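(* Let $A$ be a positively graded finite-dimensional unital algebra over an algebraically closed field $K$ with $\Lambda_0\neq\emptyset$, and let $B=\operatorname{End}_A\bigl(\bigoplus_{\lambda\in\Lambda_0}P^\lambda\bigr)$. Assume that $P^\lambda_{d_\lambda}=\operatorname{soc}(P^\lambda)\simeq L^\lambda\langle d_\lambda\rangle$ for each $\lambda\in\Lambda_0$. Then $B$ is a symmetric algebra if and only if there exists an admissible $K$-basis of $B$.
   Context: Positively graded: $A=\bigoplus_{d\ge 0}A_d$ with $A_dA_k\subset A_{d+k}$. Graded modules are finite-dimensional and $\mathbb{Z}$-graded; $M\langle k\rangle_d:=M_{d-k}$; $\operatorname{Hom}_A(M,N)_d$ is the space of homomorphisms with $f(M_k)\subset N_{k+d}$ for all $k$, and $\operatorname{Hom}_A(M,N)=\bigoplus_d\operatorname{Hom}_A(M,N)_d$; $M\simeq N$ means there is a degree-0 isomorphism. $\{L^\lambda\mid\lambda\in\Lambda\}$ is a complete set of pairwise non-isomorphic simple $A$-modules, each graded by concentration in degree $0$. The projective cover $P^\lambda$ of $L^\lambda$ is graded so that the natural map $P^\lambda\to L^\lambda$ has degree $0$, and $P^\lambda=\bigoplus_{i=0}^{d_\lambda}P^\lambda_i$ with $P^\lambda_{d_\lambda}\ne0$; this defines $d_\lambda$. $\Lambda_0:=\{\lambda\in\Lambda\mid P^\lambda\text{ is injective}\}$. Then $B=\bigoplus_{\lambda,\mu\in\Lambda_0}\operatorname{Hom}_A(P^\lambda,P^\mu)$ is positively graded. Under the socle assumption, for each $\lambda\in\Lambda_0$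 fix $0\neq\theta_\lambda\in\operatorname{End}_A(P^\lambda)$ with image $\operatorname{soc}(P^\lambda)$ (unique up to scalar; homogeneous of degree $d_\lambda$). A $K$-basis $\Upsilon$ of $B$ is appropriate if $\{\theta_\lambda\mid\lambda\in\Lambda_0\}\subseteq\Upsilon\subseteq\bigsqcup_{\lambda,\mu\in\Lambda_0}\operatorname{Hom}_A(P^\lambda,P^\mu)$. An appropriate basis consisting of homogeneous elements is admissible if for all $\lambda,\mu\in\Lambda_0$ and $j\in\mathbb{Z}$ with $\Upsilon\cap\operatorname{Hom}_A(P^\lambda,P^\mu)_j\neq\emptyset$: (i) $d_\mu=d_\lambda$; (ii) $|\Upsilon\cap\operatorname{Hom}_A(P^\mu,P^\lambda)_{d_\lambda-j}|=|\Upsilon\cap\operatorname{Hom}_A(P^\lambda,P^\mu)_j|$; (iii) for any $f\in\Upsilon\cap\operatorname{Hom}_A(P^\lambda,P^\mu)_j$ there is exactly one $g\in\Upsilon\cap\operatorname{Hom}_A(P^\mu,P^\lambda)_{d_\lambda-j}$ such that $gf=c_{gf}\theta_\lambda$, $fg=c_{fg}\theta_\mu$ for some $c_{fg}=c_{gf}\in K^\times$, and $hf=fh=0$ for all $h\in\Upsilon\cap\operatorname{Hom}_A(P^\mu,P^\lambda)_{d_\lambda-j}$ with $h\ne g$. $B$ is a symmetric algebra if there is a $K$-linear map $\tau:B\to K$ such that $(f,g)\mapsto\tau(fg)$ is symmetric and non-degenerate.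
   Formalization: The socle endomorphisms θ_λ are not fixed in advance but chosen together with the admissible basis; for arbitrarily scaled θ_λ, requiring c_fg = c_gf makes the "only if" direction fail (e.g. the zigzag algebra of type A_2). *)

theory Defs
  imports "HOL-Computational_Algebra.Polynomial" "HOL-Library.Function_Algebras"
begin

section \<open>Graded algebras and graded modules\<close>

text \<open>Pointwise scaling of functions.  In particular \<open>fscale (*)\<close> is the usual scaling of
  coordinate vectors \<open>nat \<Rightarrow> 'k\<close>.\<close>

definition fscale :: "('k \<Rightarrow> 'v \<Rightarrow> 'v) \<Rightarrow> 'k \<Rightarrow> ('x \<Rightarrow> 'v) \<Rightarrow> 'x \<Rightarrow> 'v" where
  "fscale s c f = (\<lambda>x. s c (f x))"

lemma vector_space_fscale: "vector_space s \<Longrightarrow> vector_space (fscale s)"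
  by (simp add: vector_space_def fscale_def fun_eq_iff)

definition direct_sum ::
  "('k::field \<Rightarrow> 'v::ab_group_add \<Rightarrow> 'v) \<Rightarrow> 'v set \<Rightarrow> ('i \<Rightarrow> 'v set) \<Rightarrow> bool" where
  "direct_sum s V G \<longleftrightarrow>
     (\<forall>i. module.subspace s (G i) \<and> G i \<subseteq> V) \<and>
     (\<forall>x\<in>V. \<exists>!c. (\<forall>i. c i \<in> G i) \<and> finite {i. c i \<noteq> 0} \<and> x = (\<Sum>i | c i \<noteq> 0. c i))"

locale fd_algebra = vector_space scale
  for scale :: "'k::field \<Rightarrow> 'a::ring_1 \<Rightarrow> 'a" +
  assumes scale_mult_left: "scale c (x * y) = scale c x * y"
    and scale_mult_right: "scale c (x * y) = x * scale c y"
    and finite_dim: "\<exists>S. finite S \<and> module.span scale S = UNIV"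

text \<open>Degrees of the algebra are natural numbers: this is positivity of the grading.\<close>

locale pos_graded_fd_algebra = fd_algebra scale
  for scale :: "'k::field \<Rightarrow> 'a::ring_1 \<Rightarrow> 'a" +
  fixes G :: "nat \<Rightarrow> 'a set"
  assumes grading: "direct_sum scale UNIV G"
    and grading_mult: "x \<in> G d \<Longrightarrow> y \<in> G k \<Longrightarrow> x * y \<in> G (d + k)"

text \<open>Modules are carried by subspaces of an ambient vector space, whose addition and
  scaling they inherit; the action matters only on the carrier.\<close>

record ('a, 'm) lmodule =
  car :: "'m set"
  act :: "'a \<Rightarrow> 'm \<Rightarrow> 'm"

record ('a, 'm) gmodule = "('a, 'm) lmodule" +
  grade :: "int \<Rightarrow> 'm set"

definition fd_module ::
  "('k::field \<Rightarrow> 'a::ring_1 \<Rightarrow> 'a) \<Rightarrow> ('k \<Rightarrow> 'm::ab_group_add \<Rightarrow> 'm)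
    \<Rightarrow> ('a, 'm, 'z) lmodule_scheme \<Rightarrow> bool" where
  "fd_module sA s M \<longleftrightarrow>
     vector_space s \<and>
     module.subspace s (car M) \<and>
     (\<exists>S. finite S \<and> module.span s S = car M) \<and>
     (\<forall>a. \<forall>x\<in>car M. act M a x \<in> car M) \<and>
     (\<forall>a. \<forall>x\<in>car M. \<forall>y\<in>car M. act M a (x + y) = act M a x + act M a y) \<and>
     (\<forall>a b. \<forall>x\<in>car M. act M (a + b) x = act M a x + act M b x) \<and>
     (\<forall>a b. \<forall>x\<in>car M. act M (a * b) x = act M a (act M b x)) \<and>
     (\<forall>x\<in>car M. act M 1 x = x) \<and>
     (\<forall>c a. \<forall>x\<in>car M. act M (sA c a) x = s c (act M a x))"

definition graded_module ::
  "('k::field \<Rightarrow> 'a::ring_1 \<Rightarrow> 'a) \<Rightarrow> (nat \<Rightarrow> 'a set)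
    \<Rightarrow> ('k \<Rightarrow> 'm::ab_group_add \<Rightarrow> 'm) \<Rightarrow> ('a, 'm) gmodule \<Rightarrow> bool" where
  "graded_module sA G s M \<longleftrightarrow>
     fd_module sA s M \<and>
     direct_sum s (car M) (grade M) \<and>
     (\<forall>d k. \<forall>a\<in>G d. \<forall>x\<in>grade M k. act M a x \<in> grade M (int d + k))"

definition shift :: "('a, 'm) gmodule \<Rightarrow> int \<Rightarrow> ('a, 'm) gmodule" where
  "shift M k = M\<lparr>grade := \<lambda>d. grade M (d - k)\<rparr>"

definition graded_restrict :: "('a, 'm) gmodule \<Rightarrow> 'm set \<Rightarrow> ('a, 'm) gmodule" where
  "graded_restrict M N = M\<lparr>car := N, grade := \<lambda>d. grade M d \<inter> N\<rparr>"

definition concentrated :: "('a, 'm::zero) gmodule \<Rightarrow> int \<Rightarrow> bool" where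
  "concentrated M k \<longleftrightarrow> grade M k = car M \<and> (\<forall>d. d \<noteq> k \<longrightarrow> grade M d = {0})"

definition top_degree :: "('a, 'm::zero) gmodule \<Rightarrow> int" where
  "top_degree M = Max {d. grade M d \<noteq> {0}}"

section \<open>Homomorphisms\<close>

text \<open>A homomorphism is represented by its extension by zero to the ambient space.  Equality
  of homomorphisms is then equality of functions, and sums and composites of homomorphisms
  are pointwise sums and composites of functions.  Linearity over the ground field is implied
  by compatibility with the action.\<close>

definition mod_hom ::
  "('a, 'm::ab_group_add, 'y) lmodule_scheme \<Rightarrow> ('a, 'n::ab_group_add, 'z) lmodule_scheme
    \<Rightarrow> ('m \<Rightarrow> 'n) set" where
  "mod_hom M N = {f.
     (\<forall>x\<in>car M. f x \<in> car N) \<and>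
     (\<forall>x. x \<notin> car M \<longrightarrow> f x = 0) \<and>
     (\<forall>x\<in>car M. \<forall>y\<in>car M. f (x + y) = f x + f y) \<and>
     (\<forall>a. \<forall>x\<in>car M. f (act M a x) = act N a (f x))}"

definition mod_hom_deg ::
  "('a, 'm::ab_group_add) gmodule \<Rightarrow> ('a, 'n::ab_group_add) gmodule \<Rightarrow> int \<Rightarrow> ('m \<Rightarrow> 'n) set" where
  "mod_hom_deg M N d = {f \<in> mod_hom M N. \<forall>k. f ` grade M k \<subseteq> grade N (k + d)}"

definition mod_iso ::
  "('a, 'm::ab_group_add, 'y) lmodule_scheme \<Rightarrow> ('a, 'n::ab_group_add, 'z) lmodule_scheme
    \<Rightarrow> bool" where
  "mod_iso M N \<longleftrightarrow> (\<exists>f\<in>mod_hom M N. bij_betw f (car M) (car N))"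

definition graded_iso ::
  "('a, 'm::ab_group_add) gmodule \<Rightarrow> ('a, 'n::ab_group_add) gmodule \<Rightarrow> bool" where
  "graded_iso M N \<longleftrightarrow> (\<exists>f\<in>mod_hom_deg M N 0. bij_betw f (car M) (car N))"

section \<open>Simple, projective and injective modules\<close>

text \<open>Closure under scaling and negation is implied by closure under the action.\<close>

definition submodule :: "('a, 'm::ab_group_add, 'z) lmodule_scheme \<Rightarrow> 'm set \<Rightarrow> bool" where
  "submodule M N \<longleftrightarrow>
     N \<subseteq> car M \<and> 0 \<in> N \<and> (\<forall>x\<in>N. \<forall>y\<in>N. x + y \<in> N) \<and> (\<forall>a. \<forall>x\<in>N. act M a x \<in> N)"

definition simple_module :: "('a, 'm::ab_group_add, 'z) lmodule_scheme \<Rightarrow> bool" where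
  "simple_module M \<longleftrightarrow>
     car M \<noteq> {0} \<and> (\<forall>N. submodule M N \<longrightarrow> N = {0} \<or> N = car M)"

text \<open>The sum of all simple submodules.\<close>

definition socle ::
  "('k::field \<Rightarrow> 'm::ab_group_add \<Rightarrow> 'm) \<Rightarrow> ('a, 'm, 'z) lmodule_scheme \<Rightarrow> 'm set" where
  "socle s M =
     module.span s (\<Union>{N. submodule M N \<and> simple_module (M\<lparr>car := N\<rparr>)})"

text \<open>The test objects below are the finite-dimensional modules carried by subspaces of
  \<open>nat \<Rightarrow> 'k\<close>.  Up to isomorphism these are all finite-dimensional modules, so they give
  projectivity, injectivity and completeness in the category of finite-dimensional modules.\<close>

definition projective_module ::
  "('k::field \<Rightarrow> 'a::ring_1 \<Rightarrow> 'a) \<Rightarrow> ('a, 'm::ab_group_add, 'z) lmodule_scheme \<Rightarrow> bool" where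
  "projective_module sA M \<longleftrightarrow>
     (\<forall>(X :: ('a, nat \<Rightarrow> 'k) lmodule) (Y :: ('a, nat \<Rightarrow> 'k) lmodule).
        fd_module sA (fscale (*)) X \<and> fd_module sA (fscale (*)) Y \<longrightarrow>
        (\<forall>g\<in>mod_hom X Y. g ` car X = car Y \<longrightarrow>
          (\<forall>f\<in>mod_hom M Y. \<exists>h\<in>mod_hom M X. g \<circ> h = f)))"

definition injective_module ::
  "('k::field \<Rightarrow> 'a::ring_1 \<Rightarrow> 'a) \<Rightarrow> ('a, 'm::ab_group_add, 'z) lmodule_scheme \<Rightarrow> bool" where
  "injective_module sA M \<longleftrightarrow>
     (\<forall>(X :: ('a, nat \<Rightarrow> 'k) lmodule) (Y :: ('a, nat \<Rightarrow> 'k) lmodule).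
        fd_module sA (fscale (*)) X \<and> fd_module sA (fscale (*)) Y \<longrightarrow>
        (\<forall>g\<in>mod_hom X Y. inj_on g (car X) \<longrightarrow>
          (\<forall>f\<in>mod_hom X M. \<exists>h\<in>mod_hom Y M. h \<circ> g = f)))"

definition complete_simples ::
  "('k::field \<Rightarrow> 'a::ring_1 \<Rightarrow> 'a) \<Rightarrow> ('k \<Rightarrow> 'n::ab_group_add \<Rightarrow> 'n) \<Rightarrow> 'l set
    \<Rightarrow> ('l \<Rightarrow> ('a, 'n) gmodule) \<Rightarrow> bool" where
  "complete_simples sA s \<Lambda> L \<longleftrightarrow>
     (\<forall>\<kappa>\<in>\<Lambda>. fd_module sA s (L \<kappa>) \<and> simple_module (L \<kappa>)) \<and>
     (\<forall>\<kappa>\<in>\<Lambda>. \<forall>\<mu>\<in>\<Lambda>. mod_iso (L \<kappa>) (L \<mu>) \<longrightarrow> \<kappa> = \<mu>) \<and>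
     (\<forall>X :: ('a, nat \<Rightarrow> 'k) lmodule.
        fd_module sA (fscale (*)) X \<and> simple_module X \<longrightarrow> (\<exists>\<kappa>\<in>\<Lambda>. mod_iso X (L \<kappa>)))"

text \<open>The last conjunct says that the kernel of \<open>p\<close> is superfluous.\<close>

definition projective_cover ::
  "('k::field \<Rightarrow> 'a::ring_1 \<Rightarrow> 'a) \<Rightarrow> ('a, 'm::ab_group_add, 'y) lmodule_scheme
    \<Rightarrow> ('m \<Rightarrow> 'n) \<Rightarrow> ('a, 'n::ab_group_add, 'z) lmodule_scheme \<Rightarrow> bool" where
  "projective_cover sA M p N \<longleftrightarrow>
     projective_module sA M \<and> p \<in> mod_hom M N \<and> p ` car M = car N \<and>
     (\<forall>U. submodule M U \<and> car M = {u + v |u v. u \<in> U \<and> v \<in> car M \<and> p v = 0} \<longrightarrow> U = car M)"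

section \<open>The endomorphism algebra\<close>

definition dsum ::
  "'l set \<Rightarrow> ('l \<Rightarrow> ('a, 'm::ab_group_add) gmodule) \<Rightarrow> ('a, 'l \<Rightarrow> 'm) lmodule" where
  "dsum I M =
     \<lparr>car = {x. (\<forall>i\<in>I. x i \<in> car (M i)) \<and> (\<forall>i. i \<notin> I \<longrightarrow> x i = 0) \<and> finite {i. x i \<noteq> 0}},
      act = \<lambda>a x i. if i \<in> I then act (M i) a (x i) else 0\<rparr>"

definition endo_algebra ::
  "'l set \<Rightarrow> ('l \<Rightarrow> ('a, 'm::ab_group_add) gmodule) \<Rightarrow> (('l \<Rightarrow> 'm) \<Rightarrow> ('l \<Rightarrow> 'm)) set" where
  "endo_algebra I M = mod_hom (dsum I M) (dsum I M)"

text \<open>The endomorphism of the direct sum whose only nonzero matrix entry is a given map from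
  the \<open>i\<close>-th to the \<open>j\<close>-th summand.\<close>

definition embed_hom ::
  "'l set \<Rightarrow> ('l \<Rightarrow> ('a, 'm::ab_group_add) gmodule) \<Rightarrow> 'l \<Rightarrow> 'l \<Rightarrow> ('m \<Rightarrow> 'm)
    \<Rightarrow> ('l \<Rightarrow> 'm) \<Rightarrow> ('l \<Rightarrow> 'm)" where
  "embed_hom I M i j f =
     (\<lambda>x. if x \<in> car (dsum I M) then (\<lambda>l. if l = j then f (x i) else 0) else 0)"

definition hom_block ::
  "'l set \<Rightarrow> ('l \<Rightarrow> ('a, 'm::ab_group_add) gmodule) \<Rightarrow> 'l \<Rightarrow> 'l
    \<Rightarrow> (('l \<Rightarrow> 'm) \<Rightarrow> ('l \<Rightarrow> 'm)) set" where
  "hom_block I M i j = embed_hom I M i j ` mod_hom (M i) (M j)"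

definition hom_block_deg ::
  "'l set \<Rightarrow> ('l \<Rightarrow> ('a, 'm::ab_group_add) gmodule) \<Rightarrow> 'l \<Rightarrow> 'l \<Rightarrow> int
    \<Rightarrow> (('l \<Rightarrow> 'm) \<Rightarrow> ('l \<Rightarrow> 'm)) set" where
  "hom_block_deg I M i j d = embed_hom I M i j ` mod_hom_deg (M i) (M j) d"

text \<open>\<open>B\<close> is an algebra of maps under composition.\<close>

definition symmetric_algebra ::
  "('k::field \<Rightarrow> ('x \<Rightarrow> 'x) \<Rightarrow> ('x \<Rightarrow> 'x)) \<Rightarrow> ('x \<Rightarrow> 'x::ab_group_add) set \<Rightarrow> bool" where
  "symmetric_algebra s B \<longleftrightarrow>
     (\<exists>\<tau> :: ('x \<Rightarrow> 'x) \<Rightarrow> 'k.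
        (\<forall>f\<in>B. \<forall>g\<in>B. \<tau> (f + g) = \<tau> f + \<tau> g) \<and>
        (\<forall>c. \<forall>f\<in>B. \<tau> (s c f) = c * \<tau> f) \<and>
        (\<forall>f\<in>B. \<forall>g\<in>B. \<tau> (f \<circ> g) = \<tau> (g \<circ> f)) \<and>
        (\<forall>f\<in>B. (\<forall>g\<in>B. \<tau> (f \<circ> g) = 0) \<longrightarrow> f = 0))"

section \<open>Admissible bases\<close>

definition socle_endos ::
  "('k::field \<Rightarrow> 'm::ab_group_add \<Rightarrow> 'm) \<Rightarrow> 'l set \<Rightarrow> ('l \<Rightarrow> ('a, 'm) gmodule)
    \<Rightarrow> ('l \<Rightarrow> 'm \<Rightarrow> 'm) \<Rightarrow> bool" where
  "socle_endos s I P \<theta> \<longleftrightarrow>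
     (\<forall>\<kappa>\<in>I. \<theta> \<kappa> \<in> mod_hom (P \<kappa>) (P \<kappa>) \<and> \<theta> \<kappa> \<noteq> 0 \<and>
        \<theta> \<kappa> ` car (P \<kappa>) = socle s (P \<kappa>))"

definition appropriate_basis ::
  "('k::field \<Rightarrow> 'm::ab_group_add \<Rightarrow> 'm) \<Rightarrow> 'l set \<Rightarrow> ('l \<Rightarrow> ('a, 'm) gmodule)
    \<Rightarrow> ('l \<Rightarrow> 'm \<Rightarrow> 'm) \<Rightarrow> (('l \<Rightarrow> 'm) \<Rightarrow> ('l \<Rightarrow> 'm)) set \<Rightarrow> bool" where
  "appropriate_basis s I P \<theta> \<Upsilon> \<longleftrightarrow>
     \<not> module.dependent (fscale (fscale s)) \<Upsilon> \<and>
     module.span (fscale (fscale s)) \<Upsilon> = endo_algebra I P \<and>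
     (\<lambda>\<kappa>. embed_hom I P \<kappa> \<kappa> (\<theta> \<kappa>)) ` I \<subseteq> \<Upsilon> \<and>
     \<Upsilon> \<subseteq> (\<Union>\<kappa>\<in>I. \<Union>\<mu>\<in>I. hom_block I P \<kappa> \<mu>)"

definition admissible_basis ::
  "('k::field \<Rightarrow> 'm::ab_group_add \<Rightarrow> 'm) \<Rightarrow> 'l set \<Rightarrow> ('l \<Rightarrow> ('a, 'm) gmodule)
    \<Rightarrow> ('l \<Rightarrow> 'm \<Rightarrow> 'm) \<Rightarrow> (('l \<Rightarrow> 'm) \<Rightarrow> ('l \<Rightarrow> 'm)) set \<Rightarrow> bool" where
  "admissible_basis s I P \<theta> \<Upsilon> \<longleftrightarrow>
     appropriate_basis s I P \<theta> \<Upsilon> \<and>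
     \<Upsilon> \<subseteq> (\<Union>\<kappa>\<in>I. \<Union>\<mu>\<in>I. \<Union>j. hom_block_deg I P \<kappa> \<mu> j) \<and>
     (\<forall>\<kappa>\<in>I. \<forall>\<mu>\<in>I. \<forall>j.
        let F = \<Upsilon> \<inter> hom_block_deg I P \<kappa> \<mu> j;
            G = \<Upsilon> \<inter> hom_block_deg I P \<mu> \<kappa> (top_degree (P \<kappa>) - j);
            \<theta>' = (\<lambda>\<nu>. embed_hom I P \<nu> \<nu> (\<theta> \<nu>))
        in F \<noteq> {} \<longrightarrow>
          top_degree (P \<mu>) = top_degree (P \<kappa>) \<and>
          card G = card F \<and>
          (\<forall>f\<in>F. \<exists>!g. g \<in> G \<and>
             (\<exists>c. c \<noteq> 0 \<and> g \<circ> f = fscale (fscale s) c (\<theta>' \<kappa>) \<and>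
                          f \<circ> g = fscale (fscale s) c (\<theta>' \<mu>)) \<and>
             (\<forall>h\<in>G. h \<noteq> g \<longrightarrow> h \<circ> f = 0 \<and> f \<circ> h = 0)))"

end

(* A symmetrizing form and an admissible basis both come from one linear functional tr on B,
   the sum of the coefficients of the socle endomorphisms theta_i.  It vanishes on every
   homogeneous block Hom(P_i, P_j)_e except End(P_i)_{d_i}, which Schur's lemma shows to be
   spanned by theta_i.  If an admissible basis is given, its partner condition says that
   (f, g) -> tr (f o g) is symmetric and nondegenerate.  Conversely, a nonzero f : P_i -> P_j has
   the simple socle of P_j in its image, so by projectivity theta_j = f o g for some g.  With a
   symmetrizing form normalized to 1 on every theta_i, this gives d_i = d_j and makes the form
   tr (f o g) symmetric and nondegenerate on homogeneous elements; a maximal set of homogeneous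
   elements containing the theta_i in which everyone has exactly one non-orthogonal partner is
   then an admissible basis. *)

theory Submission
  imports Defs
begin

section \<open>Linear algebra and modules\<close>

text \<open>A symmetrizing form \<tau> need not respect the grading and need not take equal values
  on arbitrarily chosen \<theta>_i. Normalization makes it agree with \<open>tr\<close> on the
  blocks End(P_i)_{d_i}; since \<open>tr\<close> vanishes elsewhere, that much agreement already
  carries symmetry over to \<open>tr\<close>. The normalization is forced: an admissible basis asks
  for one scalar c in g o f = c \<theta>_i and f o g = c \<theta>_j, and applying \<tau> gives equal
  values on \<theta>_i and \<theta>_j. This is why \<theta> is chosen together with the basis.
  Nondegeneracy guarantees that \<tau> is nonzero on every \<theta>_i.

  An orthogonal basis cannot be expected: \<theta>_i is isotropic for d_i > 0, and in characteristic
  2 a form may be alternating. Hence partners, and hence the starting set, which joins to \<theta>_i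
  its natural partner, the identity of P_i, when d_i > 0.

  Homomorphisms out of P_i are controlled by a generator of degree 0, whose image determines them;
  this bounds their degrees and dimensions. Algebraic closedness supplies the eigenvalue in Schur's
  lemma.\<close>

lemma subspace_finite_span:
  assumes "vector_space s" "module.subspace s U" "U \<subseteq> module.span s S" "finite S"
  shows "\<exists>T. finite T \<and> \<not> module.dependent s T \<and> module.span s T = U"
proof -
  interpret vector_space s by fact
  obtain T where T: "T \<subseteq> U" "independent T" "U \<subseteq> span T"
    using maximal_independent_subset by blast
  have "finite T"
    using T assms independent_span_bound by blast
  moreover have "span T = U"
    using T assms(2) by (simp add: span_minimal subset_antisym)
  ultimately show ?thesis using T by blast
qed

text \<open>More than \<open>card S\<close> vectors in the span of \<open>S\<close> satisfy a linear
  relation, whose coefficients are read as a polynomial. A sequence in place of powers of a map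
  leaves open where the map is linear.\<close>

lemma exists_annihilating_polynomial:
  fixes s :: "'k::field \<Rightarrow> 'v::ab_group_add \<Rightarrow> 'v" and f :: "nat \<Rightarrow> 'v"
  assumes "vector_space s" "finite S" "\<And>i. f i \<in> module.span s S"
  shows "\<exists>p::'k poly. p \<noteq> 0 \<and> (\<Sum>i\<le>degree p. s (coeff p i) (f i)) = 0"
proof -
  interpret vector_space s by fact
  define n where "n = card S"
  have "\<exists>a. (\<exists>i\<le>n. a i \<noteq> 0) \<and> (\<Sum>i\<le>n. s (a i) (f i)) = 0"
  \<comment> \<open>Dependence is a property of sets, so a repeated term of the sequence has to be
    treated separately.\<close>
  proof (cases "inj_on f {..n}")
    case False
    then obtain i j where ij: "i \<le> n" "j \<le> n" "i \<noteq> j" "f i = f j"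
      by (auto simp: inj_on_def)
    define a :: "nat \<Rightarrow> 'k" where "a = (\<lambda>k. if k = i then 1 else if k = j then - 1 else 0)"
    have "(\<Sum>k\<le>n. s (a k) (f k)) = (\<Sum>k\<in>{i, j}. s (a k) (f k))"
      by (rule sum.mono_neutral_right) (use ij in \<open>auto simp: a_def\<close>)
    also have "\<dots> = 0" using ij by (simp add: a_def)
    finally show ?thesis using ij by (intro exI[of _ a]) (auto simp: a_def)
  next
    case True
    have "card (f ` {..n}) = Suc n" using True by (simp add: card_image)
    then have "dependent (f ` {..n})"
      using independent_span_bound[OF assms(2), of "f ` {..n}"] assms(3) n_def by fastforce
    then obtain u where u: "\<exists>v\<in>f ` {..n}. u v \<noteq> 0" "(\<Sum>v\<in>f ` {..n}. s (u v) v) = 0"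
      by (auto simp: dependent_finite)
    then show ?thesis
      using True by (intro exI[of _ "u \<circ> f"]) (auto simp: sum.reindex)
  qed
  then obtain a where a: "\<exists>i\<le>n. a i \<noteq> 0" "(\<Sum>i\<le>n. s (a i) (f i)) = 0" by blast
  define p where "p = (\<Sum>i\<le>n. monom (a i) i)"
  have c: "coeff p i = (if i \<le> n then a i else 0)" for i
    by (simp add: p_def coeff_sum)
  have "degree p \<le> n" by (rule degree_le) (simp add: c)
  have "(\<Sum>i\<le>degree p. s (coeff p i) (f i)) = (\<Sum>i\<le>n. s (coeff p i) (f i))"
    by (rule sum.mono_neutral_left) (use \<open>degree p \<le> n\<close> in \<open>auto simp: coeff_eq_0\<close>)
  also have "\<dots> = 0" using a by (simp add: c)
  finally show ?thesis using a c by (intro exI[of _ p]) (metis coeff_0)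
qed

lemma additive_on_zero:
  fixes f :: "'v::ab_group_add \<Rightarrow> 'w::ab_group_add"
  assumes "0 \<in> V" "\<And>x y. x \<in> V \<Longrightarrow> y \<in> V \<Longrightarrow> f (x + y) = f x + f y"
  shows "f 0 = 0"
  using assms(2)[OF assms(1) assms(1)] by simp

lemma additive_on_sum:
  fixes f :: "'v::ab_group_add \<Rightarrow> 'w::ab_group_add"
  assumes "0 \<in> V" "\<And>x y. x \<in> V \<Longrightarrow> y \<in> V \<Longrightarrow> x + y \<in> V"
    and add: "\<And>x y. x \<in> V \<Longrightarrow> y \<in> V \<Longrightarrow> f (x + y) = f x + f y"
    and "\<And>i. i \<in> K \<Longrightarrow> g i \<in> V"
  shows "f (sum g K) = (\<Sum>i\<in>K. f (g i))"
proof -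
  have f0: "f 0 = 0" using assms(1) add by (rule additive_on_zero)
  have "sum g K \<in> V \<and> f (sum g K) = (\<Sum>i\<in>K. f (g i))"
    using assms(4)
  proof (induction K rule: infinite_finite_induct)
    case (insert i K)
    then show ?case using assms(2) add by auto
  qed (use assms(1) f0 in auto)
  then show ?thesis ..
qed

text \<open>Homomorphisms are extended by zero and hence linear on their carrier only, so
  \<open>T\<close> is assumed linear on \<open>V\<close> alone. A nonzero polynomial p of least
  degree with p(T) v = 0 has a root c; writing p = (X - c) q, minimality makes q(T) v a nonzero
  eigenvector.\<close>

lemma exists_eigenvector:
  fixes s :: "'k::alg_closed_field \<Rightarrow> 'v::ab_group_add \<Rightarrow> 'v"
  assumes vs: "vector_space s" and "finite S" and V: "module.span s S = V" and "V \<noteq> {0}"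
    and T: "\<And>x. x \<in> V \<Longrightarrow> T x \<in> V"
    and add: "\<And>x y. x \<in> V \<Longrightarrow> y \<in> V \<Longrightarrow> T (x + y) = T x + T y"
    and scal: "\<And>c x. x \<in> V \<Longrightarrow> T (s c x) = s c (T x)"
  shows "\<exists>c. \<exists>v\<in>V. v \<noteq> 0 \<and> T v = s c v"
proof -
  interpret vector_space s by fact
  have sub: "subspace V" using V by auto
  obtain v where v: "v \<in> V" "v \<noteq> 0"
    using \<open>V \<noteq> {0}\<close> subspace_0[OF sub] by blast
  have pow: "(T ^^ i) v \<in> V" for i by (induction i) (use v T in auto)
  \<comment> \<open>\<open>E p\<close> is p(T) v. Linearity of \<open>T\<close> on \<open>V\<close>
    suffices for its compatibility with multiplication by X.\<close>
  define E where "E p = (\<Sum>i\<le>degree p. s (coeff p i) ((T ^^ i) v))" for p :: "'k poly"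
  have E_eq: "E p = (\<Sum>i\<le>n. s (coeff p i) ((T ^^ i) v))" if "degree p \<le> n" for p n
    unfolding E_def by (rule sum.mono_neutral_left) (use that in \<open>auto simp: coeff_eq_0\<close>)
  have EV: "E p \<in> V" for p
    unfolding E_def using sub pow by (intro subspace_sum subspace_scale) auto
  have E_shift: "E (pCons 0 q) = T (E q)" for q
  proof -
    have "E (pCons 0 q) = (\<Sum>i\<le>Suc (degree q). s (coeff (pCons 0 q) i) ((T ^^ i) v))"
      by (rule E_eq) (simp add: degree_pCons_le)
    also have "\<dots> = (\<Sum>i\<le>degree q. s (coeff q i) (T ((T ^^ i) v)))"
      by (subst sum.atMost_Suc_shift) simp
    also have "\<dots> = T (E q)"
      unfolding E_def
      by (subst additive_on_sum[where V = V and f = T])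
        (use sub pow add scal in \<open>auto simp: subspace_0 subspace_add subspace_scale\<close>)
    finally show ?thesis .
  qed
  have E_add: "E (smult c q + r) = s c (E q) + E r" for c q r
  proof -
    define n where "n = max (degree q) (degree r)"
    have "degree (smult c q + r) \<le> n"
      by (rule degree_add_le) (auto simp: n_def intro: order.trans[OF degree_smult_le])
    then show ?thesis
      by (simp add: E_eq[of _ n] n_def scale_sum_right sum.distrib scale_left_distrib)
  qed
  obtain p0 where "p0 \<noteq> 0" "E p0 = 0"
    using exists_annihilating_polynomial[OF vs \<open>finite S\<close>, of "\<lambda>i. (T ^^ i) v"] pow V
    unfolding E_def by blast
  then obtain p where p: "p \<noteq> 0" "E p = 0"
    and least: "\<And>q. q \<noteq> 0 \<Longrightarrow> E q = 0 \<Longrightarrow> degree p \<le> degree q"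
    using ex_has_least_nat[of "\<lambda>p. p \<noteq> 0 \<and> E p = 0" p0 degree] by blast
  have "degree p > 0"
  proof (rule ccontr)
    assume "\<not> degree p > 0"
    then obtain c where "p = [:c:]" by (metis degree_eq_zeroE gr0I)
    then show False using p v by (simp add: E_def)
  qed
  then obtain c where "poly p c = 0" using alg_closed_imp_poly_has_root by blast
  then obtain q where q: "p = [:- c, 1:] * q" by (auto simp: poly_eq_0_iff_dvd)
  have "q \<noteq> 0" using p q by auto
  then have "degree p = Suc (degree q)" by (simp add: q degree_mult_eq del: mult_pCons_left)
  then have "E q \<noteq> 0" using least[OF \<open>q \<noteq> 0\<close>] by auto
  have "p = smult (- c) q + pCons 0 q" by (simp add: q)
  then have "E p = s (- c) (E q) + T (E q)" using E_add E_shift by metis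
  then have "0 = s (- c) (E q) + T (E q)" using p(2) by simp
  then have "T (E q) = s c (E q)" by (simp add: scale_minus_left)
  then show ?thesis using \<open>E q \<noteq> 0\<close> EV by blast
qed

section \<open>Modules over the algebra, their homomorphisms and submodules\<close>

lemma fd_moduleD:
  assumes "fd_module sA s M"
  shows "vector_space s" "module.subspace s (car M)"
    "\<exists>S. finite S \<and> module.span s S = car M"
    "x \<in> car M \<Longrightarrow> act M a x \<in> car M"
    "x \<in> car M \<Longrightarrow> y \<in> car M \<Longrightarrow> act M a (x + y) = act M a x + act M a y"
    "x \<in> car M \<Longrightarrow> act M (a + b) x = act M a x + act M b x"
    "x \<in> car M \<Longrightarrow> act M (a * b) x = act M a (act M b x)"
    "x \<in> car M \<Longrightarrow> act M 1 x = x"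
    "x \<in> car M \<Longrightarrow> act M (sA c a) x = s c (act M a x)"
  using assms unfolding fd_module_def by blast+

lemma fd_module_closed:
  assumes "fd_module sA s M"
  shows "0 \<in> car M" "x \<in> car M \<Longrightarrow> y \<in> car M \<Longrightarrow> x + y \<in> car M"
    "x \<in> car M \<Longrightarrow> y \<in> car M \<Longrightarrow> x - y \<in> car M"
    "x \<in> car M \<Longrightarrow> s c x \<in> car M"
    "(\<And>i. i \<in> K \<Longrightarrow> g i \<in> car M) \<Longrightarrow> sum g K \<in> car M"
proof -
  interpret vector_space s using fd_moduleD(1)[OF assms] .
  note sub = fd_moduleD(2)[OF assms]
  show "0 \<in> car M" "x \<in> car M \<Longrightarrow> y \<in> car M \<Longrightarrow> x + y \<in> car M"
    "x \<in> car M \<Longrightarrow> y \<in> car M \<Longrightarrow> x - y \<in> car M"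
    "x \<in> car M \<Longrightarrow> s c x \<in> car M"
    "(\<And>i. i \<in> K \<Longrightarrow> g i \<in> car M) \<Longrightarrow> sum g K \<in> car M"
    using sub by (auto simp: subspace_0 subspace_add subspace_diff subspace_scale subspace_sum)
qed

lemma act_zero:
  assumes "fd_module sA s M"
  shows "act M a 0 = 0" "x \<in> car M \<Longrightarrow> act M 0 x = 0"
proof -
  show "act M a 0 = 0"
    by (rule additive_on_zero[of "car M"])
      (use fd_module_closed(1)[OF assms] fd_moduleD(5)[OF assms] in auto)
  show "act M 0 x = 0" if "x \<in> car M"
    by (rule additive_on_zero[of UNIV "\<lambda>a. act M a x"])
      (use fd_moduleD(6)[OF assms] that in auto)
qed

lemma act_sum:
  assumes "fd_module sA s M"
  shows "(\<And>i. i \<in> K \<Longrightarrow> g i \<in> car M) \<Longrightarrow> act M a (sum g K) = (\<Sum>i\<in>K. act M a (g i))"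
    and "x \<in> car M \<Longrightarrow> act M (sum h K) x = (\<Sum>i\<in>K. act M (h i) x)"
proof -
  show "act M a (sum g K) = (\<Sum>i\<in>K. act M a (g i))" if "\<And>i. i \<in> K \<Longrightarrow> g i \<in> car M"
    by (rule additive_on_sum[of "car M"])
      (use fd_module_closed(1,2)[OF assms] fd_moduleD(5)[OF assms] that in auto)
  show "act M (sum h K) x = (\<Sum>i\<in>K. act M (h i) x)" if "x \<in> car M"
    by (rule additive_on_sum[of UNIV "\<lambda>a. act M a x"])
      (use fd_moduleD(6)[OF assms] that in auto)
qed

text \<open>The field acts through the multiples of the unit; this is why maps compatible with
  addition and the action are linear, and why submodules are subspaces.\<close>

lemma scale_conv_act:
  assumes "fd_module sA s M" "x \<in> car M"
  shows "s c x = act M (sA c 1) x"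
  using fd_moduleD(8,9)[OF assms] by simp

text \<open>The element \<open>sA c 1\<close> is central in the algebra.\<close>

lemma act_scale:
  assumes "fd_module sA s M" "fd_algebra sA" "x \<in> car M"
  shows "act M a (s c x) = s c (act M a x)"
proof -
  interpret fd_algebra sA by fact
  have "a * sA c 1 = sA c 1 * a"
    by (metis mult_1 mult_1_right scale_mult_left scale_mult_right)
  then show ?thesis
    using assms(3) by (simp add: scale_conv_act[OF assms(1)] fd_moduleD(4)[OF assms(1)]
        flip: fd_moduleD(7)[OF assms(1)])
qed

lemma mod_homD:
  assumes "f \<in> mod_hom M N"
  shows "x \<in> car M \<Longrightarrow> f x \<in> car N" "x \<notin> car M \<Longrightarrow> f x = 0"
    "x \<in> car M \<Longrightarrow> y \<in> car M \<Longrightarrow> f (x + y) = f x + f y"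
    "x \<in> car M \<Longrightarrow> f (act M a x) = act N a (f x)"
  using assms unfolding mod_hom_def by auto

lemma mod_homI:
  assumes "\<And>x. x \<in> car M \<Longrightarrow> f x \<in> car N" "\<And>x. x \<notin> car M \<Longrightarrow> f x = 0"
    "\<And>x y. x \<in> car M \<Longrightarrow> y \<in> car M \<Longrightarrow> f (x + y) = f x + f y"
    "\<And>a x. x \<in> car M \<Longrightarrow> f (act M a x) = act N a (f x)"
  shows "f \<in> mod_hom M N"
  using assms unfolding mod_hom_def by blast

lemma mod_hom_zero:
  assumes "f \<in> mod_hom M N"
  shows "f 0 = 0"
  using mod_homD(2,3)[OF assms, of 0] additive_on_zero[of "car M" f] mod_homD(3)[OF assms]
  by blast

lemma mod_hom_scale:
  assumes "fd_module sA s M" "fd_module sA s' N" "f \<in> mod_hom M N" "x \<in> car M"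
  shows "f (s c x) = s' c (f x)"
  using assms(4) mod_homD(1,4)[OF assms(3)]
  by (simp add: scale_conv_act[OF assms(1)] scale_conv_act[OF assms(2)])

lemma mod_hom_diff:
  assumes "fd_module sA s M" "f \<in> mod_hom M N" "x \<in> car M" "y \<in> car M"
  shows "f (x - y) = f x - f y"
  using mod_homD(3)[OF assms(2), of "x - y" y] assms fd_module_closed(3) by fastforce

lemma mod_hom_comp:
  assumes "f \<in> mod_hom M N" "g \<in> mod_hom N Q"
  shows "g \<circ> f \<in> mod_hom M Q"
  by (rule mod_homI) (use mod_homD[OF assms(1)] mod_homD[OF assms(2)] mod_hom_zero[OF assms(2)]
    in auto)

lemma mod_hom_add:
  assumes "fd_module sA s N" "f \<in> mod_hom M N" "g \<in> mod_hom M N"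
  shows "f + g \<in> mod_hom M N"
  by (rule mod_homI) (use mod_homD[OF assms(2)] mod_homD[OF assms(3)] in
    \<open>auto simp: fd_module_closed[OF assms(1)] fd_moduleD[OF assms(1)]\<close>)

lemma mod_hom_fscale:
  assumes "fd_module sA s N" "fd_algebra sA" "f \<in> mod_hom M N"
  shows "fscale s c f \<in> mod_hom M N"
proof -
  interpret vector_space s using fd_moduleD(1)[OF assms(1)] .
  show ?thesis
    by (rule mod_homI) (use mod_homD[OF assms(3)] in
      \<open>auto simp: fd_module_closed[OF assms(1)] fscale_def scale_right_distrib
        act_scale[OF assms(1,2)]\<close>)
qed

lemma zero_mod_hom:
  assumes "fd_module sA s N"
  shows "0 \<in> mod_hom M N"
  by (rule mod_homI) (auto simp: fd_module_closed[OF assms] act_zero[OF assms])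

lemma submoduleD:
  assumes "submodule M N"
  shows "N \<subseteq> car M" "0 \<in> N" "x \<in> N \<Longrightarrow> y \<in> N \<Longrightarrow> x + y \<in> N" "x \<in> N \<Longrightarrow> act M a x \<in> N"
  using assms unfolding submodule_def by auto

lemma submodule_subspace:
  assumes "fd_module sA s M" "submodule M N"
  shows "module.subspace s N"
proof -
  interpret vector_space s using fd_moduleD(1)[OF assms(1)] .
  show ?thesis
    using submoduleD[OF assms(2)] by (simp add: subspace_def scale_conv_act[OF assms(1)] subset_eq)
qed

lemma fd_module_submodule:
  assumes "fd_module sA s M" "submodule M N"
  shows "fd_module sA s (M\<lparr>car := N\<rparr>)"
proof -
  note sub = submodule_subspace[OF assms]
  obtain S where S: "finite S" "module.span s S = car M" using fd_moduleD(3)[OF assms(1)] by blast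
  have "\<exists>T. finite T \<and> module.span s T = N"
    using subspace_finite_span[OF fd_moduleD(1)[OF assms(1)] sub _ S(1)] S submoduleD(1)[OF assms(2)]
    by auto
  moreover have "x \<in> car M" if "x \<in> N" for x using that submoduleD(1)[OF assms(2)] by auto
  ultimately show ?thesis
    using sub submoduleD[OF assms(2)] fd_moduleD[OF assms(1)]
    unfolding fd_module_def by simp
qed

lemma submodule_kernel:
  assumes "fd_module sA s M" "fd_module sA s' N" "f \<in> mod_hom M N"
  shows "submodule M {x \<in> car M. f x = 0}"
  using mod_homD(3,4)[OF assms(3)] mod_hom_zero[OF assms(3)] unfolding submodule_def
  by (auto simp: fd_module_closed[OF assms(1)] fd_moduleD[OF assms(1)] act_zero[OF assms(2)])

lemma submodule_image:
  assumes "fd_module sA s M" "f \<in> mod_hom M N" "submodule M U"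
  shows "submodule N (f ` U)"
proof -
  note U = submoduleD[OF assms(3)]
  have "f x + f y \<in> f ` U" if "x \<in> U" "y \<in> U" for x y
    using mod_homD(3)[OF assms(2), of x y] that U by (metis image_eqI subsetD)
  moreover have "act N a (f x) \<in> f ` U" if "x \<in> U" for a x
    using mod_homD(4)[OF assms(2), of x a] that U by (metis image_eqI subsetD)
  moreover have "0 \<in> f ` U" using U(2) mod_hom_zero[OF assms(2)] by force
  ultimately show ?thesis
    using U mod_homD(1)[OF assms(2)] unfolding submodule_def by auto
qed

lemma submodule_car:
  assumes "fd_module sA s M"
  shows "submodule M (car M)" "submodule M {0}"
  unfolding submodule_def
  by (auto simp: fd_module_closed[OF assms] fd_moduleD[OF assms] act_zero[OF assms])

lemma mod_hom_corestrict:
  assumes "f \<in> mod_hom M N" "f ` car M \<subseteq> U"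
  shows "f \<in> mod_hom M (N\<lparr>car := U\<rparr>)"
  by (rule mod_homI) (use assms(2) mod_homD[OF assms(1)] in auto)

lemma mod_hom_inverse:
  assumes fd: "fd_module sA s M" and f: "f \<in> mod_hom M N" and bij: "bij_betw f (car M) (car N)"
  obtains g where "g \<in> mod_hom N M" "\<And>x. x \<in> car M \<Longrightarrow> g (f x) = x"
    "\<And>y. y \<in> car N \<Longrightarrow> f (g y) = y"
proof -
  define g where "g y = (if y \<in> car N then inv_into (car M) f y else 0)" for y
  have gf: "g (f x) = x" if "x \<in> car M" for x
    using bij that mod_homD(1)[OF f] by (simp add: g_def bij_betw_inv_into_left)
  have fg: "f (g y) = y" "g y \<in> car M" if "y \<in> car N" for y
    using bij that by (auto simp: g_def bij_betw_inv_into_right bij_betw_def inv_into_into)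
  have "g \<in> mod_hom N M"
  proof (rule mod_homI)
    fix x y assume "x \<in> car N" "y \<in> car N"
    then show "g (x + y) = g x + g y"
      using gf[of "g x + g y"] fg fd_module_closed(2)[OF fd] mod_homD(3)[OF f] by metis
  next
    fix a x assume "x \<in> car N"
    then show "g (act N a x) = act M a (g x)"
      using gf[of "act M a (g x)"] fg fd_moduleD(4)[OF fd] mod_homD(4)[OF f] by metis
  qed (use fg in \<open>auto simp: g_def\<close>)
  then show thesis using that gf fg by blast
qed

text \<open>Elements with equal image under \<open>p\<close> differ by an element of its kernel,
  which \<open>h\<close> kills, so any choice of preimage gives the same value.\<close>

lemma mod_hom_factor:
  assumes fd: "fd_module sA s M" and p: "p \<in> mod_hom M N" "p ` car M = car N"
    and h: "h \<in> mod_hom M Q" and ker: "\<And>x. x \<in> car M \<Longrightarrow> p x = 0 \<Longrightarrow> h x = 0"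
  obtains k where "k \<in> mod_hom N Q" "\<And>x. x \<in> car M \<Longrightarrow> k (p x) = h x"
proof -
  define k where "k y = (if y \<in> car N then h (inv_into (car M) p y) else 0)" for y
  have kp: "k (p x) = h x" if x: "x \<in> car M" for x
  proof -
    define x' where "x' = inv_into (car M) p (p x)"
    have x': "x' \<in> car M" "p x' = p x"
      using x by (auto simp: x'_def inv_into_into f_inv_into_f)
    then have "h (x - x') = 0"
      using ker[of "x - x'"] mod_hom_diff[OF fd p(1)] fd_module_closed(3)[OF fd] x by auto
    then have "h x = h x'" using mod_hom_diff[OF fd h] x x' by auto
    then show ?thesis using x mod_homD(1)[OF p(1)] by (simp add: k_def x'_def)
  qed
  have "k \<in> mod_hom N Q"
  proof (rule mod_homI)
    fix y assume "y \<in> car N"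
    then show "k y \<in> car Q" using p(2) kp mod_homD(1)[OF h] by (metis imageE)
  next
    fix y z assume "y \<in> car N" "z \<in> car N"
    then obtain u v where "u \<in> car M" "p u = y" "v \<in> car M" "p v = z"
      using p(2) by (metis imageE)
    then show "k (y + z) = k y + k z"
      using kp[of "u + v"] kp[of u] kp[of v] fd_module_closed(2)[OF fd]
        mod_homD(3)[OF p(1)] mod_homD(3)[OF h] by metis
  next
    fix a y assume "y \<in> car N"
    then obtain u where "u \<in> car M" "p u = y" using p(2) by (metis imageE)
    then show "k (act N a y) = act Q a (k y)"
      using kp[of "act M a u"] kp[of u] fd_moduleD(4)[OF fd]
        mod_homD(4)[OF p(1)] mod_homD(4)[OF h] by metis
  qed (simp add: k_def)
  then show thesis using that kp by blast
qed

section \<open>Simple modules, simple submodules and coordinates\<close>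

lemma simple_moduleD:
  assumes "simple_module M" "submodule M N" "N \<noteq> {0}"
  shows "N = car M"
  using assms unfolding simple_module_def by blast

lemma simple_module_iso:
  assumes "fd_module sA s M" "f \<in> mod_hom M N" "bij_betw f (car M) (car N)" "simple_module N"
  shows "simple_module M"
  unfolding simple_module_def
proof (intro conjI allI impI)
  have inj: "inj_on f (car M)" and im: "f ` car M = car N" using assms(3) by (auto simp: bij_betw_def)
  have f0: "f ` {0} = {0}" using mod_hom_zero[OF assms(2)] by simp
  show "car M \<noteq> {0}" using assms(4) im f0 unfolding simple_module_def by metis
  fix U assume U: "submodule M U"
  then have "f ` U = {0} \<or> f ` U = car N"
    using assms(4) submodule_image[OF assms(1,2)] unfolding simple_module_def by blast
  then have "f ` U = f ` {0} \<or> f ` U = f ` car M" using f0 im by simp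
  then show "U = {0} \<or> U = car M"
    using inj submoduleD(1)[OF U] fd_module_closed(1)[OF assms(1)]
    by (metis empty_subsetI inj_on_image_eq_iff insert_subset order_refl)
qed

text \<open>A nonzero submodule of \<open>U\<close> of least dimension is simple.\<close>

lemma exists_simple_submodule:
  assumes fd: "fd_module sA s M" and U: "submodule M U" "U \<noteq> {0}"
  shows "\<exists>N\<subseteq>U. submodule M N \<and> simple_module (M\<lparr>car := N\<rparr>)"
proof -
  interpret vector_space s using fd_moduleD(1)[OF fd] .
  obtain S where S: "finite S" "span S = car M" using fd_moduleD(3)[OF fd] by blast
  obtain N where N: "submodule M N" "N \<noteq> {0}" "N \<subseteq> U"
    and least: "\<And>N'. submodule M N' \<and> N' \<noteq> {0} \<and> N' \<subseteq> U \<Longrightarrow> dim N \<le> dim N'"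
    using ex_has_least_nat[of "\<lambda>N. submodule M N \<and> N \<noteq> {0} \<and> N \<subseteq> U" U dim] U by blast
  have "simple_module (M\<lparr>car := N\<rparr>)"
    unfolding simple_module_def
  proof (intro conjI allI impI)
    fix N' assume N': "submodule (M\<lparr>car := N\<rparr>) N'"
    then have sN': "submodule M N'" "N' \<subseteq> N"
      using submoduleD(1)[OF N(1)] unfolding submodule_def by auto
    show "N' = {0} \<or> N' = car (M\<lparr>car := N\<rparr>)"
    proof (rule ccontr)
      assume contr: "\<not> ?thesis"
      \<comment> \<open>A basis of \<open>N'\<close> extended to one of \<open>N\<close> must gain a
        vector, so a proper submodule has strictly smaller dimension.\<close>
      obtain T' where T': "T' \<subseteq> N'" "independent T'" "N' \<subseteq> span T'"
        using maximal_independent_subset by blast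
      obtain T where T: "T' \<subseteq> T" "T \<subseteq> N" "independent T" "N \<subseteq> span T"
        using maximal_independent_subset_extend[of T' N] T' sN' by blast
      have "finite T"
        using independent_span_bound[OF S(1) T(3)] T(2) submoduleD(1)[OF N(1)] S(2) by blast
      have "T' \<noteq> T"
      proof
        assume "T' = T"
        then have "N \<subseteq> N'"
          using T(4) T'(1) span_minimal[OF _ submodule_subspace[OF fd sN'(1)]] by blast
        then show False using contr sN' by auto
      qed
      then have "card T' < card T" using T(1) \<open>finite T\<close> by (simp add: psubset_card_mono)
      moreover have "dim N = card T" "dim N' = card T'"
        using basis_card_eq_dim T T' by metis+
      moreover have "dim N \<le> dim N'" using least[of N'] sN' N contr by auto
      ultimately show False by simp
    qed
  qed (use N in auto)
  then show ?thesis using N by blast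
qed

lemma independent_unit_functions:
  fixes e :: "'i \<Rightarrow> 'i \<Rightarrow> 'k::field"
  assumes "\<And>i. e i = (\<lambda>j. if j = i then 1 else 0)"
  shows "\<not> module.dependent (fscale (*)) (e ` K)"
proof -
  have vk: "vector_space ((*) :: 'k \<Rightarrow> 'k \<Rightarrow> 'k)"
    by unfold_locales (auto simp: algebra_simps)
  interpret v: vector_space "fscale ((*) :: 'k \<Rightarrow> 'k \<Rightarrow> 'k) :: 'k \<Rightarrow> ('i \<Rightarrow> 'k) \<Rightarrow> 'i \<Rightarrow> 'k"
    by (rule vector_space_fscale[OF vk])
  have inj: "inj e" using assms by (intro injI) (metis zero_neq_one)
  show ?thesis
    unfolding v.dependent_explicit
  proof safe
    fix t u v assume t: "finite t" "t \<subseteq> e ` K" "(\<Sum>v\<in>t. fscale (*) (u v) v) = 0" "v \<in> t" "u v \<noteq> 0"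
    then obtain i where i: "v = e i" by auto
    have ev: "(\<Sum>w\<in>t. fscale (*) (u w) w) i = (\<Sum>w\<in>t. u w * w i)"
      by (induction t rule: infinite_finite_induct) (auto simp: fscale_def)
    also have "\<dots> = (\<Sum>w\<in>t. if w = v then u w else 0)"
    proof (rule sum.cong)
      fix w assume "w \<in> t"
      then obtain j where "w = e j" using t(2) by blast
      then show "u w * w i = (if w = v then u w else 0)"
        using inj by (auto simp: i assms[of j] assms[of i] fun_eq_iff)
    qed simp
    also have "\<dots> = u v" using t by simp
    finally show False using t by simp
  qed
qed

text \<open>Projectivity is tested only on modules carried by \<open>nat \<Rightarrow> 'k\<close>; coordinates transport
  an arbitrary finite-dimensional module there.\<close>

lemma coordinate_module:
  fixes sA :: "'k::field \<Rightarrow> 'a::ring_1 \<Rightarrow> 'a" and M :: "('a, 'm::ab_group_add, 'z) lmodule_scheme"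
  assumes fd: "fd_module sA s M"
  obtains X :: "('a, nat \<Rightarrow> 'k) lmodule" and \<phi> \<psi>
  where "fd_module sA (fscale (*)) X" "\<phi> \<in> mod_hom M X" "\<psi> \<in> mod_hom X M"
    "\<And>x. x \<in> car M \<Longrightarrow> \<psi> (\<phi> x) = x" "\<And>y. y \<in> car X \<Longrightarrow> \<phi> (\<psi> y) = y"
proof -
  have vk: "vector_space ((*) :: 'k \<Rightarrow> 'k \<Rightarrow> 'k)"
    by unfold_locales (auto simp: algebra_simps)
  interpret v: vector_space "fscale ((*) :: 'k \<Rightarrow> 'k \<Rightarrow> 'k) :: 'k \<Rightarrow> (nat \<Rightarrow> 'k) \<Rightarrow> nat \<Rightarrow> 'k"
    by (rule vector_space_fscale[OF vk])
  interpret vector_space s using fd_moduleD(1)[OF fd] .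
  interpret vp: vector_space_pair s "fscale ((*) :: 'k \<Rightarrow> 'k \<Rightarrow> 'k) :: 'k \<Rightarrow> (nat \<Rightarrow> 'k) \<Rightarrow> nat \<Rightarrow> 'k"
    by unfold_locales
  obtain S where "finite S" "span S = car M" using fd_moduleD(3)[OF fd] by blast
  then obtain T where T: "finite T" "independent T" "span T = car M"
    using subspace_finite_span[OF fd_moduleD(1,2)[OF fd], of S] by auto
  obtain ix :: "'m \<Rightarrow> nat" where ix: "inj_on ix T"
    using finite_imp_inj_to_nat_seg[OF T(1)] by blast
  define e :: "nat \<Rightarrow> nat \<Rightarrow> 'k" where "e = (\<lambda>i j. if j = i then 1 else 0)"
  obtain \<phi>0 where lin: "Vector_Spaces.linear s (fscale (*)) \<phi>0" and \<phi>0: "\<And>t. t \<in> T \<Longrightarrow> \<phi>0 t = e (ix t)"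
    using vp.linear_independent_extend[OF T(2), of "\<lambda>t. e (ix t)"] by blast
  have "inj e" by (intro injI) (metis e_def zero_neq_one)
  have "\<phi>0 ` T = e ` ix ` T" using \<phi>0 by force
  moreover have "v.independent (e ` ix ` T)"
    by (rule independent_unit_functions) (simp add: e_def)
  moreover have "inj_on \<phi>0 T"
    using \<phi>0 ix \<open>inj e\<close> by (auto simp: inj_on_def dest: injD)
  ultimately have inj: "inj_on \<phi>0 (car M)"
    using vp.linear_inj_on_span_independent_image[OF lin] T(3) by metis
  define \<psi>0 where "\<psi>0 = inv_into (car M) \<phi>0"
  define X :: "('a, nat \<Rightarrow> 'k) lmodule" where
    "X = \<lparr>car = \<phi>0 ` car M, act = \<lambda>a y. \<phi>0 (act M a (\<psi>0 y))\<rparr>"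
  have \<psi>0: "\<psi>0 (\<phi>0 x) = x" if "x \<in> car M" for x
    using inj that by (simp add: \<psi>0_def)
  have actX: "act X a (\<phi>0 x) = \<phi>0 (act M a x)" if "x \<in> car M" for a x
    using that by (simp add: X_def \<psi>0)
  have carX: "car X = \<phi>0 ` car M" by (simp add: X_def)
  have fdX: "fd_module sA (fscale (*)) X"
    unfolding fd_module_def
  proof (intro conjI)
    show "vector_space (fscale ((*) :: 'k \<Rightarrow> 'k \<Rightarrow> 'k) :: 'k \<Rightarrow> (nat \<Rightarrow> 'k) \<Rightarrow> nat \<Rightarrow> 'k)"
      by (rule v.vector_space_axioms)
    have sp: "v.span (\<phi>0 ` T) = car X" using vp.linear_span_image[OF lin, of T] T carX by simp
    show "v.subspace (car X)" using v.subspace_span[of "\<phi>0 ` T"] unfolding sp .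
    show "\<exists>S. finite S \<and> v.span S = car X" using sp T(1) by blast
  qed (use carX in \<open>auto simp: actX fd_moduleD[OF fd] fd_module_closed[OF fd]
      simp flip: vp.linear_add[OF lin] vp.linear_scale[OF lin]\<close>)
  define \<phi> where "\<phi> x = (if x \<in> car M then \<phi>0 x else 0)" for x
  have "\<phi> \<in> mod_hom M X"
    by (rule mod_homI) (auto simp: \<phi>_def carX actX fd_moduleD[OF fd] fd_module_closed[OF fd]
        vp.linear_add[OF lin])
  moreover have "bij_betw \<phi> (car M) (car X)"
    using inj by (auto simp: bij_betw_def carX \<phi>_def inj_on_def)
  ultimately show thesis
    using mod_hom_inverse[OF fd, of \<phi> X] that fdX by metis
qed

text \<open>The lifting problem is conjugated by coordinate isomorphisms into one between modules on
  \<open>nat \<Rightarrow> 'k\<close>, solved there and carried back. Only target modules are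
  transported; \<open>Q\<close> may live in any ambient space by definition.\<close>

lemma projective_lift:
  fixes sA :: "'k::field \<Rightarrow> 'a::ring_1 \<Rightarrow> 'a"
    and Q :: "('a, 'q::ab_group_add, 'y) lmodule_scheme"
    and M :: "('a, 'm::ab_group_add, 'z) lmodule_scheme"
    and N :: "('a, 'n::ab_group_add, 'w) lmodule_scheme"
  assumes proj: "projective_module sA Q" and M: "fd_module sA s M" and N: "fd_module sA s' N"
    and g: "g \<in> mod_hom M N" "g ` car M = car N" and f: "f \<in> mod_hom Q N"
  obtains h where "h \<in> mod_hom Q M" "g \<circ> h = f"
proof -
  obtain X :: "('a, nat \<Rightarrow> 'k) lmodule" and \<phi> \<psi> where X: "fd_module sA (fscale (*)) X"
    and \<phi>: "\<phi> \<in> mod_hom M X" and \<psi>: "\<psi> \<in> mod_hom X M"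
    and \<psi>\<phi>: "\<And>x. x \<in> car M \<Longrightarrow> \<psi> (\<phi> x) = x"
    using coordinate_module[OF M] by metis
  obtain Y :: "('a, nat \<Rightarrow> 'k) lmodule" and \<phi>' \<psi>' where Y: "fd_module sA (fscale (*)) Y"
    and \<phi>': "\<phi>' \<in> mod_hom N Y" and \<psi>': "\<psi>' \<in> mod_hom Y N"
    and \<psi>\<phi>': "\<And>x. x \<in> car N \<Longrightarrow> \<psi>' (\<phi>' x) = x" "\<And>y. y \<in> car Y \<Longrightarrow> \<phi>' (\<psi>' y) = y"
    using coordinate_module[OF N] by metis
  define g' where "g' = \<phi>' \<circ> (g \<circ> \<psi>)"
  have g': "g' \<in> mod_hom X Y"
    unfolding g'_def using \<phi>' \<psi> g by (intro mod_hom_comp)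
  have "car Y \<subseteq> g' ` car X"
  proof
    fix y assume y: "y \<in> car Y"
    then obtain x where x: "x \<in> car M" "\<psi>' y = g x"
      using g(2) mod_homD(1)[OF \<psi>'] by (metis imageE)
    then have "g' (\<phi> x) = y" using \<psi>\<phi>[of x] \<psi>\<phi>'(2)[OF y] by (simp add: g'_def flip: x(2))
    then show "y \<in> g' ` car X" using mod_homD(1)[OF \<phi> x(1)] by blast
  qed
  then have "g' ` car X = car Y" using mod_homD(1)[OF g'] by auto
  moreover have "\<phi>' \<circ> f \<in> mod_hom Q Y" using f \<phi>' by (rule mod_hom_comp)
  ultimately obtain h where h: "h \<in> mod_hom Q X" "g' \<circ> h = \<phi>' \<circ> f"
    using proj X Y g' unfolding projective_module_def by meson
  have "g \<circ> (\<psi> \<circ> h) = f"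
  proof
    fix x
    show "(g \<circ> (\<psi> \<circ> h)) x = f x"
    proof (cases "x \<in> car Q")
      case True
      have "\<phi>' (g (\<psi> (h x))) = \<phi>' (f x)" using fun_cong[OF h(2), of x] by (simp add: g'_def)
      then show ?thesis
        using \<psi>\<phi>'(1) True mod_homD(1)[OF h(1)] mod_homD(1)[OF \<psi>] mod_homD(1)[OF g(1)]
          mod_homD(1)[OF f] by (metis comp_apply)
    next
      case False
      then show ?thesis
        using mod_homD(2)[OF h(1)] mod_homD(2)[OF f] mod_hom_zero[OF \<psi>] mod_hom_zero[OF g(1)]
        by simp
    qed
  qed
  then show thesis using that mod_hom_comp[OF h(1) \<psi>] by blast
qed

section \<open>Homogeneous components\<close>

text \<open>All components at once, as the family singled out by \<open>direct_sum\<close>. The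
  description denotes something definite only for vectors in the sum of the
  \<open>G i\<close>.\<close>

definition hcomp :: "('i \<Rightarrow> 'v::ab_group_add set) \<Rightarrow> 'v \<Rightarrow> 'i \<Rightarrow> 'v" where
  "hcomp G x = (THE c. (\<forall>i. c i \<in> G i) \<and> finite {i. c i \<noteq> 0} \<and> x = (\<Sum>i | c i \<noteq> 0. c i))"

lemma direct_sumD:
  assumes "direct_sum s V G"
  shows "module.subspace s (G i)" "G i \<subseteq> V"
  using assms unfolding direct_sum_def by auto

lemma hcomp:
  assumes "direct_sum s V G" "x \<in> V"
  shows "hcomp G x i \<in> G i" "finite {i. hcomp G x i \<noteq> 0}" "x = (\<Sum>i | hcomp G x i \<noteq> 0. hcomp G x i)"
proof -
  have "\<exists>!c. (\<forall>i. c i \<in> G i) \<and> finite {i. c i \<noteq> 0} \<and> x = (\<Sum>i | c i \<noteq> 0. c i)"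
    using assms unfolding direct_sum_def by blast
  from theI'[OF this] show "hcomp G x i \<in> G i" "finite {i. hcomp G x i \<noteq> 0}"
    "x = (\<Sum>i | hcomp G x i \<noteq> 0. hcomp G x i)"
    unfolding hcomp_def by blast+
qed

text \<open>Any finite \<open>T\<close> outside which \<open>c\<close> vanishes is allowed, so that
  the exact support never has to be computed.\<close>

lemma hcomp_unique:
  assumes ds: "direct_sum s V G" and "x \<in> V" "\<And>i. c i \<in> G i" "finite T" "\<And>i. i \<notin> T \<Longrightarrow> c i = 0"
    "x = sum c T"
  shows "hcomp G x = c"
proof -
  have "{i. c i \<noteq> 0} \<subseteq> T" using assms(5) by auto
  then have "finite {i. c i \<noteq> 0}" "x = (\<Sum>i | c i \<noteq> 0. c i)"
    using assms(4,6) finite_subset by (auto intro: sum.mono_neutral_right)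
  moreover have "\<exists>!c. (\<forall>i. c i \<in> G i) \<and> finite {i. c i \<noteq> 0} \<and> x = (\<Sum>i | c i \<noteq> 0. c i)"
    using assms(1,2) unfolding direct_sum_def by blast
  ultimately show ?thesis
    using hcomp[OF ds \<open>x \<in> V\<close>] assms(3) by blast
qed

lemma hcomp_homogeneous:
  assumes "vector_space s" "direct_sum s V G" "x \<in> G i"
  shows "hcomp G x = (\<lambda>j. if j = i then x else 0)"
proof -
  interpret vector_space s by fact
  show ?thesis
    by (rule hcomp_unique[OF assms(2), where T = "{i}"])
      (use assms direct_sumD[OF assms(2)] in \<open>auto simp: subspace_0\<close>)
qed

lemma hcomp_add:
  assumes "vector_space s" and V: "module.subspace s V" and ds: "direct_sum s V G" and xy: "x \<in> V" "y \<in> V"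
  shows "hcomp G (x + y) i = hcomp G x i + hcomp G y i"
proof -
  interpret vector_space s by fact
  let ?T = "{i. hcomp G x i \<noteq> 0} \<union> {i. hcomp G y i \<noteq> 0}"
  have "x = (\<Sum>i\<in>?T. hcomp G x i)" "y = (\<Sum>i\<in>?T. hcomp G y i)"
    using hcomp(2,3)[OF ds xy(1)] hcomp(2,3)[OF ds xy(2)]
    by (auto intro: trans[OF _ sum.mono_neutral_left])
  then have "hcomp G (x + y) = (\<lambda>i. hcomp G x i + hcomp G y i)"
    using hcomp[OF ds xy(1)] hcomp[OF ds xy(2)] direct_sumD[OF ds] V xy
    by (intro hcomp_unique[OF ds, where T = ?T]) (auto simp: subspace_add sum.distrib)
  then show ?thesis by simp
qed

lemma hcomp_scale:
  assumes "vector_space s" and V: "module.subspace s V" and ds: "direct_sum s V G" and x: "x \<in> V"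
  shows "hcomp G (s c x) i = s c (hcomp G x i)"
proof -
  interpret vector_space s by fact
  have sum: "s c x = (\<Sum>i | hcomp G x i \<noteq> 0. s c (hcomp G x i))"
    by (subst hcomp(3)[OF ds x]) (rule scale_sum_right)
  have "hcomp G (s c x) = (\<lambda>i. s c (hcomp G x i))"
    using hcomp(1,2)[OF ds x] direct_sumD[OF ds] V x
    by (intro hcomp_unique[OF ds subspace_scale[OF V x] _ _ _ sum]) (auto simp: subspace_scale)
  then show ?thesis by simp
qed

lemma hcomp_sum_superset:
  assumes "direct_sum s V G" "x \<in> V" "finite D" "{i. G i \<noteq> {0}} \<subseteq> D"
  shows "x = (\<Sum>i\<in>D. hcomp G x i)"
proof -
  have "{i. hcomp G x i \<noteq> 0} \<subseteq> D" using hcomp(1)[OF assms(1,2)] assms(4) by fastforce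
  then show ?thesis
    using hcomp(3)[OF assms(1,2)] assms(3) by (auto intro: trans[OF _ sum.mono_neutral_left])
qed

text \<open>The components of a finite spanning set occupy finitely many degrees; in any other
  degree the component map vanishes on a spanning set, hence everywhere.\<close>

lemma finite_degrees:
  assumes "vector_space s" and V: "module.subspace s V" and ds: "direct_sum s V G"
    and fd: "\<exists>S. finite S \<and> module.span s S = V"
  shows "finite {i. G i \<noteq> {0}}"
proof -
  interpret vector_space s by fact
  obtain S where S: "finite S" "span S = V" using fd by blast
  define F where "F = (\<Union>x\<in>S. {i. hcomp G x i \<noteq> 0})"
  have "G i = {0}" if "i \<notin> F" for i
  proof -
    have "hcomp G 0 i = 0"
      by (rule additive_on_zero[of V "\<lambda>x. hcomp G x i"])
        (use V hcomp_add[OF assms(1) V ds] in \<open>auto simp: subspace_0\<close>)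
    then have "subspace {x \<in> V. hcomp G x i = 0}"
      using V hcomp_add[OF assms(1) V ds] hcomp_scale[OF assms(1) V ds]
      by (auto simp: subspace_def)
    moreover have "S \<subseteq> {x \<in> V. hcomp G x i = 0}"
      using that span_superset S(2) unfolding F_def by blast
    ultimately have "V \<subseteq> {x \<in> V. hcomp G x i = 0}" using span_minimal S(2) by blast
    then have "x = 0" if "x \<in> G i" for x
      using hcomp_homogeneous[OF assms(1) ds that] direct_sumD(2)[OF ds] that by fastforce
    then show ?thesis using direct_sumD(1)[OF ds] subspace_0 by blast
  qed
  then have "{i. G i \<noteq> {0}} \<subseteq> F" by blast
  moreover have "finite F" unfolding F_def using S hcomp(2)[OF ds] span_superset by blast
  ultimately show ?thesis using finite_subset by blast
qed

text \<open>Additivity is all that is used, so the lemma serves for maps out of the algebra as well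
  as out of a module.\<close>

lemma additive_graded_ext:
  fixes f g :: "'v::ab_group_add \<Rightarrow> 'w::ab_group_add"
  assumes ds: "direct_sum s V G" and "0 \<in> V" "\<And>x y. x \<in> V \<Longrightarrow> y \<in> V \<Longrightarrow> x + y \<in> V"
    and f: "\<And>x y. x \<in> V \<Longrightarrow> y \<in> V \<Longrightarrow> f (x + y) = f x + f y"
    and g: "\<And>x y. x \<in> V \<Longrightarrow> y \<in> V \<Longrightarrow> g (x + y) = g x + g y"
    and eq: "\<And>i x. x \<in> G i \<Longrightarrow> f x = g x" and x: "x \<in> V"
  shows "f x = g x"
proof -
  have V: "hcomp G x i \<in> V" for i using hcomp(1)[OF ds x] direct_sumD(2)[OF ds] by blast
  have "f x = (\<Sum>i | hcomp G x i \<noteq> 0. f (hcomp G x i))"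
    by (subst hcomp(3)[OF ds x], rule additive_on_sum[of V]) (use assms V in auto)
  also have "\<dots> = (\<Sum>i | hcomp G x i \<noteq> 0. g (hcomp G x i))"
    using eq hcomp(1)[OF ds x] by (intro sum.cong) auto
  also have "\<dots> = g (\<Sum>i | hcomp G x i \<noteq> 0. hcomp G x i)"
    by (rule additive_on_sum[of V, symmetric]) (use assms V in auto)
  also have "\<dots> = g x" using hcomp(3)[OF ds x] by simp
  finally show ?thesis .
qed

section \<open>Graded modules and homogeneous parts of homomorphisms\<close>

lemma graded_moduleD:
  assumes "graded_module sA G s M"
  shows "fd_module sA s M" "direct_sum s (car M) (grade M)"
    "a \<in> G d \<Longrightarrow> x \<in> grade M k \<Longrightarrow> act M a x \<in> grade M (int d + k)"
    "x \<in> grade M k \<Longrightarrow> x \<in> car M" "0 \<in> grade M k"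
proof -
  show fd: "fd_module sA s M" and ds: "direct_sum s (car M) (grade M)"
    and "a \<in> G d \<Longrightarrow> x \<in> grade M k \<Longrightarrow> act M a x \<in> grade M (int d + k)"
    using assms unfolding graded_module_def by blast+
  interpret vector_space s using fd_moduleD(1)[OF fd] .
  show "x \<in> grade M k \<Longrightarrow> x \<in> car M" using direct_sumD(2)[OF ds] by blast
  show "0 \<in> grade M k" using direct_sumD(1)[OF ds] subspace_0 by blast
qed

lemma graded_hcomp:
  assumes "graded_module sA G s M"
  shows "x \<in> car M \<Longrightarrow> hcomp (grade M) x k \<in> grade M k"
    "x \<in> car M \<Longrightarrow> hcomp (grade M) x k \<in> car M"
    "x \<in> car M \<Longrightarrow> y \<in> car M \<Longrightarrow> hcomp (grade M) (x + y) k = hcomp (grade M) x k + hcomp (grade M) y k"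
    "x \<in> car M \<Longrightarrow> hcomp (grade M) (s c x) k = s c (hcomp (grade M) x k)"
    "x \<in> grade M j \<Longrightarrow> hcomp (grade M) x k = (if k = j then x else 0)"
    "finite {k. grade M k \<noteq> {0}}"
    "x \<in> car M \<Longrightarrow> finite D \<Longrightarrow> {k. grade M k \<noteq> {0}} \<subseteq> D \<Longrightarrow> (\<Sum>k\<in>D. hcomp (grade M) x k) = x"
proof -
  note g = graded_moduleD[OF assms]
  note fd = fd_moduleD[OF g(1)]
  show "x \<in> car M \<Longrightarrow> hcomp (grade M) x k \<in> grade M k"
    using hcomp(1)[OF g(2)] .
  then show "x \<in> car M \<Longrightarrow> hcomp (grade M) x k \<in> car M" using g(4) by blast
  show "x \<in> car M \<Longrightarrow> y \<in> car M \<Longrightarrow> hcomp (grade M) (x + y) k = hcomp (grade M) x k + hcomp (grade M) y k"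
    "x \<in> car M \<Longrightarrow> hcomp (grade M) (s c x) k = s c (hcomp (grade M) x k)"
    "x \<in> grade M j \<Longrightarrow> hcomp (grade M) x k = (if k = j then x else 0)"
    "finite {k. grade M k \<noteq> {0}}"
    "x \<in> car M \<Longrightarrow> finite D \<Longrightarrow> {k. grade M k \<noteq> {0}} \<subseteq> D \<Longrightarrow> (\<Sum>k\<in>D. hcomp (grade M) x k) = x"
    using hcomp_add[OF fd(1,2) g(2)] hcomp_scale[OF fd(1,2) g(2)] hcomp_homogeneous[OF fd(1) g(2)]
      finite_degrees[OF fd(1,2) g(2) fd(3)] hcomp_sum_superset[OF g(2)] by auto
qed

text \<open>Both sides are additive in \<open>a\<close> and in \<open>x\<close>, so compatibility
  extends from homogeneous \<open>a\<close> to all \<open>a\<close> for homogeneous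
  \<open>x\<close>, and from there to all \<open>x\<close>.\<close>

lemma mod_hom_graded_criterion:
  assumes alg: "pos_graded_fd_algebra sA G" and M: "graded_module sA G s M" and N: "fd_module sA s' N"
    and f: "\<And>x. x \<in> car M \<Longrightarrow> f x \<in> car N" "\<And>x. x \<notin> car M \<Longrightarrow> f x = 0"
    and add: "\<And>x y. x \<in> car M \<Longrightarrow> y \<in> car M \<Longrightarrow> f (x + y) = f x + f y"
    and hom: "\<And>d k a x. a \<in> G d \<Longrightarrow> x \<in> grade M k \<Longrightarrow> f (act M a x) = act N a (f x)"
  shows "f \<in> mod_hom M N"
proof (rule mod_homI)
  interpret pos_graded_fd_algebra sA G by fact
  note fdM = graded_moduleD(1)[OF M]
  note closM = fd_module_closed[OF fdM] and dM = fd_moduleD[OF fdM] and dN = fd_moduleD[OF N]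
  fix a x assume x: "x \<in> car M"
  have homog: "f (act M a y) = act N a (f y)" if y: "y \<in> grade M k" for y k
  proof (rule additive_graded_ext[OF grading, where f = "\<lambda>a. f (act M a y)"])
    show "f (act M b y) = act N b (f y)" if "b \<in> G d" for d b
      using hom that y by blast
  qed (use graded_moduleD(4)[OF M y] add dM(4,6) dN(6) f(1) in auto)
  show "f (act M a x) = act N a (f x)"
    by (rule additive_graded_ext[OF graded_moduleD(2)[OF M], where f = "\<lambda>x. f (act M a x)"])
      (use homog closM(1,2) dM(4,5) dN(5) add f(1) x in auto)
qed (use f add in auto)

text \<open>The part of \<open>f\<close> of degree \<open>j\<close>: on degree \<open>k\<close> of
  \<open>M\<close> it is the component of \<open>f\<close> in degree \<open>k + j\<close>. Only
  nonzero degrees are summed over, to keep the sum finite; outside the carrier the value is 0, as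
  for every homomorphism.\<close>

definition hom_comp ::
  "('a, 'm::ab_group_add) gmodule \<Rightarrow> ('a, 'n::ab_group_add) gmodule \<Rightarrow> ('m \<Rightarrow> 'n) \<Rightarrow> int \<Rightarrow> 'm \<Rightarrow> 'n" where
  "hom_comp M N f j x = (if x \<in> car M then
     \<Sum>k | grade M k \<noteq> {0}. hcomp (grade N) (f (hcomp (grade M) x k)) (k + j) else 0)"

lemma hom_comp_homogeneous:
  assumes M: "graded_module sA G s M" and N: "graded_module sA G s' N" and f: "f \<in> mod_hom M N"
    and x: "x \<in> grade M k"
  shows "hom_comp M N f j x = hcomp (grade N) (f x) (k + j)"
proof -
  have h0: "hcomp (grade N) 0 l = 0" for l
    using graded_hcomp(5)[OF N graded_moduleD(5)[OF N], of l l] by simp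
  have "hom_comp M N f j x =
      (\<Sum>i | grade M i \<noteq> {0}. if i = k then hcomp (grade N) (f x) (k + j) else 0)"
    unfolding hom_comp_def using graded_moduleD(4)[OF M x]
    by (simp add: graded_hcomp(5)[OF M x] if_distrib if_distribR mod_hom_zero[OF f] h0 cong: if_cong)
  also have "\<dots> = hcomp (grade N) (f x) (k + j)"
    using graded_hcomp(6)[OF M] x mod_hom_zero[OF f] h0 by (cases "grade M k = {0}") auto
  finally show ?thesis .
qed

lemma hom_comp_mod_hom_deg:
  assumes alg: "pos_graded_fd_algebra sA G" and M: "graded_module sA G s M"
    and N: "graded_module sA G s' N" and f: "f \<in> mod_hom M N"
  shows "hom_comp M N f j \<in> mod_hom_deg M N j"
proof -
  interpret pos_graded_fd_algebra sA G by fact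
  note fdM = graded_moduleD(1)[OF M] and fdN = graded_moduleD(1)[OF N]
  note gM = graded_hcomp[OF M] and gN = graded_hcomp[OF N] and fh = mod_homD[OF f]
  \<comment> \<open>Acting by an element of degree \<open>d\<close> shifts components by
    \<open>d\<close>; this turns the compatibility of \<open>f\<close> into that of its
    parts.\<close>
  have hN: "hcomp (grade N) (act N a y) (int d + l) = act N a (hcomp (grade N) y l)"
    if a: "a \<in> G d" and y: "y \<in> car N" for a d y l
  proof (rule additive_graded_ext[OF graded_moduleD(2)[OF N],
      where f = "\<lambda>y. hcomp (grade N) (act N a y) (int d + l)"])
    fix i x assume x: "x \<in> grade N i"
    then have "act N a x \<in> grade N (int d + i)" using a graded_moduleD(3)[OF N] by blast
    from gN(5)[OF this] gN(5)[OF x]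
    show "hcomp (grade N) (act N a x) (int d + l) = act N a (hcomp (grade N) x l)"
      using act_zero[OF fdN] by simp
  qed (use y gN fd_moduleD[OF fdN] fd_module_closed[OF fdN] in auto)
  have "hom_comp M N f j \<in> mod_hom M N"
  proof (rule mod_hom_graded_criterion[OF alg M fdN])
    fix d k a x assume a: "a \<in> G d" and x: "x \<in> grade M k"
    have "act M a x \<in> grade M (int d + k)" using a x graded_moduleD(3)[OF M] by blast
    then have "hom_comp M N f j (act M a x) = hcomp (grade N) (f (act M a x)) (int d + (k + j))"
      using hom_comp_homogeneous[OF M N f, of "act M a x"] by (simp add: add.assoc)
    also have "\<dots> = act N a (hom_comp M N f j x)"
      using hN[OF a] fh graded_moduleD(4)[OF M x] hom_comp_homogeneous[OF M N f x] by simp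
    finally show "hom_comp M N f j (act M a x) = act N a (hom_comp M N f j x)" .
  next
    show "hom_comp M N f j (x + y) = hom_comp M N f j x + hom_comp M N f j y"
      if "x \<in> car M" "y \<in> car M" for x y
      using that fd_module_closed(2)[OF fdM that]
      by (simp add: hom_comp_def gM fh gN sum.distrib)
  qed (use gM fh gN in \<open>auto simp: hom_comp_def intro!: fd_module_closed[OF fdN]\<close>)
  moreover have "hom_comp M N f j x \<in> grade N (k + j)" if x: "x \<in> grade M k" for x k
    using hom_comp_homogeneous[OF M N f x] gN(1) fh graded_moduleD(4)[OF M x] by simp
  ultimately show ?thesis unfolding mod_hom_deg_def by auto
qed

lemma mod_hom_decompose:
  assumes alg: "pos_graded_fd_algebra sA G" and M: "graded_module sA G s M"
    and N: "graded_module sA G s' N" and f: "f \<in> mod_hom M N"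
  obtains J where "finite J" "f = (\<Sum>j\<in>J. hom_comp M N f j)"
proof -
  \<comment> \<open>The degree of a nonzero part is a difference of two occurring degrees, so
    finitely many parts suffice.\<close>
  define J where "J = (\<lambda>(k, l). l - k) ` ({k. grade M k \<noteq> {0}} \<times> {k. grade N k \<noteq> {0}})"
  have "finite J" unfolding J_def using graded_hcomp(6)[OF M] graded_hcomp(6)[OF N] by blast
  note fdM = graded_moduleD(1)[OF M] and fh = mod_homD[OF f]
  have hc: "hom_comp M N f j \<in> mod_hom M N" for j
    using hom_comp_mod_hom_deg[OF alg M N f] unfolding mod_hom_deg_def by blast
  have sum_app: "(\<Sum>j\<in>J. hom_comp M N f j) x = (\<Sum>j\<in>J. hom_comp M N f j x)" for x
    by (induction J rule: infinite_finite_induct) auto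
  have "f x = (\<Sum>j\<in>J. hom_comp M N f j) x" for x
  proof (cases "x \<in> car M")
    case True
    have homog: "f x = (\<Sum>j\<in>J. hom_comp M N f j) x" if x: "x \<in> grade M k" for k x
    proof (cases "x = 0")
      case True
      then have "hom_comp M N f j x = 0" for j using mod_hom_zero[OF hc] by blast
      then show ?thesis using True mod_hom_zero[OF f] by (simp add: sum_app)
    next
      case False
      then have k: "grade M k \<noteq> {0}" using x by blast
      have fx: "f x \<in> car N" using fh graded_moduleD(4)[OF M x] by blast
      have "f x = (\<Sum>l\<in>(+) k ` J. hcomp (grade N) (f x) l)"
      proof (rule graded_hcomp(7)[OF N fx, symmetric])
        show "{l. grade N l \<noteq> {0}} \<subseteq> (+) k ` J"
        proof
          fix l assume "l \<in> {l. grade N l \<noteq> {0}}"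
          then have "l - k \<in> J" using k unfolding J_def by auto
          then show "l \<in> (+) k ` J" by (rule rev_image_eqI) simp
        qed
      qed (use \<open>finite J\<close> in auto)
      also have "\<dots> = (\<Sum>j\<in>J. hom_comp M N f j x)"
        by (simp add: sum.reindex hom_comp_homogeneous[OF M N f x])
      finally show ?thesis by (simp add: sum_app)
    qed
    show ?thesis
    proof (rule additive_graded_ext[OF graded_moduleD(2)[OF M], where f = f])
      show "(\<Sum>j\<in>J. hom_comp M N f j) (x + y) = (\<Sum>j\<in>J. hom_comp M N f j) x + (\<Sum>j\<in>J. hom_comp M N f j) y"
        if "x \<in> car M" "y \<in> car M" for x y
        using mod_homD(3)[OF hc] that by (simp add: sum_app sum.distrib)
    qed (use homog True fh fd_module_closed[OF fdM] in auto)
  next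
    case False
    then have "hom_comp M N f j x = 0" for j by (simp add: hom_comp_def)
    then show ?thesis using False fh by (simp add: sum_app)
  qed
  then show thesis using that \<open>finite J\<close> by blast
qed

section \<open>Projective covers of simple modules\<close>

lemma mod_hom_degD:
  assumes "f \<in> mod_hom_deg M N d"
  shows "f \<in> mod_hom M N" "x \<in> grade M k \<Longrightarrow> f x \<in> grade N (k + d)"
  using assms unfolding mod_hom_deg_def by auto

locale local_projective = pos_graded_fd_algebra sA GA
  for sA :: "'k::field \<Rightarrow> 'a::ring_1 \<Rightarrow> 'a" and GA :: "nat \<Rightarrow> 'a set" +
  fixes sP :: "'k \<Rightarrow> 'm::ab_group_add \<Rightarrow> 'm" and sL :: "'k \<Rightarrow> 'n::ab_group_add \<Rightarrow> 'n"
    and P :: "('a, 'm) gmodule" and L :: "('a, 'n) gmodule" and \<pi> :: "'m \<Rightarrow> 'n"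
  assumes P: "graded_module sA GA sP P" and L: "graded_module sA GA sL L"
    and conc: "concentrated L 0" and simple: "simple_module L"
    and cover: "projective_cover sA P \<pi> L" and \<pi>_deg: "\<pi> \<in> mod_hom_deg P L 0"
begin

lemmas fdP = graded_moduleD(1)[OF P] and fdL = graded_moduleD(1)[OF L]

lemma \<pi>: "\<pi> \<in> mod_hom P L" and \<pi>_surj: "\<pi> ` car P = car L"
  using cover unfolding projective_cover_def by auto

lemma projective: "projective_module sA P"
  using cover unfolding projective_cover_def by auto

text \<open>The kernel of \<pi> is the largest proper submodule: a submodule not inside it maps onto
  the simple module \<open>L\<close>, so together with the kernel it fills \<open>P\<close>, and
  superfluity of the kernel makes it all of \<open>P\<close>.\<close>

lemma submodule_proper_kernel:
  assumes U: "submodule P U" "U \<noteq> car P" and x: "x \<in> U"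
  shows "\<pi> x = 0"
proof (rule ccontr)
  assume "\<pi> x \<noteq> 0"
  then have "\<pi> ` U = car L"
    using simple_moduleD[OF simple submodule_image[OF fdP \<pi> U(1)]] x by blast
  have "car P = {u + v |u v. u \<in> U \<and> v \<in> car P \<and> \<pi> v = 0}"
  proof (intro equalityI subsetI)
    fix y assume y: "y \<in> car P"
    then obtain u where u: "u \<in> U" "\<pi> u = \<pi> y"
      using \<open>\<pi> ` U = car L\<close> mod_homD(1)[OF \<pi>] by (metis imageE)
    then have uP: "u \<in> car P" using submoduleD(1)[OF U(1)] by blast
    have "y = u + (y - u)" "y - u \<in> car P" "\<pi> (y - u) = 0"
      using y uP u mod_hom_diff[OF fdP \<pi>] fd_module_closed(3)[OF fdP] by auto
    then show "y \<in> {u + v |u v. u \<in> U \<and> v \<in> car P \<and> \<pi> v = 0}" using u(1) by blast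
  qed (use submoduleD(1)[OF U(1)] fd_module_closed(2)[OF fdP] in auto)
  then show False using cover U unfolding projective_cover_def by blast
qed

text \<open>The kernel of \<open>h\<close> is proper, hence inside that of \<pi>. Conversely, if
  \<open>h\<close> did not vanish on the kernel of \<pi>, it would map that kernel onto
  \<open>N\<close>, so that \<open>P\<close> would be the sum of the two kernels and \<pi> would be
  zero.\<close>

lemma hom_to_simple_kernel:
  assumes N: "fd_module sA s N" "simple_module N" and h: "h \<in> mod_hom P N" "h \<noteq> 0"
  shows "h ` car P = car N" and "\<And>x. x \<in> car P \<Longrightarrow> h x = 0 \<longleftrightarrow> \<pi> x = 0"
proof -
  define K where "K = {x \<in> car P. h x = 0}"
  have K: "submodule P K" unfolding K_def by (rule submodule_kernel[OF fdP N(1) h(1)])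
  obtain z where "h z \<noteq> 0" using h(2) by (auto simp: fun_eq_iff)
  then have z: "z \<in> car P" "h z \<noteq> 0" using mod_homD(2)[OF h(1)] by blast+
  then show im: "h ` car P = car N"
    using simple_moduleD[OF N(2) submodule_image[OF fdP h(1) submodule_car(1)[OF fdP]]] by blast
  have K1: "\<pi> x = 0" if "x \<in> car P" "h x = 0" for x
    using submodule_proper_kernel[OF K] that z unfolding K_def by blast
  define R where "R = {x \<in> car P. \<pi> x = 0}"
  have R: "submodule P R" unfolding R_def by (rule submodule_kernel[OF fdP fdL \<pi>])
  have "h ` R = {0}"
  proof (rule ccontr)
    assume "h ` R \<noteq> {0}"
    then have hR: "h ` R = car N"
      using simple_moduleD[OF N(2) submodule_image[OF fdP h(1) R]] by blast
    have "\<pi> x = 0" if x: "x \<in> car P" for x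
    proof -
      obtain y where y: "y \<in> car P" "\<pi> y = 0" "h x = h y"
        using hR mod_homD(1)[OF h(1) x] unfolding R_def by auto
      then have "\<pi> (x - y) = 0"
        using K1[of "x - y"] mod_hom_diff[OF fdP h(1)] fd_module_closed(3)[OF fdP] x by auto
      then show ?thesis using mod_hom_diff[OF fdP \<pi>] x y by auto
    qed
    then have "\<pi> ` car P = {0}" using z by force
    then show False using \<pi>_surj simple unfolding simple_module_def by metis
  qed
  then show "h x = 0 \<longleftrightarrow> \<pi> x = 0" if "x \<in> car P" for x
    using K1 that unfolding R_def by blast
qed

text \<open>\<open>L\<close> lives in degree 0, so \<pi> vanishes on every other degree of
  \<open>P\<close>.\<close>

lemma exists_generator: "\<exists>x. x \<in> grade P 0 \<and> \<pi> x \<noteq> 0"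
proof (rule ccontr)
  assume contr: "\<not> ?thesis"
  have zero: "\<pi> x = 0" if x: "x \<in> grade P k" for x k
  proof (cases "k = 0")
    case False
    then have "grade L k = {0}" using conc unfolding concentrated_def by blast
    then show ?thesis using mod_hom_degD(2)[OF \<pi>_deg x] by auto
  qed (use contr x in blast)
  have "\<pi> x = 0" if "x \<in> car P" for x
    by (rule additive_graded_ext[OF graded_moduleD(2)[OF P] fd_module_closed(1,2)[OF fdP],
          where f = \<pi> and g = "\<lambda>_. 0"]) (use zero mod_homD(3)[OF \<pi>] that in auto)
  then have "\<pi> ` car P = {0}" using fd_module_closed(1)[OF fdP] by force
  then show False using \<pi>_surj simple unfolding simple_module_def by metis
qed

definition gen :: 'm where
  "gen = (SOME x. x \<in> grade P 0 \<and> \<pi> x \<noteq> 0)"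

lemma gen: "gen \<in> grade P 0" "\<pi> gen \<noteq> 0" "gen \<in> car P"
  using someI_ex[OF exists_generator] graded_moduleD(4)[OF P] unfolding gen_def by blast+

text \<open>The cyclic submodule of \<open>gen\<close> is not inside the kernel of \<pi>, the
  largest proper submodule.\<close>

lemma generated:
  assumes "y \<in> car P"
  obtains a where "y = act P a gen"
proof -
  define U where "U = range (\<lambda>a. act P a gen)"
  have "submodule P U"
    unfolding submodule_def U_def
  proof (intro conjI ballI allI)
    show "0 \<in> range (\<lambda>a. act P a gen)"
      using act_zero(2)[OF fdP gen(3)] by (metis rangeI)
  qed (use fd_moduleD(4)[OF fdP gen(3)] in \<open>auto simp flip: fd_moduleD(6,7)[OF fdP gen(3)]\<close>)
  moreover have "gen \<in> U" unfolding U_def using fd_moduleD(8)[OF fdP gen(3)] by (metis rangeI)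
  ultimately have "U = car P" using submodule_proper_kernel gen(2) by blast
  then show thesis using assms that unfolding U_def by auto
qed

text \<open>Since \<open>gen\<close> has degree 0, decomposing \<open>a\<close> decomposes
  \<open>act P a gen\<close> degree by degree. As the algebra has no negative degrees, neither has
  \<open>P\<close>.\<close>

lemma generated_homogeneous:
  assumes y: "y \<in> grade P k"
  shows "if k < 0 then y = 0 else \<exists>a\<in>GA (nat k). y = act P a gen"
proof -
  obtain a where a: "y = act P a gen" using generated graded_moduleD(4)[OF P y] by blast
  \<comment> \<open>Degrees of the algebra are natural numbers and those of modules integers;
    \<open>c\<close> extends the components by 0 to negative degrees.\<close>
  define c where "c = (\<lambda>k. act P (if k < 0 then 0 else hcomp GA a (nat k)) gen)"
  have GA: "hcomp GA a d \<in> GA d" for d by (rule hcomp(1)[OF grading UNIV_I])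
  have "y = (\<Sum>d | hcomp GA a d \<noteq> 0. act P (hcomp GA a d) gen)"
    unfolding a by (subst hcomp(3)[OF grading UNIV_I], rule act_sum(2)[OF fdP gen(3)])
  also have "\<dots> = sum c (int ` {d. hcomp GA a d \<noteq> 0})"
    by (simp add: sum.reindex c_def)
  finally have y_sum: "y = sum c (int ` {d. hcomp GA a d \<noteq> 0})" .
  have "hcomp (grade P) y = c"
  proof (rule hcomp_unique[OF graded_moduleD(2)[OF P] graded_moduleD(4)[OF P y] _ _ _ y_sum])
    fix i
    show "c i \<in> grade P i"
    proof (cases "i < 0")
      case True
      then show ?thesis
        using act_zero(2)[OF fdP gen(3)] graded_moduleD(5)[OF P] by (simp add: c_def)
    next
      case False
      then show ?thesis
        using graded_moduleD(3)[OF P GA gen(1), of "nat i"] by (simp add: c_def)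
    qed
    show "c i = 0" if "i \<notin> int ` {d. hcomp GA a d \<noteq> 0}"
    proof -
      have "hcomp GA a (nat i) = 0" if "\<not> i < 0"
        using that \<open>i \<notin> _\<close> by (metis (mono_tags, lifting) image_eqI int_nat_eq mem_Collect_eq not_less)
      then show ?thesis using act_zero(2)[OF fdP gen(3)] by (auto simp: c_def)
    qed
  qed (use hcomp(2)[OF grading UNIV_I] in auto)
  then have "y = c k" using graded_hcomp(5)[OF P y, of k] by simp
  then show ?thesis using GA act_zero(2)[OF fdP gen(3)] by (auto simp: c_def)
qed

lemma grade_negative: "k < 0 \<Longrightarrow> grade P k = {0}"
  using generated_homogeneous graded_moduleD(5)[OF P] by fastforce

lemma hom_eq_zero_gen:
  assumes "f \<in> mod_hom P N" "fd_module sA s N" "f gen = 0"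
  shows "f = 0"
proof
  fix x
  show "f x = 0 x"
  proof (cases "x \<in> car P")
    case True
    then obtain a where "x = act P a gen" using generated by blast
    then show ?thesis
      using mod_homD(4)[OF assms(1) gen(3)] act_zero(1)[OF assms(2)] assms(3) by simp
  qed (use mod_homD(2)[OF assms(1)] in simp)
qed

lemma grade_bounds:
  assumes "grade P k \<noteq> {0}"
  shows "0 \<le> k \<and> k \<le> top_degree P"
  unfolding top_degree_def using Max_ge[OF graded_hcomp(6)[OF P]] grade_negative assms by force

end

lemma graded_isoE:
  assumes "graded_iso M N"
  obtains f where "f \<in> mod_hom M N" "bij_betw f (car M) (car N)"
  using assms unfolding graded_iso_def mod_hom_deg_def by blast

lemma submodule_socle:
  assumes "fd_module sA s M" "fd_algebra sA"
  shows "submodule M (socle s M)"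
proof -
  interpret vector_space s using fd_moduleD(1)[OF assms(1)] .
  let ?X = "\<Union>{N. submodule M N \<and> simple_module (M\<lparr>car := N\<rparr>)}"
  have X: "?X \<subseteq> car M"
  proof
    fix x assume "x \<in> ?X"
    then obtain N where "submodule M N" "x \<in> N" by blast
    then show "x \<in> car M" using submoduleD(1)[of M N] by blast
  qed
  then have sub: "socle s M \<subseteq> car M"
    unfolding socle_def using fd_moduleD(2)[OF assms(1)] by (rule span_minimal)
  have "act M a x \<in> socle s M" if "x \<in> socle s M" for a x
  proof -
    have "subspace {x \<in> car M. act M a x \<in> socle s M}"
      using fd_moduleD(5)[OF assms(1)] fd_module_closed(1,2,4)[OF assms(1)] act_zero(1)[OF assms(1)]
        act_scale[OF assms] unfolding socle_def
      by (auto simp: subspace_def span_add span_scale span_zero)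
    moreover have "?X \<subseteq> {x \<in> car M. act M a x \<in> socle s M}"
    proof
      fix x assume x: "x \<in> ?X"
      then obtain N where N: "submodule M N" "simple_module (M\<lparr>car := N\<rparr>)" "x \<in> N" by blast
      then have "act M a x \<in> ?X" using submoduleD(4)[OF N(1,3)] by blast
      then show "x \<in> {x \<in> car M. act M a x \<in> socle s M}"
        using X x span_base unfolding socle_def by auto
    qed
    ultimately show ?thesis using that span_minimal unfolding socle_def by blast
  qed
  then show ?thesis
    using sub unfolding submodule_def socle_def by (auto intro: span_add span_zero)
qed

section \<open>Projective covers with simple socle in top degree\<close>

locale socle_projective = local_projective sA GA sP sL P L \<pi>
  for sA :: "'k::alg_closed_field \<Rightarrow> 'a::ring_1 \<Rightarrow> 'a" and GA :: "nat \<Rightarrow> 'a set"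
    and sP :: "'k \<Rightarrow> 'm::ab_group_add \<Rightarrow> 'm" and sL :: "'k \<Rightarrow> 'n::ab_group_add \<Rightarrow> 'n"
    and P :: "('a, 'm) gmodule" and L :: "('a, 'n) gmodule" and \<pi> :: "'m \<Rightarrow> 'n" +
  assumes top_socle: "grade P (top_degree P) = socle sP P"
    and socle_iso: "graded_iso (graded_restrict P (socle sP P)) (shift L (top_degree P))"
begin

abbreviation "S \<equiv> P\<lparr>car := socle sP P\<rparr>"

lemma fdS: "fd_module sA sP S"
  using fd_module_submodule[OF fdP submodule_socle[OF fdP]] fd_algebra_axioms by blast

lemma socle_iso_hom: "\<exists>f\<in>mod_hom S L. bij_betw f (car S) (car L)"
proof -
  obtain f where "f \<in> mod_hom (graded_restrict P (socle sP P)) (shift L (top_degree P))"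
    "bij_betw f (car (graded_restrict P (socle sP P))) (car (shift L (top_degree P)))"
    using socle_iso by (rule graded_isoE)
  then show ?thesis
    by (intro bexI[of _ f]) (auto simp: graded_restrict_def shift_def mod_hom_def)
qed

lemma simple_socle: "simple_module S"
  using socle_iso_hom simple_module_iso[OF fdS _ _ simple] by blast

lemma mod_hom_socle: "f \<in> mod_hom P S \<Longrightarrow> f \<in> mod_hom P P"
  using submoduleD(1)[OF submodule_socle[OF fdP fd_algebra_axioms]] by (auto simp: mod_hom_def)

text \<open>The endomorphism is \<pi> followed by an isomorphism from \<open>L\<close> onto the
  socle.\<close>

lemma exists_socle_endo: "\<exists>\<theta>. \<theta> \<in> mod_hom P P \<and> \<theta> \<noteq> 0 \<and> \<theta> ` car P = socle sP P"
proof -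
  obtain f where f: "f \<in> mod_hom S L" "bij_betw f (car S) (car L)" using socle_iso_hom by blast
  obtain g where g: "g \<in> mod_hom L S" "\<And>x. x \<in> car S \<Longrightarrow> g (f x) = x"
    "\<And>y. y \<in> car L \<Longrightarrow> f (g y) = y"
    using mod_hom_inverse[OF fdS f] by blast
  have gp: "g \<circ> \<pi> \<in> mod_hom P S" using \<pi> g(1) by (rule mod_hom_comp)
  have "f ((g \<circ> \<pi>) gen) = \<pi> gen" using g(3) mod_homD(1)[OF \<pi> gen(3)] by simp
  then have "g \<circ> \<pi> \<noteq> 0" using mod_hom_zero[OF f(1)] gen(2) by (metis zero_fun_apply)
  moreover from this have "(g \<circ> \<pi>) ` car P = car S"
    by (rule hom_to_simple_kernel(1)[OF fdS simple_socle gp])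
  moreover have "car S = socle sP P" by simp
  ultimately show ?thesis using mod_hom_socle[OF gp] by metis
qed

text \<open>Schur's lemma for the simple module \<open>S\<close>: an eigenvalue of the endomorphism of \<open>S\<close>
  induced by \<open>\<theta>\<close> and \<open>f\<close> is the scalar.\<close>

lemma socle_hom_unique:
  assumes \<theta>: "\<theta> \<in> mod_hom P P" "\<theta> \<noteq> 0" "\<theta> ` car P = socle sP P"
    and f: "f \<in> mod_hom P P" "f ` car P \<subseteq> socle sP P"
  shows "\<exists>c. f = fscale sP c \<theta>"
proof -
  interpret vP: vector_space sP using fd_moduleD(1)[OF fdP] .
  have \<theta>S: "\<theta> \<in> mod_hom P S" and fS: "f \<in> mod_hom P S"
    using mod_hom_corestrict[OF \<theta>(1)] mod_hom_corestrict[OF f(1)] \<theta>(3) f(2) by auto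
  note ker\<theta> = hom_to_simple_kernel(2)[OF fdS simple_socle \<theta>S \<theta>(2)]
  have kerf: "f x = 0" if "x \<in> car P" "\<theta> x = 0" for x
    using hom_to_simple_kernel(2)[OF fdS simple_socle fS _ that(1)] ker\<theta>[OF that(1)] that(2)
    by (cases "f = 0") simp_all
  have "\<theta> ` car P = car S" using \<theta>(3) by simp
  from mod_hom_factor[OF fdP \<theta>S this fS kerf]
  obtain T where T: "T \<in> mod_hom S S" "\<And>x. x \<in> car P \<Longrightarrow> T (\<theta> x) = f x" by blast
  obtain B where B: "finite B" "vP.span B = car S" using fd_moduleD(3)[OF fdS] by blast
  have "car S \<noteq> {0}" using simple_socle unfolding simple_module_def by blast
  have "\<exists>c. \<exists>v\<in>car S. v \<noteq> 0 \<and> T v = sP c v"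
    by (rule exists_eigenvector[OF fd_moduleD(1)[OF fdS] B \<open>car S \<noteq> {0}\<close>])
      (use mod_homD(1,3)[OF T(1)] mod_hom_scale[OF fdS fdS T(1)] in auto)
  then obtain c v where v: "v \<in> car S" "v \<noteq> 0" "T v = sP c v" by blast
  obtain x where x: "x \<in> car P" "\<theta> x = v"
    using v(1) \<open>\<theta> ` car P = car S\<close> by (metis imageE)
  define h where "h = f + fscale sP (- c) \<theta>"
  have h: "h \<in> mod_hom P S"
    unfolding h_def by (intro mod_hom_add[OF fdS] fS mod_hom_fscale[OF fdS fd_algebra_axioms] \<theta>S)
  have "h x = 0" using T(2)[OF x(1)] v(3) x(2) by (simp add: h_def fscale_def)
  then have "h = 0"
    using hom_to_simple_kernel(2)[OF fdS simple_socle h _ x(1)] ker\<theta>[OF x(1)] v(2) x(2) by auto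
  have "f x = sP c (\<theta> x)" for x
    using fun_cong[OF \<open>h = 0\<close>, of x] by (simp add: h_def fscale_def)
  then show ?thesis unfolding fscale_def by blast
qed

text \<open>\<theta> has the same kernel as \<pi>, so it kills all degrees but 0, and degree 0 is
  sent into the socle, which is the component of top degree.\<close>

lemma socle_endo_deg:
  assumes \<theta>: "\<theta> \<in> mod_hom P P" "\<theta> \<noteq> 0" "\<theta> ` car P = socle sP P"
  shows "\<theta> \<in> mod_hom_deg P P (top_degree P)"
proof -
  have \<theta>S: "\<theta> \<in> mod_hom P S" using mod_hom_corestrict[OF \<theta>(1)] \<theta>(3) by auto
  have "\<theta> x \<in> grade P (k + top_degree P)" if x: "x \<in> grade P k" for x k
  proof (cases "k = 0")
    case True
    then show ?thesis using top_socle \<theta>(3) graded_moduleD(4)[OF P x] by auto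
  next
    case False
    then have "grade L k = {0}" using conc unfolding concentrated_def by blast
    then have "\<pi> x = 0" using mod_hom_degD(2)[OF \<pi>_deg x] by auto
    then have "\<theta> x = 0"
      using hom_to_simple_kernel(2)[OF fdS simple_socle \<theta>S \<theta>(2)] graded_moduleD(4)[OF P x] by blast
    then show ?thesis using graded_moduleD(5)[OF P] by simp
  qed
  then show ?thesis using \<theta>(1) unfolding mod_hom_deg_def by auto
qed

lemma lift_socle_endo:
  assumes \<theta>: "\<theta> \<in> mod_hom P P" "\<theta> ` car P = socle sP P"
    and Q: "fd_module sA s Q" and f: "f \<in> mod_hom Q P" "f \<noteq> 0"
  obtains g where "g \<in> mod_hom P Q" "f \<circ> g = \<theta>"
proof -
  let ?I = "f ` car Q"
  have I: "submodule P ?I" by (rule submodule_image[OF Q f(1) submodule_car(1)[OF Q]])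
  obtain z where "f z \<noteq> 0" using f(2) by (auto simp: fun_eq_iff)
  then have "?I \<noteq> {0}" using mod_homD(2)[OF f(1)] by blast
  then obtain N where N: "N \<subseteq> ?I" "submodule P N" "simple_module (P\<lparr>car := N\<rparr>)"
    using exists_simple_submodule[OF fdP I] by blast
  interpret vP: vector_space sP using fd_moduleD(1)[OF fdP] .
  \<comment> \<open>A simple submodule of the image lies in the socle; the socle being simple, the
    two are equal.\<close>
  have "N \<subseteq> socle sP P" unfolding socle_def using N(2,3) by (blast intro: vP.span_base)
  then have "submodule S N" using N(2) unfolding submodule_def by auto
  moreover have "N \<noteq> {0}" using N(3) unfolding simple_module_def by auto
  ultimately have "N = socle sP P" using simple_moduleD[OF simple_socle] by auto
  then have \<theta>I: "\<theta> \<in> mod_hom P (P\<lparr>car := ?I\<rparr>)"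
    using mod_hom_corestrict[OF \<theta>(1)] \<theta>(2) N(1) by auto
  have fI: "f \<in> mod_hom Q (P\<lparr>car := ?I\<rparr>)" using mod_hom_corestrict[OF f(1)] by auto
  show thesis
    using projective_lift[OF projective Q fd_module_submodule[OF fdP I] fI _ \<theta>I] that by auto
qed

end

text \<open>Lifting \<open>P\<^sub>\<kappa> \<rightarrow> L\<^sub>\<kappa>\<close> along \<open>A \<rightarrow> L\<^sub>\<kappa>\<close> gives elements of \<open>A\<close> that
  act nontrivially on exactly one simple module, hence are linearly independent.\<close>

lemma finite_simple_index:
  fixes sA :: "'k::field \<Rightarrow> 'a::ring_1 \<Rightarrow> 'a" and sL :: "'k \<Rightarrow> 'n::ab_group_add \<Rightarrow> 'n"
    and P :: "'l \<Rightarrow> ('a, 'm::ab_group_add) gmodule"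
  assumes loc: "\<And>\<kappa>. \<kappa> \<in> \<Lambda> \<Longrightarrow> local_projective sA GA sP sL (P \<kappa>) (L \<kappa>) (\<pi> \<kappa>)"
    and non_iso: "\<And>\<kappa> \<mu>. \<kappa> \<in> \<Lambda> \<Longrightarrow> \<mu> \<in> \<Lambda> \<Longrightarrow> mod_iso (L \<kappa>) (L \<mu>) \<Longrightarrow> \<kappa> = \<mu>"
  shows "finite \<Lambda>"
proof (cases "\<Lambda> = {}")
  case False
  then obtain \<kappa>0 where "\<kappa>0 \<in> \<Lambda>" by blast
  interpret l0: local_projective sA GA sP sL "P \<kappa>0" "L \<kappa>0" "\<pi> \<kappa>0" by (rule loc) fact
  define R :: "('a, 'a) lmodule" where "R = \<lparr>car = UNIV, act = (*)\<rparr>"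
  have fdR: "fd_module sA sA R"
    using l0.finite_dim
    by (auto simp: fd_module_def R_def l0.vector_space_axioms algebra_simps
        l0.scale_mult_left[symmetric])
  define x where "x \<kappa> = local_projective.gen (P \<kappa>) (\<pi> \<kappa>)" for \<kappa>
  define v where "v \<kappa> = \<pi> \<kappa> (x \<kappa>)" for \<kappa>
  have ev: "(\<lambda>a. act (L \<kappa>) a y) \<in> mod_hom R (L \<kappa>)" if "\<kappa> \<in> \<Lambda>" "y \<in> car (L \<kappa>)" for \<kappa> y
  proof -
    interpret local_projective sA GA sP sL "P \<kappa>" "L \<kappa>" "\<pi> \<kappa>" by (rule loc) fact
    show ?thesis
      by (rule mod_homI) (use fd_moduleD[OF fdL] that(2) in \<open>auto simp: R_def\<close>)
  qed
  have "\<exists>e. act (L \<kappa>) e (v \<kappa>) \<noteq> 0 \<and> (\<forall>\<mu>\<in>\<Lambda>. \<mu> \<noteq> \<kappa> \<longrightarrow> act (L \<mu>) e (v \<mu>) = 0)" if \<kappa>: "\<kappa> \<in> \<Lambda>" for \<kappa>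
  proof -
    interpret local_projective sA GA sP sL "P \<kappa>" "L \<kappa>" "\<pi> \<kappa>" by (rule loc) fact
    have x: "x \<kappa> = gen" by (simp add: x_def)
    have v: "v \<kappa> \<in> car (L \<kappa>)" "v \<kappa> \<noteq> 0"
      using mod_homD(1)[OF \<pi> gen(3)] gen(2) by (auto simp: v_def x)
    have "submodule (L \<kappa>) (range (\<lambda>a. act (L \<kappa>) a (v \<kappa>)))"
      using submodule_image[OF fdR ev[OF \<kappa> v(1)] submodule_car(1)[OF fdR]] by (simp add: R_def)
    moreover have "v \<kappa> \<in> range (\<lambda>a. act (L \<kappa>) a (v \<kappa>))"
      using fd_moduleD(8)[OF fdL v(1)] by (metis rangeI)
    ultimately have "range (\<lambda>a. act (L \<kappa>) a (v \<kappa>)) = car (L \<kappa>)"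
      using simple_moduleD[OF simple] v(2) by blast
    then obtain q where q: "q \<in> mod_hom (P \<kappa>) R" "(\<lambda>a. act (L \<kappa>) a (v \<kappa>)) \<circ> q = \<pi> \<kappa>"
      using projective_lift[OF projective fdR fdL ev[OF \<kappa> v(1)] _ \<pi>] by (auto simp: R_def)
    have "act (L \<kappa>) (q gen) (v \<kappa>) = \<pi> \<kappa> gen" using fun_cong[OF q(2), of gen] by simp
    then have "act (L \<kappa>) (q gen) (v \<kappa>) \<noteq> 0" using gen(2) by simp
    moreover have "act (L \<mu>) (q gen) (v \<mu>) = 0" if \<mu>: "\<mu> \<in> \<Lambda>" "\<mu> \<noteq> \<kappa>" for \<mu>
    proof (rule ccontr)
      assume nz: "act (L \<mu>) (q gen) (v \<mu>) \<noteq> 0"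
      interpret \<mu>: local_projective sA GA sP sL "P \<mu>" "L \<mu>" "\<pi> \<mu>" by (rule loc) fact
      have "v \<mu> \<in> car (L \<mu>)"
        using mod_homD(1)[OF \<mu>.\<pi> \<mu>.gen(3)] by (simp add: v_def x_def)
      define h where "h = (\<lambda>a. act (L \<mu>) a (v \<mu>)) \<circ> q"
      have h: "h \<in> mod_hom (P \<kappa>) (L \<mu>)"
        unfolding h_def by (rule mod_hom_comp[OF q(1) ev]) fact+
      have "h \<noteq> 0" using nz by (auto simp: h_def fun_eq_iff)
      \<comment> \<open>A nonzero \<open>h\<close> has the same kernel as
        \<open>\<pi> \<kappa>\<close>, so it induces an isomorphism between two simple modules with
        different indices.\<close>
      note hk = hom_to_simple_kernel[OF \<mu>.fdL \<mu>.simple h this]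
      obtain k where k: "k \<in> mod_hom (L \<kappa>) (L \<mu>)" "\<And>y. y \<in> car (P \<kappa>) \<Longrightarrow> k (\<pi> \<kappa> y) = h y"
        using mod_hom_factor[OF fdP \<pi> \<pi>_surj h] hk(2) by blast
      have "k ` car (L \<kappa>) = car (L \<mu>)"
        unfolding \<pi>_surj[symmetric] hk(1)[symmetric] using k(2) by (force simp: image_image)
      moreover have "inj_on k (car (L \<kappa>))"
      proof (rule inj_onI)
        fix y z assume yz: "y \<in> car (L \<kappa>)" "z \<in> car (L \<kappa>)" "k y = k z"
        then obtain u where u: "u \<in> car (P \<kappa>)" "\<pi> \<kappa> u = y - z"
          using \<pi>_surj fd_module_closed(3)[OF fdL] by (metis imageE)
        then have "h u = 0" using k(2)[OF u(1)] mod_hom_diff[OF fdL k(1)] yz by simp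
        then show "y = z" using hk(2)[OF u(1)] u(2) by simp
      qed
      ultimately have "mod_iso (L \<kappa>) (L \<mu>)" using k(1) unfolding mod_iso_def bij_betw_def by blast
      then show False using non_iso \<kappa> \<mu> by blast
    qed
    ultimately show ?thesis by blast
  qed
  then obtain e where e: "\<And>\<kappa>. \<kappa> \<in> \<Lambda> \<Longrightarrow> act (L \<kappa>) (e \<kappa>) (v \<kappa>) \<noteq> 0"
    "\<And>\<kappa> \<mu>. \<kappa> \<in> \<Lambda> \<Longrightarrow> \<mu> \<in> \<Lambda> \<Longrightarrow> \<mu> \<noteq> \<kappa> \<Longrightarrow> act (L \<mu>) (e \<kappa>) (v \<mu>) = 0" by metis
  have inj: "inj_on e \<Lambda>" by (rule inj_onI) (use e in metis)
  have "l0.independent (e ` \<Lambda>)"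
    unfolding l0.dependent_explicit
  proof safe
    fix t u b assume t: "finite t" "t \<subseteq> e ` \<Lambda>" "(\<Sum>b\<in>t. sA (u b) b) = 0" "b \<in> t" "u b \<noteq> 0"
    then obtain \<kappa> where \<kappa>: "\<kappa> \<in> \<Lambda>" "b = e \<kappa>" by blast
    interpret local_projective sA GA sP sL "P \<kappa>" "L \<kappa>" "\<pi> \<kappa>" by (rule loc) fact
    interpret vL: vector_space sL using fd_moduleD(1)[OF fdL] .
    have v: "v \<kappa> \<in> car (L \<kappa>)" using mod_homD(1)[OF \<pi> gen(3)] by (simp add: v_def x_def)
    \<comment> \<open>Letting a linear relation act on \<open>v \<kappa>\<close> leaves the single
      coefficient of \<open>e \<kappa>\<close>.\<close>
    have "0 = act (L \<kappa>) (\<Sum>b\<in>t. sA (u b) b) (v \<kappa>)" using t(3) act_zero(2)[OF fdL v] by simp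
    also have "\<dots> = (\<Sum>b'\<in>t. sL (u b') (act (L \<kappa>) b' (v \<kappa>)))"
      by (simp add: act_sum(2)[OF fdL v] fd_moduleD(9)[OF fdL v])
    also have "\<dots> = (\<Sum>b'\<in>t. if b' = b then sL (u b) (act (L \<kappa>) b (v \<kappa>)) else 0)"
    proof (rule sum.cong)
      fix b' assume "b' \<in> t"
      then obtain \<mu> where "\<mu> \<in> \<Lambda>" "b' = e \<mu>" using t(2) by blast
      then show "sL (u b') (act (L \<kappa>) b' (v \<kappa>)) = (if b' = b then sL (u b) (act (L \<kappa>) b (v \<kappa>)) else 0)"
        using e(2)[of \<mu> \<kappa>] \<kappa> by auto
    qed simp
    also have "\<dots> = sL (u b) (act (L \<kappa>) b (v \<kappa>))" using t(1,4) by simp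
    finally show False using t(5) e(1) \<kappa> by simp
  qed
  moreover obtain B where "finite B" "l0.span B = UNIV" using l0.finite_dim by blast
  ultimately have "finite (e ` \<Lambda>)" using l0.independent_span_bound[of B "e ` \<Lambda>"] by auto
  then show ?thesis using inj by (rule finite_imageD)
qed simp

section \<open>Homogeneous bases adapted to a symmetric form\<close>

text \<open>The Gram matrix of \<open>S\<close> is monomial: one nonzero entry in each row. This is
  the partner condition of an admissible basis, stated for values of a form instead of
  composites.\<close>

definition paired :: "('v \<Rightarrow> 'v \<Rightarrow> 'k::zero) \<Rightarrow> 'v set \<Rightarrow> bool" where
  "paired b S \<longleftrightarrow> (\<forall>u\<in>S. \<exists>v\<in>S. b u v \<noteq> 0 \<and> (\<forall>w\<in>S. w \<noteq> v \<longrightarrow> b u w = 0))"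

text \<open>Symmetry turns the choice of partners into an involution: \<open>u\<close> pairs with
  \<open>p u\<close>, so it must be the only element that \<open>p u\<close> pairs with.\<close>

lemma paired_partner:
  assumes "paired b S" "\<And>x y. x \<in> S \<Longrightarrow> y \<in> S \<Longrightarrow> b x y = b y x"
  obtains p where "\<And>u. u \<in> S \<Longrightarrow> p u \<in> S" "\<And>u. u \<in> S \<Longrightarrow> p (p u) = u"
    "\<And>u. u \<in> S \<Longrightarrow> b u (p u) \<noteq> 0" "\<And>u w. u \<in> S \<Longrightarrow> w \<in> S \<Longrightarrow> w \<noteq> p u \<Longrightarrow> b u w = 0"
proof -
  obtain p where p: "\<forall>u\<in>S. p u \<in> S \<and> b u (p u) \<noteq> 0 \<and> (\<forall>w\<in>S. w \<noteq> p u \<longrightarrow> b u w = 0)"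
    using assms(1) unfolding paired_def by metis
  moreover have "p (p u) = u" if "u \<in> S" for u using p that assms(2) by metis
  ultimately show thesis using that by blast
qed

text \<open>The pieces \<open>W t\<close> are the homogeneous blocks and \<sigma> is the duality of
  blocks: \<open>W t\<close> can pair nontrivially only with \<open>W (\<sigma> t)\<close>.
  Nondegeneracy is stated for homogeneous vectors, where it can be verified.\<close>

locale graded_form = vector_space scale
  for scale :: "'k::field \<Rightarrow> 'v::ab_group_add \<Rightarrow> 'v" +
  fixes B :: "'v set" and b :: "'v \<Rightarrow> 'v \<Rightarrow> 'k" and T :: "'t set" and W :: "'t \<Rightarrow> 'v set"
    and \<sigma> :: "'t \<Rightarrow> 't"
  assumes subspace_B: "subspace B"
    and b_add: "x \<in> B \<Longrightarrow> y \<in> B \<Longrightarrow> z \<in> B \<Longrightarrow> b (x + y) z = b x z + b y z"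
    and b_scale: "x \<in> B \<Longrightarrow> z \<in> B \<Longrightarrow> b (scale c x) z = c * b x z"
    and b_sym: "x \<in> B \<Longrightarrow> y \<in> B \<Longrightarrow> b x y = b y x"
    and subspace_W: "t \<in> T \<Longrightarrow> subspace (W t)"
    and span_W: "span (\<Union>t\<in>T. W t) = B"
    and b_orth: "t \<in> T \<Longrightarrow> t' \<in> T \<Longrightarrow> x \<in> W t \<Longrightarrow> y \<in> W t' \<Longrightarrow> b x y \<noteq> 0 \<Longrightarrow> t' = \<sigma> t"
    and b_nondeg: "t \<in> T \<Longrightarrow> x \<in> W t \<Longrightarrow> x \<noteq> 0 \<Longrightarrow> \<exists>y\<in>B. b x y \<noteq> 0"
begin

abbreviation "H \<equiv> \<Union>t\<in>T. W t"

lemma H_B: "H \<subseteq> B" using span_W span_superset by blast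

lemma W_B: "t \<in> T \<Longrightarrow> x \<in> W t \<Longrightarrow> x \<in> B" using H_B by blast

lemma b_zero: "z \<in> B \<Longrightarrow> b 0 z = 0"
  using b_scale[of 0 z 0] subspace_0[OF subspace_B] by simp

lemma b_sum:
  assumes "z \<in> B" "\<And>i. i \<in> K \<Longrightarrow> g i \<in> B"
  shows "b (\<Sum>i\<in>K. scale (a i) (g i)) z = (\<Sum>i\<in>K. a i * b (g i) z)"
proof -
  have "b (\<Sum>i\<in>K. scale (a i) (g i)) z = (\<Sum>i\<in>K. b (scale (a i) (g i)) z)"
    by (rule additive_on_sum[of B "\<lambda>x. b x z"])
      (use assms subspace_B b_add in \<open>auto simp: subspace_0 subspace_add subspace_scale\<close>)
  then show ?thesis using assms b_scale by simp
qed

lemma b_span_zero: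
  assumes "x \<in> B" "S \<subseteq> B" "\<And>u. u \<in> S \<Longrightarrow> b u x = 0" "y \<in> span S"
  shows "b y x = 0"
proof -
  have "subspace {y \<in> B. b y x = 0}"
    using assms(1) subspace_B unfolding subspace_def by (simp add: b_add b_scale b_zero)
  then have "span S \<subseteq> {y \<in> B. b y x = 0}" using assms(2,3) by (intro span_minimal) auto
  then show ?thesis using assms(4) by blast
qed

text \<open>A homogeneous vector orthogonal to all homogeneous ones is orthogonal to their span
  \<open>B\<close>.\<close>

lemma b_nondeg_homogeneous:
  assumes "t \<in> T" "x \<in> W t" "x \<noteq> 0"
  shows "\<exists>t'\<in>T. \<exists>y\<in>W t'. b x y \<noteq> 0"
proof (rule ccontr)
  assume "\<not> ?thesis"
  then have "b x y = 0" if "y \<in> H" for y using that by blast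
  then have "b y x = 0" if "y \<in> H" for y
    using b_sym[OF W_B[OF assms(1,2)], of y] H_B that by (metis subsetD)
  then have "b y x = 0" if "y \<in> B" for y
    by (rule b_span_zero[OF W_B[OF assms(1,2)] H_B]) (use that span_W in auto)
  then show False using b_nondeg[OF assms] b_sym W_B assms by metis
qed

text \<open>Pairing a linear relation with \<open>p v\<close> isolates the coefficient of
  \<open>v\<close>.\<close>

lemma paired_independent:
  assumes "paired b S" "S \<subseteq> B"
  shows "independent S"
  unfolding dependent_explicit
proof safe
  fix t u v assume t: "finite t" "t \<subseteq> S" "(\<Sum>v\<in>t. scale (u v) v) = 0" "v \<in> t" "u v \<noteq> 0"
  obtain p where p: "\<And>u. u \<in> S \<Longrightarrow> p u \<in> S" "\<And>u. u \<in> S \<Longrightarrow> p (p u) = u"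
    "\<And>u. u \<in> S \<Longrightarrow> b u (p u) \<noteq> 0" "\<And>u w. u \<in> S \<Longrightarrow> w \<in> S \<Longrightarrow> w \<noteq> p u \<Longrightarrow> b u w = 0"
    by (rule paired_partner[OF assms(1)]) (use b_sym assms(2) in blast)+
  have vS: "v \<in> S" "p v \<in> B" using t assms p(1) by blast+
  have "0 = b (\<Sum>w\<in>t. scale (u w) w) (p v)" using t(3) b_zero vS(2) by simp
  also have "\<dots> = (\<Sum>w\<in>t. u w * b w (p v))"
    by (rule b_sum) (use vS t(2) assms(2) in auto)
  also have "\<dots> = (\<Sum>w\<in>t. if w = v then u v * b v (p v) else 0)"
  proof (rule sum.cong)
    fix w assume "w \<in> t"
    then have "w \<in> S" using t(2) by blast
    moreover from this have "p v \<noteq> p w" if "w \<noteq> v" using p(2) vS(1) that by metis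
    ultimately show "u w * b w (p v) = (if w = v then u v * b v (p v) else 0)"
      using p(4)[of w "p v"] p(1)[OF vS(1)] by (cases "w = v") auto
  qed simp
  also have "\<dots> = u v * b v (p v)" using t(1,4) by simp
  finally show False using t(5) p(3) vS(1) by simp
qed

text \<open>From \<open>x\<close> a combination of \<open>S\<close> is subtracted whose coefficients
  are forced by pairing with the partners. The point is that the result is homogeneous of the same
  type \<open>t\<close>.\<close>

lemma orthogonal_projection:
  assumes S: "paired b S" "S \<subseteq> H" "finite S" and x: "t \<in> T" "x \<in> W t"
  obtains w where "w \<in> W t" "x - w \<in> span S" "\<And>v. v \<in> S \<Longrightarrow> b w v = 0"
proof -
  have SB: "u \<in> S \<Longrightarrow> u \<in> B" for u using S(2) H_B by blast
  obtain p where p: "\<And>u. u \<in> S \<Longrightarrow> p u \<in> S" "\<And>u. u \<in> S \<Longrightarrow> p (p u) = u"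
    "\<And>u. u \<in> S \<Longrightarrow> b u (p u) \<noteq> 0" "\<And>u w. u \<in> S \<Longrightarrow> w \<in> S \<Longrightarrow> w \<noteq> p u \<Longrightarrow> b u w = 0"
    by (rule paired_partner[OF S(1)]) (use b_sym SB in blast)+
  have xB: "x \<in> B" using W_B x by blast
  define a where "a u = b x (p u) / b u (p u)" for u
  define y where "y = (\<Sum>u\<in>S. scale (a u) u)"
  \<comment> \<open>If \<open>a u\<close> is nonzero, then \<open>p u\<close> pairs nontrivially
    with both \<open>x\<close> and \<open>u\<close>; the blocks of both are then dual to that of
    \<open>p u\<close>, so \<open>u\<close> lies in \<open>W t\<close> itself.\<close>
  have "scale (a u) u \<in> W t" if u: "u \<in> S" for u
  proof (cases "b x (p u) = 0")
    case True
    then show ?thesis using subspace_0[OF subspace_W[OF x(1)]] by (simp add: a_def)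
  next
    case False
    obtain r where r: "r \<in> T" "u \<in> W r" using u S(2) by blast
    obtain r' where r': "r' \<in> T" "p u \<in> W r'" using p(1)[OF u] S(2) by blast
    have "b (p u) x \<noteq> 0" "b (p u) u \<noteq> 0" using False p(1,3)[OF u] b_sym SB u xB by metis+
    then have "t = r" using b_orth[OF r'(1) x(1) r'(2) x(2)] b_orth[OF r'(1) r(1) r'(2) r(2)] by simp
    then show ?thesis using subspace_W[OF x(1)] r by (auto simp: subspace_scale)
  qed
  then have yW: "y \<in> W t" unfolding y_def by (rule subspace_sum[OF subspace_W[OF x(1)]])
  have "b (x - y) v = 0" if v: "v \<in> S" for v
  proof -
    have yB: "y \<in> B" using yW W_B x by blast
    have "b y v = (\<Sum>u\<in>S. a u * b u v)" unfolding y_def by (rule b_sum) (use SB v in auto)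
    also have "\<dots> = (\<Sum>u\<in>S. if u = p v then b x v else 0)"
    proof (rule sum.cong)
      fix u assume "u \<in> S"
      moreover from this have "v \<noteq> p u" if "u \<noteq> p v" using p(2) that by metis
      ultimately show "a u * b u v = (if u = p v then b x v else 0)"
        using p(4)[of u v] p(2)[OF v] p(3)[of u] v by (cases "u = p v") (auto simp: a_def)
    qed simp
    also have "\<dots> = b x v" using S(3) p(1)[OF v] by simp
    finally have "b y v = b x v" .
    moreover have "b x v = b (x - y) v + b y v"
      using b_add[of "x - y" y v] xB yB SB[OF v] subspace_diff[OF subspace_B] by simp
    ultimately show ?thesis by simp
  qed
  moreover have "x - y \<in> W t" using subspace_diff[OF subspace_W[OF x(1)]] x yW by blast
  moreover have "x - (x - y) \<in> span S"
    unfolding y_def by (simp add: span_sum span_scale span_base)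
  ultimately show thesis using that by blast
qed

text \<open>A homogeneous vector orthogonal to \<open>S\<close> is either anisotropic or spans a
  hyperbolic plane together with a second one; this also covers characteristic 2.\<close>

lemma paired_extend:
  assumes S: "paired b S" "S \<subseteq> H" "finite S" and "span S \<noteq> B"
  shows "\<exists>S'. S \<subset> S' \<and> paired b S' \<and> S' \<subseteq> H \<and> finite S'"
proof -
  have SB: "u \<in> S \<Longrightarrow> u \<in> B" for u using S(2) H_B by blast
  have "\<not> H \<subseteq> span S"
    using \<open>span S \<noteq> B\<close> span_W span_minimal[OF _ subspace_span] span_mono[OF S(2)] by blast
  then obtain x t where x: "t \<in> T" "x \<in> W t" "x \<notin> span S" by blast
  obtain w where w: "w \<in> W t" "x - w \<in> span S" "\<And>v. v \<in> S \<Longrightarrow> b w v = 0"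
    using orthogonal_projection[OF S x(1,2)] by blast
  have wS: "w \<notin> span S" using x(3) w(2) by (metis diff_add_cancel span_add)
  then have wS': "w \<notin> S" using span_base by blast
  have wB: "w \<in> B" using W_B x(1) w(1) by blast
  have extend: "paired b (insert z S)" if "z \<in> B" "\<And>v. v \<in> S \<Longrightarrow> b z v = 0" "b z z \<noteq> 0" for z
  proof -
    have "b v z = 0" if "v \<in> S" for v using that \<open>\<And>v. v \<in> S \<Longrightarrow> b z v = 0\<close> b_sym SB \<open>z \<in> B\<close> by metis
    then show ?thesis using S(1) that unfolding paired_def by (auto; blast)
  qed
  show ?thesis
  proof (cases "b w w = 0")
    case False
    then show ?thesis
      using extend[of w] wB w(1,3) wS' S x(1) by (intro exI[of _ "insert w S"]) auto
  next
    case True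
    have "w \<noteq> 0" using wS span_zero by blast
    then obtain t' y where y: "t' \<in> T" "y \<in> W t'" "b w y \<noteq> 0"
      using b_nondeg_homogeneous[OF x(1) w(1)] by blast
    obtain z where z: "z \<in> W t'" "y - z \<in> span S" "\<And>v. v \<in> S \<Longrightarrow> b z v = 0"
      using orthogonal_projection[OF S y(1,2)] by blast
    have yB: "y \<in> B" and zB: "z \<in> B" using W_B y z(1) by blast+
    \<comment> \<open>Passing from \<open>y\<close> to \<open>z\<close> changes it by an element of
      the span of \<open>S\<close>, to which \<open>w\<close> is orthogonal.\<close>
    have "b (y - z) w = 0"
      by (rule b_span_zero[OF wB _ _ z(2)]) (use SB w(3) b_sym wB in auto)
    then have "b w z \<noteq> 0"
      using y(3) b_add[of "y - z" z w] b_sym wB yB zB subspace_diff[OF subspace_B yB zB] by simp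
    show ?thesis
    proof (cases "b z z = 0")
      \<comment> \<open>Here \<open>z\<close> alone is adjoined; it is outside \<open>S\<close>
        because \<open>w\<close> pairs with it but with nothing in \<open>S\<close>. Any strict
        enlargement will do, so \<open>w\<close> may stay outside.\<close>
      case False
      then show ?thesis
        using extend[of z] zB z w(3) \<open>b w z \<noteq> 0\<close> S y(1) by (intro exI[of _ "insert z S"]) auto
    next
      case zz: True
      have "b v w = 0" "b v z = 0" if "v \<in> S" for v using that w(3) z(3) b_sym SB wB zB by metis+
      moreover have "b z w \<noteq> 0" using \<open>b w z \<noteq> 0\<close> b_sym wB zB by simp
      ultimately have "paired b (insert w (insert z S))"
        using S(1) True zz \<open>b w z \<noteq> 0\<close> w(3) z(3) unfolding paired_def by (auto; blast)
      then show ?thesis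
        using w(1) z(1) x(1) y(1) S wS'
        by (intro exI[of _ "insert w (insert z S)"]) auto
    qed
  qed
qed

text \<open>Paired sets are independent, so their size is bounded by that of \<open>C\<close>, and
  one of greatest size above \<open>S0\<close> cannot be enlarged.\<close>

lemma exists_paired_basis:
  assumes S0: "paired b S0" "S0 \<subseteq> H" "finite S0" and C: "finite C" "B \<subseteq> span C"
  obtains S where "S0 \<subseteq> S" "paired b S" "S \<subseteq> H" "finite S" "independent S" "span S = B"
proof -
  let ?Q = "\<lambda>S. S0 \<subseteq> S \<and> paired b S \<and> S \<subseteq> H \<and> finite S"
  have "card S < Suc (card C)" if "?Q S" for S
  proof -
    have "S \<subseteq> B" using that H_B by blast
    have "S \<subseteq> span C" using \<open>S \<subseteq> B\<close> C(2) by (rule subset_trans)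
    moreover have "independent S" using paired_independent \<open>S \<subseteq> B\<close> that by blast
    ultimately show ?thesis using independent_span_bound[OF C(1)] by (simp add: le_imp_less_Suc)
  qed
  then obtain S where S: "?Q S" "\<And>S'. ?Q S' \<Longrightarrow> card S' \<le> card S"
    using ex_has_greatest_nat[of ?Q S0 card "Suc (card C)"] S0 by blast
  have "span S = B"
  proof (rule ccontr)
    assume "span S \<noteq> B"
    from S(1) paired_extend[OF _ _ _ this] obtain S' where S': "S \<subset> S'" "paired b S'" "S' \<subseteq> H" "finite S'"
      by auto
    have "card S' \<le> card S" using S(1) S' by (intro S(2)) auto
    then show False using psubset_card_mono[OF S'(4,1)] by linarith
  qed
  moreover have "independent S" using S(1) H_B by (intro paired_independent) auto
  ultimately show thesis using S(1) by (intro that[of S]) simp_all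
qed

end

section \<open>The endomorphism algebra of a direct sum\<close>

definition single :: "'l \<Rightarrow> 'm::zero \<Rightarrow> 'l \<Rightarrow> 'm" where
  "single i m = (\<lambda>l. if l = i then m else 0)"

definition entry ::
  "('l \<Rightarrow> ('a, 'm::ab_group_add) gmodule) \<Rightarrow> 'l \<Rightarrow> 'l \<Rightarrow> (('l \<Rightarrow> 'm) \<Rightarrow> ('l \<Rightarrow> 'm)) \<Rightarrow> 'm \<Rightarrow> 'm" where
  "entry P i j F m = (if m \<in> car (P i) then F (single i m) j else 0)"

lemma sum_fun_apply: "(\<Sum>i\<in>K. g i) x = (\<Sum>i\<in>K. g i x)"
  for g :: "'i \<Rightarrow> 'x \<Rightarrow> 'v::ab_group_add"
  by (induction K rule: infinite_finite_induct) auto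

text \<open>A basis of \<open>U\<close> stays independent under \<phi>, which bounds its size. The
  application is to spaces of homomorphisms, with \<phi> the evaluation at a generator.\<close>

lemma subspace_finite_span_injective:
  assumes "Vector_Spaces.linear s1 s2 \<phi>" and U: "module.subspace s1 U" and inj: "inj_on \<phi> U"
    and T: "finite T" "\<phi> ` U \<subseteq> module.span s2 T"
  shows "\<exists>T'. finite T' \<and> module.span s1 T' = U"
proof -
  interpret Vector_Spaces.linear s1 s2 \<phi> by fact
  interpret vector_space_pair s1 s2 ..
  obtain C where C: "C \<subseteq> U" "vs1.independent C" "U \<subseteq> vs1.span C"
    using vs1.maximal_independent_subset by blast
  have span: "vs1.span C = U" using C(3) vs1.span_minimal[OF C(1) U] by blast
  have "vs2.independent (\<phi> ` C)"
    using linear_independent_injective_image[OF assms(1) C(2)] inj span by simp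
  then have "finite (\<phi> ` C)"
    using vs2.independent_span_bound[OF T(1), of "\<phi> ` C"] T(2) C(1) by blast
  then have "finite C" using inj C(1) finite_imageD inj_on_subset by blast
  then show ?thesis using span by blast
qed

text \<open>Three scalings appear: \<open>v\<close> on the modules, \<open>v1\<close> on
  homomorphisms between them, \<open>vB\<close> on endomorphisms of the direct sum. Finiteness of
  \<open>I\<close> makes the support condition in \<open>dsum\<close> automatic and turns
  endomorphisms into finite matrices.\<close>

locale hom_family = pos_graded_fd_algebra sA GA
  for sA :: "'k::field \<Rightarrow> 'a::ring_1 \<Rightarrow> 'a" and GA :: "nat \<Rightarrow> 'a set" +
  fixes s :: "'k \<Rightarrow> 'm::ab_group_add \<Rightarrow> 'm" and I :: "'l set" and P :: "'l \<Rightarrow> ('a, 'm) gmodule"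
  assumes P: "i \<in> I \<Longrightarrow> graded_module sA GA s (P i)" and fin: "finite I" and vs: "vector_space s"
begin

lemma alg: "pos_graded_fd_algebra sA GA" by unfold_locales

lemma fdP: "i \<in> I \<Longrightarrow> fd_module sA s (P i)"
  using graded_moduleD(1) P by blast

sublocale v: vector_space s by (rule vs)
sublocale v1: vector_space "fscale s :: 'k \<Rightarrow> ('m \<Rightarrow> 'm) \<Rightarrow> 'm \<Rightarrow> 'm"
  by (rule vector_space_fscale[OF vs])
sublocale vB: vector_space "fscale (fscale s) :: 'k \<Rightarrow> (('l \<Rightarrow> 'm) \<Rightarrow> ('l \<Rightarrow> 'm)) \<Rightarrow> ('l \<Rightarrow> 'm) \<Rightarrow> ('l \<Rightarrow> 'm)"
  by (intro vector_space_fscale vs)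

abbreviation "D \<equiv> car (dsum I P)"
abbreviation "B \<equiv> endo_algebra I P"
abbreviation "E \<equiv> embed_hom I P"
abbreviation "W \<equiv> hom_block_deg I P"

lemma D_iff: "x \<in> D \<longleftrightarrow> (\<forall>i\<in>I. x i \<in> car (P i)) \<and> (\<forall>i. i \<notin> I \<longrightarrow> x i = 0)"
proof -
  have "finite {i. x i \<noteq> 0}" if "\<forall>i. i \<notin> I \<longrightarrow> x i = 0"
    by (rule finite_subset[OF _ fin]) (use that in auto)
  then show ?thesis by (auto simp: dsum_def)
qed

lemma act_dsum: "act (dsum I P) a x = (\<lambda>i. if i \<in> I then act (P i) a (x i) else 0)"
  by (simp add: dsum_def)

lemma act_dsum_apply: "i \<in> I \<Longrightarrow> act (dsum I P) a x i = act (P i) a (x i)"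
  by (simp add: act_dsum)

lemma D_closed: "0 \<in> D" "x \<in> D \<Longrightarrow> y \<in> D \<Longrightarrow> x + y \<in> D" "x \<in> D \<Longrightarrow> fscale s c x \<in> D"
  using fd_module_closed[OF fdP] by (auto simp: D_iff fscale_def)

lemma act_D: "x \<in> D \<Longrightarrow> act (dsum I P) a x \<in> D"
  using fd_moduleD(4)[OF fdP] by (auto simp: D_iff act_dsum)

lemma single_D: "i \<in> I \<Longrightarrow> m \<in> car (P i) \<Longrightarrow> single i m \<in> D"
  using fd_module_closed(1)[OF fdP] by (auto simp: D_iff single_def)

lemma act_single:
  "i \<in> I \<Longrightarrow> act (dsum I P) a (single i m) = single i (act (P i) a m)"
  using act_zero(1)[OF fdP] by (auto simp: act_dsum single_def fun_eq_iff)

lemma single_add: "single i (m + m') = single i m + single i m'" for m m' :: 'm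
  by (auto simp: single_def fun_eq_iff)

lemma B_D: "F \<in> B \<Longrightarrow> x \<in> D \<Longrightarrow> F x \<in> D"
  and B_outside: "F \<in> B \<Longrightarrow> x \<notin> D \<Longrightarrow> F x = 0"
  and B_add: "F \<in> B \<Longrightarrow> x \<in> D \<Longrightarrow> y \<in> D \<Longrightarrow> F (x + y) = F x + F y"
  and B_act: "F \<in> B \<Longrightarrow> x \<in> D \<Longrightarrow> F (act (dsum I P) a x) = act (dsum I P) a (F x)"
  unfolding endo_algebra_def by (blast dest: mod_homD)+

lemma B_scale:
  assumes "F \<in> B" "x \<in> D"
  shows "F (fscale s c x) = fscale s c (F x)"
proof -
  have "fscale s c y = act (dsum I P) (sA c 1) y" if "y \<in> D" for y
    using that scale_conv_act[OF fdP] by (auto simp: D_iff act_dsum fscale_def fun_eq_iff)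
  then show ?thesis using B_act[OF assms] B_D[OF assms] assms(2) by simp
qed

lemma BI:
  assumes "\<And>x. x \<in> D \<Longrightarrow> F x \<in> D" "\<And>x. x \<notin> D \<Longrightarrow> F x = 0"
    "\<And>x y. x \<in> D \<Longrightarrow> y \<in> D \<Longrightarrow> F (x + y) = F x + F y"
    "\<And>a x. x \<in> D \<Longrightarrow> F (act (dsum I P) a x) = act (dsum I P) a (F x)"
  shows "F \<in> B"
  unfolding endo_algebra_def by (rule mod_homI) (fact assms)+

lemma act_dsum_add: "x \<in> D \<Longrightarrow> y \<in> D \<Longrightarrow> act (dsum I P) a (x + y) = act (dsum I P) a x + act (dsum I P) a y"
  using fd_moduleD(5)[OF fdP] by (auto simp: D_iff act_dsum fun_eq_iff)

lemma act_dsum_scale: "x \<in> D \<Longrightarrow> act (dsum I P) a (fscale s c x) = fscale s c (act (dsum I P) a x)"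
  using act_scale[OF fdP fd_algebra_axioms] by (auto simp: D_iff act_dsum fun_eq_iff fscale_def)

lemma act_dsum_zero: "act (dsum I P) a 0 = 0"
  using act_zero(1)[OF fdP] by (auto simp: act_dsum fun_eq_iff)

lemma subspace_B: "vB.subspace B"
  unfolding vB.subspace_def
proof (intro conjI ballI allI)
  show "0 \<in> B" by (rule BI) (use D_closed act_dsum_zero in auto)
next
  fix F G assume F: "F \<in> B" and G: "G \<in> B"
  show "F + G \<in> B"
    by (rule BI) (use D_closed(2) B_D B_outside B_add B_act act_dsum_add F G in \<open>auto simp: add_ac\<close>)
next
  fix c F assume F: "F \<in> B"
  have "fscale (fscale s) c F x = fscale s c (F x)" for x by (simp add: fscale_def)
  moreover have "fscale s c (0 :: 'l \<Rightarrow> 'm) = 0" by (simp add: fscale_def fun_eq_iff)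
  moreover have "fscale s c (x + y) = fscale s c x + fscale s c y" for x y :: "'l \<Rightarrow> 'm"
    by (simp add: fscale_def fun_eq_iff v.scale_right_distrib)
  ultimately show "fscale (fscale s) c F \<in> B"
    by (intro BI) (use D_closed(3) B_D[OF F] B_outside[OF F] B_add[OF F] B_act[OF F] act_dsum_scale in auto)
qed

lemma B_comp: "F \<in> B \<Longrightarrow> G \<in> B \<Longrightarrow> F \<circ> G \<in> B"
  unfolding endo_algebra_def by (rule mod_hom_comp)

lemma comp_add_right: "F \<in> B \<Longrightarrow> G \<in> B \<Longrightarrow> G' \<in> B \<Longrightarrow> F \<circ> (G + G') = (F \<circ> G) + (F \<circ> G')"
proof
  fix x assume FG: "F \<in> B" "G \<in> B" "G' \<in> B"
  have "F 0 = 0" using B_add[OF FG(1) D_closed(1) D_closed(1)] by simp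
  then show "(F \<circ> (G + G')) x = ((F \<circ> G) + (F \<circ> G')) x"
    using B_add[OF FG(1) B_D[OF FG(2)] B_D[OF FG(3)], of x x] B_outside[OF FG(2), of x]
      B_outside[OF FG(3), of x] by (cases "x \<in> D") auto
qed

lemma comp_scale_right: "F \<in> B \<Longrightarrow> G \<in> B \<Longrightarrow> F \<circ> fscale (fscale s) c G = fscale (fscale s) c (F \<circ> G)"
proof
  fix x assume F: "F \<in> B" and G: "G \<in> B"
  have "G x \<in> D" using B_D[OF G] B_outside[OF G, of x] D_closed(1) by (cases "x \<in> D") auto
  then show "(F \<circ> fscale (fscale s) c G) x = fscale (fscale s) c (F \<circ> G) x"
    using B_scale[OF F] by (simp add: fscale_def[where s = "fscale s"])
qed

lemma comp_add_left: "(F + G) \<circ> K = (F \<circ> K) + (G \<circ> K)" for F G :: "('l \<Rightarrow> 'm) \<Rightarrow> ('l \<Rightarrow> 'm)"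
  by (simp add: fun_eq_iff)

lemma comp_scale_left: "fscale (fscale s) c F \<circ> K = fscale (fscale s) c (F \<circ> K)"
  by (simp add: fun_eq_iff fscale_def)

lemma comp_zero: "F \<in> B \<Longrightarrow> F \<circ> (0 :: ('l \<Rightarrow> 'm) \<Rightarrow> _) = 0"
  "(0 :: ('l \<Rightarrow> 'm) \<Rightarrow> ('l \<Rightarrow> 'm)) \<circ> F = 0" for F :: "('l \<Rightarrow> 'm) \<Rightarrow> ('l \<Rightarrow> 'm)"
  using B_add[of F 0 0] D_closed(1) by (auto simp: fun_eq_iff)

lemma E_apply: "E i j f x l = (if x \<in> D \<and> l = j then f (x i) else 0)"
  by (simp add: embed_hom_def)

lemma E_D: "x \<in> D \<Longrightarrow> E i j f x = single j (f (x i))"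
  by (simp add: fun_eq_iff E_apply single_def)

lemma E_add: "E i j (f + g) = E i j f + E i j g"
  by (simp add: fun_eq_iff E_apply)

lemma E_scale: "E i j (fscale s c f) = fscale (fscale s) c (E i j f)"
  by (auto simp: fun_eq_iff E_apply fscale_def)

lemma E_zero: "E i j 0 = 0"
  by (auto simp: fun_eq_iff E_apply)

lemma linear_E: "Vector_Spaces.linear (fscale s) (fscale (fscale s)) (E i j)"
  by (intro Vector_Spaces.linear.intro module_hom.intro module_hom_axioms.intro
      v1.vector_space_axioms vB.vector_space_axioms v1.module_axioms vB.module_axioms E_add E_scale)

lemma E_B:
  assumes "i \<in> I" "j \<in> I" "f \<in> mod_hom (P i) (P j)"
  shows "E i j f \<in> B"
proof (rule BI)
  note f = mod_homD[OF assms(3)]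
  have xi: "x i \<in> car (P i)" if "x \<in> D" for x using that assms(1) by (simp add: D_iff)
  fix x assume x: "x \<in> D"
  show "E i j f x \<in> D" using x f(1)[OF xi[OF x]] single_D assms(2) by (simp add: E_D)
  show "E i j f (act (dsum I P) a x) = act (dsum I P) a (E i j f x)" for a
    using x act_D[OF x] f(4)[OF xi[OF x]] assms(1,2) by (simp add: E_D act_single act_dsum_apply)
  show "E i j f (x + y) = E i j f x + E i j f y" if "y \<in> D" for y
    using x that D_closed(2) f(3)[OF xi xi] by (simp add: E_D single_add)
qed (simp add: embed_hom_def)

text \<open>The product rule of matrix units.\<close>

lemma E_comp:
  assumes "i \<in> I" "j \<in> I" "k \<in> I" "f \<in> mod_hom (P i) (P j)" "g \<in> mod_hom (P k) (P l)"
  shows "E k l g \<circ> E i j f = (if k = j then E i l (g \<circ> f) else 0)"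
proof
  fix x
  have g0: "g 0 = 0" by (rule mod_hom_zero[OF assms(5)])
  show "(E k l g \<circ> E i j f) x = (if k = j then E i l (g \<circ> f) else 0) x"
  proof (cases "x \<in> D")
    case True
    then have "E i j f x \<in> D" using B_D[OF E_B] assms by blast
    then have "E k l g (E i j f x) = single l (g (E i j f x k))" by (rule E_D)
    then show ?thesis using True g0 by (auto simp: E_apply E_D single_def fun_eq_iff)
  next
    case False
    then show ?thesis using g0 by (auto simp: fun_eq_iff E_apply)
  qed
qed

lemma entry_mod_hom:
  assumes "F \<in> B" "i \<in> I" "j \<in> I"
  shows "entry P i j F \<in> mod_hom (P i) (P j)"
proof (rule mod_homI)
  fix m assume m: "m \<in> car (P i)"
  note sm = single_D[OF assms(2) m]
  show "entry P i j F m \<in> car (P j)" using B_D[OF assms(1) sm] m assms(3) by (simp add: entry_def D_iff)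
  show "entry P i j F (m + m') = entry P i j F m + entry P i j F m'" if "m' \<in> car (P i)" for m'
    using B_add[OF assms(1) sm single_D[OF assms(2) that]] m that fd_module_closed(2)[OF fdP[OF assms(2)]]
    by (simp add: entry_def single_add)
  show "entry P i j F (act (P i) a m) = act (P j) a (entry P i j F m)" for a
    using B_act[OF assms(1) sm, of a] m fd_moduleD(4)[OF fdP[OF assms(2)] m] assms
    by (simp add: entry_def act_single act_dsum_apply)
qed (simp add: entry_def)

lemma B_decompose:
  assumes "F \<in> B"
  shows "F = (\<Sum>i\<in>I. \<Sum>j\<in>I. E i j (entry P i j F))"
proof (intro ext)
  fix x l
  show "F x l = (\<Sum>i\<in>I. \<Sum>j\<in>I. E i j (entry P i j F)) x l"
  proof (cases "x \<in> D")
    case True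
    then have xi: "x i \<in> car (P i)" if "i \<in> I" for i using that by (simp add: D_iff)
    have "x = (\<Sum>i\<in>I. single i (x i))"
      using True fin by (auto simp: fun_eq_iff sum_fun_apply single_def D_iff)
    then have "F x = F (\<Sum>i\<in>I. single i (x i))" by simp
    also have "\<dots> = (\<Sum>i\<in>I. F (single i (x i)))"
      by (rule additive_on_sum[of D F, OF D_closed(1,2) B_add[OF assms]]) (simp_all add: single_D xi)
    finally have Fx: "F x l = (\<Sum>i\<in>I. F (single i (x i)) l)" by (simp add: sum_fun_apply)
    show ?thesis
    proof (cases "l \<in> I")
      case True
      have "(\<Sum>j\<in>I. E i j (entry P i j F) x l) = F (single i (x i)) l" if "i \<in> I" for i
        using True fin \<open>x \<in> D\<close> xi[OF that] by (simp add: E_apply entry_def)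
      then show ?thesis using Fx by (simp add: sum_fun_apply)
    next
      case False
      then have "F x l = 0" using B_D[OF assms \<open>x \<in> D\<close>] by (simp add: D_iff)
      moreover have "E i j f x l = 0" if "j \<in> I" for i j f using that False by (auto simp: E_apply)
      ultimately show ?thesis by (simp add: sum_fun_apply)
    qed
  next
    case False
    then show ?thesis using B_outside[OF assms] by (simp add: sum_fun_apply E_apply)
  qed
qed

lemma W_iff: "F \<in> W i j e \<longleftrightarrow> (\<exists>f\<in>mod_hom_deg (P i) (P j) e. F = E i j f)"
  unfolding hom_block_deg_def by auto

lemma W_B: "i \<in> I \<Longrightarrow> j \<in> I \<Longrightarrow> F \<in> W i j e \<Longrightarrow> F \<in> B"
  by (auto simp: W_iff intro!: E_B dest: mod_hom_degD(1))

lemma subspace_mod_hom: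
  assumes "j \<in> I"
  shows "v1.subspace (mod_hom (P i) (P j))"
  using zero_mod_hom[OF fdP[OF assms]] mod_hom_add[OF fdP[OF assms]]
    mod_hom_fscale[OF fdP[OF assms] fd_algebra_axioms]
  by (auto simp: v1.subspace_def)

lemma subspace_mod_hom_deg:
  assumes "i \<in> I" "j \<in> I"
  shows "v1.subspace (mod_hom_deg (P i) (P j) e)"
proof -
  have "v.subspace (grade (P j) k)" for k
    using direct_sumD(1)[OF graded_moduleD(2)[OF P[OF assms(2)]]] .
  then have "0 \<in> grade (P j) k" "x \<in> grade (P j) k \<Longrightarrow> y \<in> grade (P j) k \<Longrightarrow> x + y \<in> grade (P j) k"
    "x \<in> grade (P j) k \<Longrightarrow> s c x \<in> grade (P j) k" for x y c k
    by (auto simp: v.subspace_0 v.subspace_add v.subspace_scale)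
  then show ?thesis
    using subspace_mod_hom[OF assms(2), of i] unfolding v1.subspace_def mod_hom_deg_def
    by (auto simp: image_subset_iff fscale_def)
qed

lemma subspace_W: "i \<in> I \<Longrightarrow> j \<in> I \<Longrightarrow> vB.subspace (W i j e)"
proof -
  interpret E: Vector_Spaces.linear "fscale s" "fscale (fscale s)" "E i j" by (rule linear_E)
  show "i \<in> I \<Longrightarrow> j \<in> I \<Longrightarrow> vB.subspace (W i j e)"
    unfolding hom_block_deg_def by (rule E.subspace_image[OF subspace_mod_hom_deg])
qed

text \<open>An endomorphism is the sum of its matrix entries, and each entry is the sum of its
  homogeneous parts.\<close>

lemma span_W: "vB.span (\<Union>(i, j, e)\<in>I \<times> I \<times> UNIV. W i j e) = B"
proof
  let ?H = "\<Union>(i, j, e)\<in>I \<times> I \<times> UNIV. W i j e"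
  show "vB.span ?H \<subseteq> B" by (rule vB.span_minimal[OF _ subspace_B]) (use W_B in auto)
  show "B \<subseteq> vB.span ?H"
  proof
    fix F assume F: "F \<in> B"
    have "E i j (entry P i j F) \<in> vB.span ?H" if ij: "i \<in> I" "j \<in> I" for i j
    proof -
      let ?f = "entry P i j F"
      have f: "?f \<in> mod_hom (P i) (P j)" by (rule entry_mod_hom[OF F ij])
      obtain J where J: "?f = (\<Sum>e\<in>J. hom_comp (P i) (P j) ?f e)"
        using mod_hom_decompose[OF alg P[OF ij(1)] P[OF ij(2)] f] by blast
      have "E i j ?f = (\<Sum>e\<in>J. E i j (hom_comp (P i) (P j) ?f e))"
        by (subst J) (rule module_hom.sum[OF linear_E[unfolded linear_iff_module_hom]])
      moreover have "E i j (hom_comp (P i) (P j) ?f e) \<in> ?H" for e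
        using hom_comp_mod_hom_deg[OF alg P[OF ij(1)] P[OF ij(2)] f, of e] ij by (auto simp: W_iff)
      ultimately show ?thesis by (simp add: vB.span_sum vB.span_base)
    qed
    then have "(\<Sum>i\<in>I. \<Sum>j\<in>I. E i j (entry P i j F)) \<in> vB.span ?H"
      by (intro vB.span_sum) auto
    then show "F \<in> vB.span ?H" using B_decompose[OF F] by simp
  qed
qed

lemma W_comp:
  assumes "i \<in> I" "j \<in> I" "k \<in> I" "F \<in> W i j e" "G \<in> W j k e'"
  shows "G \<circ> F \<in> W i k (e + e')"
proof -
  obtain f g where f: "f \<in> mod_hom_deg (P i) (P j) e" "F = E i j f"
    and g: "g \<in> mod_hom_deg (P j) (P k) e'" "G = E j k g"
    using assms(4,5) by (auto simp: W_iff)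
  note fh = mod_hom_degD[OF f(1)] and gh = mod_hom_degD[OF g(1)]
  have "G \<circ> F = E i k (g \<circ> f)"
    using E_comp[OF assms(1,2,2) fh(1) gh(1)] f(2) g(2) by simp
  moreover have "g \<circ> f \<in> mod_hom_deg (P i) (P k) (e + e')"
    using mod_hom_comp[OF fh(1) gh(1)] fh(2) gh(2) unfolding mod_hom_deg_def
    by (auto simp: add.assoc[symmetric])
  ultimately show ?thesis by (auto simp: W_iff)
qed

lemma W_comp_zero:
  assumes "i \<in> I" "j \<in> I" "k \<in> I" "F \<in> W i j e" "G \<in> W k l e'" "k \<noteq> j"
  shows "G \<circ> F = 0"
  using assms(4-6) E_comp[OF assms(1-3) mod_hom_degD(1) mod_hom_degD(1)] by (auto simp: W_iff)

lemma B_finite_span: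
  assumes "\<And>i j. i \<in> I \<Longrightarrow> j \<in> I \<Longrightarrow> \<exists>T. finite T \<and> v1.span T = mod_hom (P i) (P j)"
  shows "\<exists>C. finite C \<and> B \<subseteq> vB.span C"
proof -
  obtain T where T: "\<And>i j. i \<in> I \<Longrightarrow> j \<in> I \<Longrightarrow> finite (T i j) \<and> v1.span (T i j) = mod_hom (P i) (P j)"
    using assms by metis
  define C where "C = (\<Union>i\<in>I. \<Union>j\<in>I. E i j ` T i j)"
  have "finite C" unfolding C_def using fin T by auto
  moreover have "B \<subseteq> vB.span C"
  proof
    fix F assume F: "F \<in> B"
    have "E i j (entry P i j F) \<in> vB.span C" if ij: "i \<in> I" "j \<in> I" for i j
    proof -
      interpret E: Vector_Spaces.linear "fscale s" "fscale (fscale s)" "E i j" by (rule linear_E)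
      have "E i j (entry P i j F) \<in> E i j ` v1.span (T i j)"
        using entry_mod_hom[OF F ij] T[OF ij] by simp
      also have "\<dots> = vB.span (E i j ` T i j)" by (rule E.span_image[symmetric])
      also have "\<dots> \<subseteq> vB.span C" by (rule vB.span_mono) (use ij in \<open>auto simp: C_def\<close>)
      finally show ?thesis .
    qed
    then have "(\<Sum>i\<in>I. \<Sum>j\<in>I. E i j (entry P i j F)) \<in> vB.span C"
      by (intro vB.span_sum) auto
    then show "F \<in> vB.span C" using B_decompose[OF F] by simp
  qed
  ultimately show ?thesis by blast
qed

end

section \<open>Admissible bases and symmetrizing forms\<close>

context hom_family
begin

text \<open>The \<open>G\<close> with \<open>\<tau> (F \<circ> G) = 0\<close> form a subspace; were
  it to contain all homogeneous blocks, it would be \<open>B\<close>. The lemma serves to replace a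
  witness by a homogeneous one.\<close>

lemma exists_homogeneous_nonzero:
  assumes add: "\<And>F G. F \<in> B \<Longrightarrow> G \<in> B \<Longrightarrow> \<tau> (F + G) = \<tau> F + \<tau> G"
    and scal: "\<And>c F. F \<in> B \<Longrightarrow> \<tau> (fscale (fscale s) c F) = c * \<tau> F"
    and F: "F \<in> B" and G: "G \<in> B" "\<tau> (F \<circ> G) \<noteq> (0 :: 'k)"
  shows "\<exists>k\<in>I. \<exists>l\<in>I. \<exists>e. \<exists>Y\<in>W k l e. \<tau> (F \<circ> Y) \<noteq> 0"
proof (rule ccontr)
  assume contr: "\<not> ?thesis"
  have 0: "0 \<in> B" by (rule vB.subspace_0[OF subspace_B])
  have "\<tau> 0 = 0" using scal[OF 0, of 0] by simp
  then have "vB.subspace {G \<in> B. \<tau> (F \<circ> G) = 0}"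
    unfolding vB.subspace_def
  proof (intro conjI ballI allI)
    show "0 \<in> {G \<in> B. \<tau> (F \<circ> G) = 0}" using 0 comp_zero(1)[OF F] \<open>\<tau> 0 = 0\<close> by simp
  next
    fix G G' assume "G \<in> {G \<in> B. \<tau> (F \<circ> G) = 0}" "G' \<in> {G \<in> B. \<tau> (F \<circ> G) = 0}"
    then show "G + G' \<in> {G \<in> B. \<tau> (F \<circ> G) = 0}"
      using comp_add_right[OF F, of G G'] add[OF B_comp B_comp, OF F _ F, of G G']
        vB.subspace_add[OF subspace_B, of G G'] by simp
  next
    fix c G assume "G \<in> {G \<in> B. \<tau> (F \<circ> G) = 0}"
    then show "fscale (fscale s) c G \<in> {G \<in> B. \<tau> (F \<circ> G) = 0}"
      using comp_scale_right[OF F, of G c] scal[OF B_comp, OF F, of G c]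
        vB.subspace_scale[OF subspace_B, of G c] by simp
  qed
  moreover have "(\<Union>(i, j, e)\<in>I \<times> I \<times> UNIV. W i j e) \<subseteq> {G \<in> B. \<tau> (F \<circ> G) = 0}"
  proof (clarify, intro conjI)
    fix i j e Y assume Y: "i \<in> I" "j \<in> I" "Y \<in> W i j e"
    show "Y \<in> B" by (rule W_B[OF Y])
    show "\<tau> (F \<circ> Y) = 0" using contr Y by blast
  qed
  ultimately have "vB.span (\<Union>(i, j, e)\<in>I \<times> I \<times> UNIV. W i j e) \<subseteq> {G \<in> B. \<tau> (F \<circ> G) = 0}"
    by (rule vB.span_minimal[rotated])
  then have "B \<subseteq> {G \<in> B. \<tau> (F \<circ> G) = 0}" unfolding span_W .
  then show False using G by blast
qed

text \<open>Linear extension in one argument at a time: one factor runs over \<open>B\<close> while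
  the other stays in \<open>K\<close>, after which the other is released too.\<close>

lemma trace_symmetric_span:
  assumes add: "\<And>F G. F \<in> B \<Longrightarrow> G \<in> B \<Longrightarrow> \<tau> (F + G) = \<tau> F + \<tau> G"
    and scal: "\<And>c F. F \<in> B \<Longrightarrow> \<tau> (fscale (fscale s) c F) = c * \<tau> F"
    and K: "vB.span K = B" and sym: "\<And>F G. F \<in> K \<Longrightarrow> G \<in> K \<Longrightarrow> \<tau> (F \<circ> G) = (\<tau> (G \<circ> F) :: 'k)"
    and FG: "F \<in> B" "G \<in> B"
  shows "\<tau> (F \<circ> G) = \<tau> (G \<circ> F)"
proof -
  have KB: "K \<subseteq> B" using K vB.span_superset by blast
  have sub: "vB.subspace {F \<in> B. \<tau> (F \<circ> G) = \<tau> (G \<circ> F)}" if G: "G \<in> B" for G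
    unfolding vB.subspace_def
  proof (intro conjI ballI allI)
    show "0 \<in> {F \<in> B. \<tau> (F \<circ> G) = \<tau> (G \<circ> F)}"
      using vB.subspace_0[OF subspace_B] comp_zero(1)[OF G] comp_zero(2)[of G] by simp
  next
    fix F F' assume "F \<in> {F \<in> B. \<tau> (F \<circ> G) = \<tau> (G \<circ> F)}" "F' \<in> {F \<in> B. \<tau> (F \<circ> G) = \<tau> (G \<circ> F)}"
    then show "F + F' \<in> {F \<in> B. \<tau> (F \<circ> G) = \<tau> (G \<circ> F)}"
      using comp_add_right[OF G, of F F'] add[OF B_comp B_comp, OF G _ G, of F F']
        comp_add_left[of F F' G] add[OF B_comp B_comp, OF _ G _ G, of F F']
        vB.subspace_add[OF subspace_B, of F F'] by simp
  next
    fix c F assume "F \<in> {F \<in> B. \<tau> (F \<circ> G) = \<tau> (G \<circ> F)}"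
    then show "fscale (fscale s) c F \<in> {F \<in> B. \<tau> (F \<circ> G) = \<tau> (G \<circ> F)}"
      using comp_scale_right[OF G, of F c] scal[OF B_comp, OF G, of F c]
        comp_scale_left[of c F G] scal[OF B_comp, OF _ G, of F c]
        vB.subspace_scale[OF subspace_B, of F c] by simp
  qed
  have "vB.span K \<subseteq> {F \<in> B. \<tau> (F \<circ> G) = \<tau> (G \<circ> F)}" if G: "G \<in> K" for G
    by (rule vB.span_minimal[OF _ sub]) (use sym G KB in auto)
  then have K_sym: "\<tau> (F \<circ> G) = \<tau> (G \<circ> F)" if "F \<in> B" "G \<in> K" for F G
    using that unfolding K by blast
  have "vB.span K \<subseteq> {G' \<in> B. \<tau> (G' \<circ> F) = \<tau> (F \<circ> G')}"
    by (rule vB.span_minimal[OF _ sub[OF FG(1)]]) (use K_sym[OF FG(1)] KB in auto)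
  then show ?thesis using FG(2) unfolding K by auto
qed

end

text \<open>All that the comparison of forms and bases uses about the modules: generators in degree
  0, degree bounds and the socle endomorphisms. \<open>top\<close> is the outcome of Schur's lemma
  and \<open>lift\<close> that of projectivity; simple modules and covers no longer occur.\<close>

locale socle_family = hom_family sA GA s I P
  for sA :: "'k::field \<Rightarrow> 'a::ring_1 \<Rightarrow> 'a" and GA :: "nat \<Rightarrow> 'a set"
    and s :: "'k \<Rightarrow> 'm::ab_group_add \<Rightarrow> 'm" and I :: "'l set" and P :: "'l \<Rightarrow> ('a, 'm) gmodule" +
  fixes \<theta> :: "'l \<Rightarrow> 'm \<Rightarrow> 'm" and gen :: "'l \<Rightarrow> 'm"
  assumes gen: "i \<in> I \<Longrightarrow> gen i \<in> grade (P i) 0"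
    and gen_zero: "i \<in> I \<Longrightarrow> j \<in> I \<Longrightarrow> f \<in> mod_hom (P i) (P j) \<Longrightarrow> f (gen i) = 0 \<Longrightarrow> f = 0"
    and degrees: "i \<in> I \<Longrightarrow> grade (P i) k \<noteq> {0} \<Longrightarrow> 0 \<le> k \<and> k \<le> top_degree (P i)"
    and \<theta>: "i \<in> I \<Longrightarrow> \<theta> i \<in> mod_hom_deg (P i) (P i) (top_degree (P i))"
    and \<theta>_nonzero: "i \<in> I \<Longrightarrow> \<theta> i \<noteq> 0"
    and top: "i \<in> I \<Longrightarrow> f \<in> mod_hom_deg (P i) (P i) (top_degree (P i)) \<Longrightarrow> \<exists>c. f = fscale s c (\<theta> i)"
    and lift: "i \<in> I \<Longrightarrow> j \<in> I \<Longrightarrow> f \<in> mod_hom (P i) (P j) \<Longrightarrow> f \<noteq> 0 \<Longrightarrow>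
      \<exists>g\<in>mod_hom (P j) (P i). f \<circ> g = \<theta> j"
begin

abbreviation "d i \<equiv> top_degree (P i)"
abbreviation "\<Theta> i \<equiv> E i i (\<theta> i)"
abbreviation "vscale \<equiv> fscale (fscale s)"

lemma gen_car: "i \<in> I \<Longrightarrow> gen i \<in> car (P i)"
  using graded_moduleD(4)[OF P gen] by blast

lemma exists_functional:
  assumes "i \<in> I"
  shows "\<exists>\<xi>. Vector_Spaces.linear s (*) \<xi> \<and> \<xi> (\<theta> i (gen i)) = 1"
proof -
  have "vector_space ((*) :: 'k \<Rightarrow> 'k \<Rightarrow> 'k)" by unfold_locales (auto simp: algebra_simps)
  then interpret vector_space_pair s "(*) :: 'k \<Rightarrow> 'k \<Rightarrow> 'k"
    unfolding vector_space_pair_def using vs by blast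
  have "\<theta> i (gen i) \<noteq> 0"
    using gen_zero[OF assms assms mod_hom_degD(1)[OF \<theta>[OF assms]]] \<theta>_nonzero[OF assms] by blast
  then have "v.independent {\<theta> i (gen i)}" by simp
  from linear_independent_extend[OF this, of "\<lambda>_. 1"] show ?thesis by auto
qed

text \<open>A functional that reads off coefficients of \<open>\<theta> i\<close>. In
  \<open>tr F\<close> with \<open>F\<close> in \<open>B\<close> it meets only multiples of
  \<open>\<theta> i (gen i)\<close>, so any choice serves.\<close>

definition \<xi> :: "'l \<Rightarrow> 'm \<Rightarrow> 'k" where
  "\<xi> i = (SOME \<xi>. Vector_Spaces.linear s (*) \<xi> \<and> \<xi> (\<theta> i (gen i)) = 1)"

lemma \<xi>:
  assumes "i \<in> I"
  shows "\<xi> i (x + y) = \<xi> i x + \<xi> i y" "\<xi> i (s c x) = c * \<xi> i x" "\<xi> i (\<theta> i (gen i)) = 1" "\<xi> i 0 = 0"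
proof -
  have l: "Vector_Spaces.linear s (*) (\<xi> i)" "\<xi> i (\<theta> i (gen i)) = 1"
    unfolding \<xi>_def using someI_ex[OF exists_functional[OF assms]] by blast+
  show "\<xi> i (\<theta> i (gen i)) = 1" by fact
  show "\<xi> i (x + y) = \<xi> i x + \<xi> i y" "\<xi> i (s c x) = c * \<xi> i x" "\<xi> i 0 = 0"
    using l(1) by (auto simp: linear_iff_module_hom module_hom.add module_hom.scale module_hom.zero)
qed

text \<open>The sum of the coefficients of the \<open>\<theta> i\<close>: the trace form of an admissible basis, and
  the homogeneous part of an arbitrary symmetrizing form.\<close>

definition tr :: "(('l \<Rightarrow> 'm) \<Rightarrow> ('l \<Rightarrow> 'm)) \<Rightarrow> 'k" where
  "tr F = (\<Sum>i\<in>I. \<xi> i (hcomp (grade (P i)) (F (single i (gen i)) i) (d i)))"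

lemma B_gen: "F \<in> B \<Longrightarrow> i \<in> I \<Longrightarrow> F (single i (gen i)) i \<in> car (P i)"
  using B_D[OF _ single_D[OF _ gen_car]] by (auto simp: D_iff)

lemma tr_add: "F \<in> B \<Longrightarrow> G \<in> B \<Longrightarrow> tr (F + G) = tr F + tr G"
  unfolding tr_def by (simp add: sum.distrib[symmetric] graded_hcomp(3)[OF P] B_gen \<xi> cong: sum.cong)

lemma tr_scale: "F \<in> B \<Longrightarrow> tr (vscale c F) = c * tr F"
  unfolding tr_def
  by (simp add: sum_distrib_left fscale_def graded_hcomp(4)[OF P] B_gen \<xi> cong: sum.cong)

lemma tr_zero: "tr 0 = 0"
  using tr_scale[of 0 0] vB.subspace_0[OF subspace_B] by simp

text \<open>Only the diagonal contributes, and \<open>gen i\<close> has degree 0, so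
  \<open>f (gen i)\<close> is homogeneous of degree \<open>e\<close>: its component in degree
  \<open>d i\<close> is everything or nothing.\<close>

lemma tr_E:
  assumes "i \<in> I" "j \<in> I" "f \<in> mod_hom_deg (P i) (P j) e"
  shows "tr (E i j f) = (if i = j \<and> e = d i then \<xi> i (f (gen i)) else 0)"
proof -
  have f: "f (gen i) \<in> grade (P j) e" "f 0 = 0"
    using mod_hom_degD(2)[OF assms(3) gen[OF assms(1)]] mod_hom_zero[OF mod_hom_degD(1)[OF assms(3)]]
    by auto
  have z: "hcomp (grade (P k)) 0 m = 0" if "k \<in> I" for k m
    using graded_hcomp(5)[OF P[OF that] graded_moduleD(5)[OF P[OF that]], of m m] by simp
  have "\<xi> k (hcomp (grade (P k)) (E i j f (single k (gen k)) k) (d k)) =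
      (if k = i then if i = j \<and> e = d i then \<xi> i (f (gen i)) else 0 else 0)" if k: "k \<in> I" for k
    using f z[OF k] \<xi>(4)[OF k] graded_hcomp(5)[OF P[OF assms(2)] f(1), of "d j"] single_D[OF k gen_car[OF k]]
    by (auto simp: E_apply) (auto simp: single_def)
  then show ?thesis unfolding tr_def using fin assms(1) by simp
qed

lemma \<Theta>_W: "i \<in> I \<Longrightarrow> \<Theta> i \<in> W i i (d i)"
  using \<theta> by (auto simp: W_iff)

lemma \<Theta>_B: "i \<in> I \<Longrightarrow> \<Theta> i \<in> B"
  using W_B \<Theta>_W by blast

lemma tr_\<Theta>: "i \<in> I \<Longrightarrow> tr (\<Theta> i) = 1"
  using tr_E[OF _ _ \<theta>] \<xi>(3) by simp

lemma tr_W: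
  assumes "i \<in> I" "j \<in> I" "F \<in> W i j e" "tr F \<noteq> 0"
  shows "i = j" "e = d i"
proof -
  obtain f where f: "f \<in> mod_hom_deg (P i) (P j) e" "F = E i j f" using assms(3) W_iff by blast
  show "i = j" "e = d i" using tr_E[OF assms(1,2) f(1)] assms(4) f(2) by (auto split: if_splits)
qed

lemma W_top:
  assumes "i \<in> I" "F \<in> W i i (d i)"
  shows "F = vscale (tr F) (\<Theta> i)"
proof -
  obtain f where f: "f \<in> mod_hom_deg (P i) (P i) (d i)" "F = E i i f" using assms(2) W_iff by blast
  then obtain c where "F = vscale c (\<Theta> i)" using top[OF assms(1)] E_scale by metis
  then show ?thesis using tr_scale[OF \<Theta>_B] tr_\<Theta> assms(1) by simp
qed

text \<open>\<open>F\<close> is determined by the image of the generator, which has degree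
  \<open>e\<close> in the target, so \<open>e\<close> must be an occurring degree there.\<close>

lemma W_degrees:
  assumes "i \<in> I" "j \<in> I" "F \<in> W i j e" "F \<noteq> 0"
  shows "0 \<le> e \<and> e \<le> d j"
proof -
  obtain f where f: "f \<in> mod_hom_deg (P i) (P j) e" "F = E i j f" using assms(3) W_iff by blast
  then have "f (gen i) \<noteq> 0"
    using gen_zero[OF assms(1,2) mod_hom_degD(1)[OF f(1)]] assms(4) E_zero by metis
  then have "grade (P j) e \<noteq> {0}" using mod_hom_degD(2)[OF f(1) gen[OF assms(1)]] by auto
  then show ?thesis using degrees[OF assms(2)] by blast
qed

text \<open>The composite runs from \<open>P i\<close> to \<open>P l\<close> in degree
  \<open>e + e'\<close>, and \<open>tr\<close> sees only endomorphisms of degree \<open>d i\<close>.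
  This is the orthogonality of blocks for the form.\<close>

lemma tr_comp_nonzero:
  assumes "i \<in> I" "j \<in> I" "k \<in> I" "l \<in> I" "F \<in> W i j e" "G \<in> W k l e'" "tr (G \<circ> F) \<noteq> 0"
  shows "k = j" "l = i" "e' = d i - e"
proof -
  show k: "k = j" using W_comp_zero[OF assms(1-3,5,6)] assms(7) tr_zero by metis
  then have "G \<circ> F \<in> W i l (e + e')" using W_comp[OF assms(1,2,4,5)] assms(6) by blast
  from tr_W[OF assms(1,4) this assms(7)] show "l = i" "e' = d i - e" by auto
qed

text \<open>The map \<open>g\<close> with \<open>f \<circ> g = \<theta> j\<close> need not be
  homogeneous; a homogeneous \<open>Y\<close> that keeps the trace nonzero is taken instead, and
  orthogonality of blocks determines where it lies.\<close>

lemma exists_complement: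
  assumes "i \<in> I" "j \<in> I" "F \<in> W i j e" "F \<noteq> 0"
  shows "\<exists>Y\<in>W j i (d j - e). tr (F \<circ> Y) \<noteq> 0"
proof -
  obtain f where f: "f \<in> mod_hom_deg (P i) (P j) e" "F = E i j f" using assms(3) W_iff by blast
  then have "f \<noteq> 0" using assms(4) E_zero by metis
  then obtain g where g: "g \<in> mod_hom (P j) (P i)" "f \<circ> g = \<theta> j"
    using lift[OF assms(1,2) mod_hom_degD(1)[OF f(1)]] by blast
  have "F \<circ> E j i g = \<Theta> j"
    using E_comp[OF assms(2,1,1) g(1) mod_hom_degD(1)[OF f(1)]] f(2) g(2) by simp
  then have "tr (F \<circ> E j i g) \<noteq> 0" using tr_\<Theta>[OF assms(2)] by simp
  then obtain k l e' Y where Y: "k \<in> I" "l \<in> I" "Y \<in> W k l e'" "tr (F \<circ> Y) \<noteq> 0"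
    using exists_homogeneous_nonzero[OF tr_add tr_scale W_B[OF assms(1-3)] E_B[OF assms(2,1) g(1)]]
    by blast
  have "i = l" "j = k" "e = d k - e'" using tr_comp_nonzero[OF Y(1,2) assms(1,2) Y(3) assms(3) Y(4)] by auto
  then show ?thesis using Y by (intro bexI[of _ Y]) auto
qed

text \<open>Evaluation at the generator embeds the homomorphisms into the finite-dimensional module
  \<open>P j\<close>.\<close>

lemma finite_span_mod_hom:
  assumes "i \<in> I" "j \<in> I"
  shows "\<exists>T. finite T \<and> v1.span T = mod_hom (P i) (P j)"
proof -
  obtain S where S: "finite S" "v.span S = car (P j)" using fd_moduleD(3)[OF fdP[OF assms(2)]] by blast
  have sub: "v1.subspace (mod_hom (P i) (P j))" by (rule subspace_mod_hom[OF assms(2)])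
  show ?thesis
  proof (rule subspace_finite_span_injective[OF _ sub _ S(1)])
    show "Vector_Spaces.linear (fscale s) s (\<lambda>f. f (gen i))"
      by (intro Vector_Spaces.linear.intro module_hom.intro module_hom_axioms.intro
          v1.vector_space_axioms v.vector_space_axioms v1.module_axioms v.module_axioms)
        (auto simp: fscale_def)
    show "inj_on (\<lambda>f. f (gen i)) (mod_hom (P i) (P j))"
    proof (rule inj_onI)
      fix f g assume fg: "f \<in> mod_hom (P i) (P j)" "g \<in> mod_hom (P i) (P j)" "f (gen i) = g (gen i)"
      then have "f - g = 0" using gen_zero[OF assms, of "f - g"] v1.subspace_diff[OF sub] by auto
      then show "f = g" by simp
    qed
    show "(\<lambda>f. f (gen i)) ` mod_hom (P i) (P j) \<subseteq> v.span S"
      using S(2) mod_homD(1)[OF _ gen_car[OF assms(1)]] by auto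
  qed
qed

section \<open>From an admissible basis to a symmetrizing form\<close>

lemma admissible_imp_symmetric:
  assumes "admissible_basis s I P \<theta> \<Upsilon>"
  shows "symmetric_algebra vscale B"
proof -
  have indep: "vB.independent \<Upsilon>" and span: "vB.span \<Upsilon> = B"
    and homog: "\<Upsilon> \<subseteq> (\<Union>\<kappa>\<in>I. \<Union>\<mu>\<in>I. \<Union>j. W \<kappa> \<mu> j)"
    using assms unfolding admissible_basis_def appropriate_basis_def by auto
  have \<Upsilon>B: "u \<in> \<Upsilon> \<Longrightarrow> u \<in> B" for u using span vB.span_base by blast
  have partner: "d j = d i \<and> (\<exists>g\<in>\<Upsilon> \<inter> W j i (d i - e).
      (\<exists>c. c \<noteq> 0 \<and> g \<circ> f = vscale c (\<Theta> i) \<and> f \<circ> g = vscale c (\<Theta> j)) \<and>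
      (\<forall>h\<in>\<Upsilon> \<inter> W j i (d i - e). h \<noteq> g \<longrightarrow> h \<circ> f = 0 \<and> f \<circ> h = 0))"
    if "i \<in> I" "j \<in> I" "f \<in> \<Upsilon>" "f \<in> W i j e" for i j e f
    using assms that unfolding admissible_basis_def Let_def by blast
  have sym: "tr (g \<circ> f) = tr (f \<circ> g)" if f: "f \<in> \<Upsilon>" and g: "g \<in> \<Upsilon>" for f g
  proof -
    obtain i j e where i: "i \<in> I" "j \<in> I" "f \<in> W i j e" using f homog by blast
    obtain k l e' where k: "k \<in> I" "l \<in> I" "g \<in> W k l e'" using g homog by blast
    note p = partner[OF i(1,2) f i(3)]
    show ?thesis
    \<comment> \<open>The cases are whether the blocks of \<open>f\<close> and \<open>g\<close> are
      dual. If not, both traces vanish; \<open>d j = d i\<close> shows that duality is symmetric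
      here.\<close>
    proof (cases "k = j \<and> l = i \<and> e' = d i - e")
      case True
      obtain g0 c where g0: "g0 \<circ> f = vscale c (\<Theta> i)" "f \<circ> g0 = vscale c (\<Theta> j)"
        "\<forall>h\<in>\<Upsilon> \<inter> W j i (d i - e). h \<noteq> g0 \<longrightarrow> h \<circ> f = 0 \<and> f \<circ> h = 0"
        using p by blast
      show ?thesis
      proof (cases "g = g0")
        case True
        then show ?thesis using g0 tr_scale[OF \<Theta>_B] tr_\<Theta> i by simp
      next
        case False
        then show ?thesis using g0(3) True g k by simp
      qed
    next
      case False
      have "tr (g \<circ> f) = 0" using tr_comp_nonzero[OF i(1,2) k(1,2) i(3) k(3)] False by blast
      moreover have "tr (f \<circ> g) = 0"
      proof (rule ccontr)
        assume "tr (f \<circ> g) \<noteq> 0"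
        from tr_comp_nonzero[OF k(1,2) i(1,2) k(3) i(3) this] False p show False by auto
      qed
      ultimately show ?thesis by simp
    qed
  qed
  have nondeg: "F = 0" if F: "F \<in> B" "\<And>G. G \<in> B \<Longrightarrow> tr (F \<circ> G) = 0" for F
  proof -
    obtain t r where t: "finite t" "t \<subseteq> \<Upsilon>" "F = (\<Sum>v\<in>t. vscale (r v) v)"
      using F(1) unfolding span[symmetric] vB.span_explicit by blast
    \<comment> \<open>Pairing \<open>F\<close> with the partner \<open>g\<close> of \<open>u\<close>
      isolates the coefficient of \<open>u\<close>.\<close>
    have "r u = 0" if u: "u \<in> t" for u
    proof -
      have u\<Upsilon>: "u \<in> \<Upsilon>" using u t(2) by blast
      then obtain i j e where i: "i \<in> I" "j \<in> I" "u \<in> W i j e" using homog by blast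
      obtain g c where dj: "d j = d i" and g: "g \<in> \<Upsilon>" "g \<in> W j i (d i - e)"
        and c: "c \<noteq> 0" "u \<circ> g = vscale c (\<Theta> j)"
        using partner[OF i(1,2) u\<Upsilon> i(3)] by blast
      have trc: "tr (u \<circ> g) = c" using c(2) tr_scale[OF \<Theta>_B] tr_\<Theta> i by simp
      \<comment> \<open>The condition for \<open>u\<close> controls the block of \<open>g\<close>,
        whereas the other elements in the block of \<open>u\<close> have to be compared with
        \<open>g\<close>. So the condition is applied to \<open>g\<close>, whose partner must be
        \<open>u\<close> because \<open>u \<circ> g\<close> is nonzero.\<close>
      have "d j - (d i - e) = e" using dj by simp
      then obtain f' where f': "\<forall>h\<in>\<Upsilon> \<inter> W i j e. h \<noteq> f' \<longrightarrow> h \<circ> g = 0 \<and> g \<circ> h = 0"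
        using partner[OF i(2,1) g] by metis
      have "u \<circ> g \<noteq> 0" using trc c(1) tr_zero by metis
      then have "f' = u" using f'[THEN bspec, of u] u\<Upsilon> i(3) by auto
      have zero: "tr (v \<circ> g) = 0" if v: "v \<in> \<Upsilon>" "v \<noteq> u" for v
      proof (rule ccontr)
        assume nz: "tr (v \<circ> g) \<noteq> 0"
        obtain i' j' e'' where v': "i' \<in> I" "j' \<in> I" "v \<in> W i' j' e''" using v homog by blast
        have "i' = i" "j' = j" "e'' = e"
          using tr_comp_nonzero[OF i(2,1) v'(1,2) g(2) v'(3) nz] dj by auto
        then have "v \<circ> g = 0" using f' \<open>f' = u\<close> v v' by blast
        then show False using nz tr_zero by simp
      qed
      have gB: "g \<in> B" using \<Upsilon>B g(1) by blast
      have "F \<circ> g = (\<Sum>v\<in>t. vscale (r v) (v \<circ> g))"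
        unfolding t(3) by (rule ext) (simp add: sum_fun_apply fscale_def)
      then have "tr (F \<circ> g) = (\<Sum>v\<in>t. tr (vscale (r v) (v \<circ> g)))"
        using t(2) \<Upsilon>B B_comp gB tr_add vB.subspace_0[OF subspace_B] vB.subspace_add[OF subspace_B]
          vB.subspace_scale[OF subspace_B]
        by (subst additive_on_sum[of B tr, symmetric]) auto
      also have "\<dots> = (\<Sum>v\<in>t. if v = u then r u * c else 0)"
        using t(2) \<Upsilon>B B_comp gB zero trc by (intro sum.cong) (auto simp: tr_scale)
      also have "\<dots> = r u * c" using t(1) u by simp
      finally show ?thesis using F(2)[OF gB] c(1) by simp
    qed
    then show ?thesis using t(3) by simp
  qed
  show ?thesis
    unfolding symmetric_algebra_def
  proof (rule exI[of _ tr], intro conjI ballI allI impI)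
    show "tr (F \<circ> G) = tr (G \<circ> F)" if "F \<in> B" "G \<in> B" for F G
      by (rule trace_symmetric_span[OF tr_add tr_scale span sym that])
  qed (use nondeg in \<open>simp_all add: tr_add tr_scale\<close>)
qed

end

section \<open>From a symmetrizing form to an admissible basis\<close>

locale symmetrized_socle_family = socle_family sA GA s I P \<theta> gen
  for sA :: "'k::field \<Rightarrow> 'a::ring_1 \<Rightarrow> 'a" and GA :: "nat \<Rightarrow> 'a set"
    and s :: "'k \<Rightarrow> 'm::ab_group_add \<Rightarrow> 'm" and I :: "'l set" and P :: "'l \<Rightarrow> ('a, 'm) gmodule"
    and \<theta> :: "'l \<Rightarrow> 'm \<Rightarrow> 'm" and gen :: "'l \<Rightarrow> 'm" +
  fixes \<tau> :: "(('l \<Rightarrow> 'm) \<Rightarrow> ('l \<Rightarrow> 'm)) \<Rightarrow> 'k"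
  assumes \<tau>_scale: "F \<in> B \<Longrightarrow> \<tau> (vscale c F) = c * \<tau> F"
    and \<tau>_sym: "F \<in> B \<Longrightarrow> G \<in> B \<Longrightarrow> \<tau> (F \<circ> G) = \<tau> (G \<circ> F)"
    and \<tau>_\<Theta>: "i \<in> I \<Longrightarrow> \<tau> (\<Theta> i) = 1"
begin

lemma \<tau>_zero: "\<tau> 0 = 0"
  using \<tau>_scale[of 0 0] vB.subspace_0[OF subspace_B] by simp

text \<open>The block is spanned by \<open>\<Theta> i\<close>, on which both functionals are
  normalized to 1. On other blocks \<tau> may differ from \<open>tr\<close>.\<close>

lemma \<tau>_top:
  assumes "i \<in> I" "F \<in> W i i (d i)"
  shows "\<tau> F = tr F"
proof -
  have "\<tau> F = \<tau> (vscale (tr F) (\<Theta> i))" using W_top[OF assms] by simp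
  then show ?thesis using \<tau>_scale[OF \<Theta>_B] \<tau>_\<Theta> assms(1) by simp
qed

text \<open>For a complement \<open>Y\<close> of \<open>F\<close>, symmetry gives
  \<open>\<tau> (Y \<circ> F) = \<tau> (F \<circ> Y)\<close>, which is nonzero. So
  \<open>Y \<circ> F\<close> is a nonzero endomorphism of \<open>P i\<close> of degree
  \<open>d j\<close>, which cannot exceed \<open>d i\<close>. The nonzero \<open>Y\<close> is
  recorded so that the argument can be run in the opposite direction.\<close>

lemma top_degree_le:
  assumes "i \<in> I" "j \<in> I" "F \<in> W i j e" "F \<noteq> 0"
  shows "d j \<le> d i" and "\<exists>Y\<in>W j i (d j - e). Y \<noteq> 0"
proof -
  obtain Y where Y: "Y \<in> W j i (d j - e)" "tr (F \<circ> Y) \<noteq> 0" using exists_complement[OF assms] by blast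
  have FY: "F \<circ> Y \<in> W j j (d j)" using W_comp[OF assms(2,1,2) Y(1) assms(3)] by simp
  have YF: "Y \<circ> F \<in> W i i (d j)" using W_comp[OF assms(1,2,1,3) Y(1)] by simp
  have "\<tau> (Y \<circ> F) = tr (F \<circ> Y)"
    using \<tau>_sym[OF W_B[OF assms(2,1) Y(1)] W_B[OF assms(1-3)]] \<tau>_top[OF assms(2) FY] by simp
  then have "Y \<circ> F \<noteq> 0" using Y(2) \<tau>_zero by metis
  then show "d j \<le> d i" using W_degrees[OF assms(1,1) YF] by blast
  have "F \<circ> 0 = (0 :: ('l \<Rightarrow> 'm) \<Rightarrow> _)" by (rule comp_zero(1)[OF W_B[OF assms(1-3)]])
  then have "Y \<noteq> 0" using Y(2) tr_zero by metis
  then show "\<exists>Y\<in>W j i (d j - e). Y \<noteq> 0" using Y(1) by blast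
qed

lemma top_degree_eq:
  assumes "i \<in> I" "j \<in> I" "F \<in> W i j e" "F \<noteq> 0"
  shows "d i = d j"
proof -
  obtain Y where "Y \<in> W j i (d j - e)" "Y \<noteq> 0" using top_degree_le(2)[OF assms] by blast
  then have "d i \<le> d j" by (rule top_degree_le(1)[OF assms(2,1)])
  then show ?thesis using top_degree_le(1)[OF assms] by simp
qed

text \<open>For dual blocks both composites lie in top blocks, where \<open>tr\<close> is \<tau>;
  otherwise both traces vanish, by orthogonality of blocks and equality of the top degrees.\<close>

lemma tr_comp_homogeneous:
  assumes i: "i \<in> I" "j \<in> I" "F \<in> W i j e" and k: "k \<in> I" "l \<in> I" "G \<in> W k l e'"
  shows "tr (G \<circ> F) = tr (F \<circ> G)"
proof (cases "F = 0 \<or> G = 0")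
  case True
  then show ?thesis using comp_zero W_B[OF i] W_B[OF k] by metis
next
  case False
  then have eq: "d i = d j" "d k = d l" using top_degree_eq i k by blast+
  show ?thesis
  proof (cases "k = j \<and> l = i \<and> e' = d i - e")
    case True
    then have "G \<circ> F \<in> W i i (d i)" "F \<circ> G \<in> W j j (d j)"
      using W_comp[OF i(1,2,1,3), of G e'] W_comp[OF i(2,1,2), of G e' F e] i k eq by auto
    then show ?thesis
      using \<tau>_top i \<tau>_sym[OF W_B[OF i] W_B[OF k]] by metis
  next
    case False
    have "tr (G \<circ> F) = 0" using tr_comp_nonzero[OF i(1,2) k(1,2) i(3) k(3)] False by blast
    moreover have "tr (F \<circ> G) = 0"
    proof (rule ccontr)
      assume "tr (F \<circ> G) \<noteq> 0"
      from tr_comp_nonzero[OF k(1,2) i(1,2) k(3) i(3) this] False eq show False by auto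
    qed
    ultimately show ?thesis by simp
  qed
qed

lemma tr_sym:
  assumes "F \<in> B" "G \<in> B"
  shows "tr (F \<circ> G) = tr (G \<circ> F)"
proof (rule trace_symmetric_span[OF tr_add tr_scale span_W _ assms])
  fix F G assume "F \<in> (\<Union>(i, j, e)\<in>I \<times> I \<times> UNIV. W i j e)" "G \<in> (\<Union>(i, j, e)\<in>I \<times> I \<times> UNIV. W i j e)"
  then obtain i j e k l e' where "i \<in> I" "j \<in> I" "F \<in> W i j e" "k \<in> I" "l \<in> I" "G \<in> W k l e'"
    by blast
  then show "tr (F \<circ> G) = tr (G \<circ> F)" by (rule tr_comp_homogeneous[symmetric])
qed

text \<open>A block is indexed by source, target and degree; its dual exchanges source and target
  and complements the degree to \<open>d i\<close>. Nondegeneracy on homogeneous elements comes from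
  the complement obtained by lifting \<theta>.\<close>

sublocale form: graded_form vscale B "\<lambda>F G. tr (F \<circ> G)" "I \<times> I \<times> UNIV" "\<lambda>(i, j, e). W i j e"
  "\<lambda>(i, j, e). (j, i, d i - e)"
proof unfold_locales
  fix F G H assume F: "F \<in> B" and G: "G \<in> B" and H: "H \<in> B"
  show "tr ((F + G) \<circ> H) = tr (F \<circ> H) + tr (G \<circ> H)"
    using tr_add[OF B_comp[OF F H] B_comp[OF G H]] by (simp add: comp_add_left)
next
  fix F H c assume F: "F \<in> B" and H: "H \<in> B"
  show "tr (vscale c F \<circ> H) = c * tr (F \<circ> H)"
    using tr_scale[OF B_comp[OF F H]] by (simp add: comp_scale_left)
next
  fix F G assume "F \<in> B" "G \<in> B"
  then show "tr (F \<circ> G) = tr (G \<circ> F)" by (rule tr_sym)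
next
  fix t :: "'l \<times> 'l \<times> int" assume "t \<in> I \<times> I \<times> UNIV"
  then show "vB.subspace (case t of (i, j, e) \<Rightarrow> W i j e)" using subspace_W by auto
next
  fix t t' :: "'l \<times> 'l \<times> int" and F G
  assume t: "t \<in> I \<times> I \<times> UNIV" "t' \<in> I \<times> I \<times> UNIV" "F \<in> (case t of (i, j, e) \<Rightarrow> W i j e)"
    "G \<in> (case t' of (i, j, e) \<Rightarrow> W i j e)" "tr (F \<circ> G) \<noteq> 0"
  obtain i j e k l e' where ij: "t = (i, j, e)" "t' = (k, l, e')" by (metis prod_cases3)
  have F: "i \<in> I" "j \<in> I" "F \<in> W i j e" and G: "k \<in> I" "l \<in> I" "G \<in> W k l e'" using t ij by auto
  have "tr (G \<circ> F) \<noteq> 0" using t(5) tr_comp_homogeneous[OF F G] by simp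
  from tr_comp_nonzero[OF F(1,2) G(1,2) F(3) G(3) this]
  show "t' = (case t of (i, j, e) \<Rightarrow> (j, i, d i - e))" by (simp add: ij)
next
  fix t :: "'l \<times> 'l \<times> int" and F
  assume t: "t \<in> I \<times> I \<times> UNIV" "F \<in> (case t of (i, j, e) \<Rightarrow> W i j e)" "F \<noteq> 0"
  obtain i j e where ij: "t = (i, j, e)" by (metis prod_cases3)
  have F: "i \<in> I" "j \<in> I" "F \<in> W i j e" using t ij by auto
  obtain Y where "Y \<in> W j i (d j - e)" "tr (F \<circ> Y) \<noteq> 0" using exists_complement[OF F t(3)] by blast
  then show "\<exists>G\<in>B. tr (F \<circ> G) \<noteq> 0" using W_B[OF F(2,1)] by blast
qed (use subspace_B span_W in \<open>auto simp: case_prod_unfold\<close>)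

text \<open>The identity of \<open>P i\<close>, cut off outside the carrier as the encoding of
  homomorphisms demands.\<close>

definition one :: "'l \<Rightarrow> 'm \<Rightarrow> 'm" where
  "one i x = (if x \<in> car (P i) then x else 0)"

lemma one_mod_hom_deg:
  assumes "i \<in> I"
  shows "one i \<in> mod_hom_deg (P i) (P i) 0"
proof -
  have "one i \<in> mod_hom (P i) (P i)"
    using fd_module_closed(2)[OF fdP[OF assms]] fd_moduleD(4)[OF fdP[OF assms]]
    by (intro mod_homI) (auto simp: one_def)
  then show ?thesis
    using graded_moduleD(4,5)[OF P[OF assms]] unfolding mod_hom_deg_def by (auto simp: one_def)
qed

lemma one_W: "i \<in> I \<Longrightarrow> E i i (one i) \<in> W i i 0"
  using one_mod_hom_deg by (auto simp: W_iff)

lemma \<Theta>_comp_one: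
  assumes "i \<in> I"
  shows "\<Theta> i \<circ> E i i (one i) = \<Theta> i"
proof -
  have \<theta>i: "\<theta> i \<in> mod_hom (P i) (P i)" by (rule mod_hom_degD(1)[OF \<theta>[OF assms]])
  have "\<theta> i \<circ> one i = \<theta> i"
    using mod_homD(2)[OF \<theta>i] mod_hom_zero[OF \<theta>i] by (auto simp: fun_eq_iff one_def)
  then show ?thesis
    using E_comp[OF assms assms assms mod_hom_degD(1)[OF one_mod_hom_deg[OF assms]] \<theta>i] by simp
qed

lemma tr_diagonal_zero:
  assumes "i \<in> I" "k \<in> I" "F \<in> W i i e" "G \<in> W k k e'" "i \<noteq> k \<or> e + e' \<noteq> d i"
  shows "tr (G \<circ> F) = 0"
proof (rule ccontr)
  assume "tr (G \<circ> F) \<noteq> 0"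
  from tr_comp_nonzero[OF assms(1,1,2,2,3,4) this] assms(5) show False by auto
qed

text \<open>The endomorphisms prescribed for the basis and the partners they need. For nonzero
  \<open>d i\<close>, \<open>\<Theta> i\<close> is isotropic and pairs with the identity of
  \<open>P i\<close>. For \<open>d i = 0\<close> the identity is a multiple of
  \<open>\<Theta> i\<close>, which is then its own partner, so the identity has to be left
  out.\<close>

definition initial where
  "initial = \<Theta> ` I \<union> (\<lambda>i. E i i (one i)) ` {i \<in> I. d i \<noteq> 0}"

text \<open>A complement of \<open>\<Theta> i\<close> has degree 0, here the top degree, so it is
  itself a multiple of \<open>\<Theta> i\<close>.\<close>

lemma tr_\<Theta>_\<Theta>:
  assumes "i \<in> I" "d i = 0"
  shows "tr (\<Theta> i \<circ> \<Theta> i) \<noteq> 0"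
proof -
  have "\<Theta> i \<noteq> 0" using tr_\<Theta>[OF assms(1)] tr_zero by (metis zero_neq_one)
  then obtain Y where Y: "Y \<in> W i i (d i - d i)" "tr (\<Theta> i \<circ> Y) \<noteq> 0"
    using exists_complement[OF assms(1,1) \<Theta>_W[OF assms(1)]] by blast
  then have "Y = vscale (tr Y) (\<Theta> i)" using W_top[OF assms(1)] assms(2) by simp
  then have "\<Theta> i \<circ> Y = vscale (tr Y) (\<Theta> i \<circ> \<Theta> i)"
    using comp_scale_right[OF \<Theta>_B \<Theta>_B, OF assms(1,1)] by metis
  then show ?thesis using Y(2) tr_scale[OF B_comp[OF \<Theta>_B \<Theta>_B], OF assms(1,1)] by auto
qed

text \<open>The trace of a composite survives only if the indices agree and the degrees add up to
  \<open>d i\<close>. With \<open>\<Theta> i\<close> in degree \<open>d i\<close> and the identity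
  in degree 0, only the intended pairs remain.\<close>

lemma paired_initial: "paired (\<lambda>F G. tr (F \<circ> G)) initial"
  unfolding paired_def
proof
  have \<Theta>\<Theta>: "tr (\<Theta> k \<circ> \<Theta> i) = 0" if "i \<in> I" "k \<in> I" "i \<noteq> k \<or> d k \<noteq> 0" for i k
    by (rule tr_diagonal_zero[OF that(1,2) \<Theta>_W \<Theta>_W]) (use that in auto)
  have \<Theta>I: "tr (\<Theta> k \<circ> E i i (one i)) = 0" if "i \<in> I" "k \<in> I" "i \<noteq> k" for i k
    by (rule tr_diagonal_zero[OF that(1,2) one_W \<Theta>_W]) (use that in auto)
  have I\<Theta>: "tr (E k k (one k) \<circ> \<Theta> i) = 0" if "i \<in> I" "k \<in> I" "i \<noteq> k" for i k
    by (rule tr_diagonal_zero[OF that(1,2) \<Theta>_W one_W]) (use that in auto)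
  have II: "tr (E k k (one k) \<circ> E i i (one i)) = 0" if "i \<in> I" "k \<in> I" "i \<noteq> k \<or> d k \<noteq> 0" for i k
    by (rule tr_diagonal_zero[OF that(1,2) one_W one_W]) (use that in auto)
  fix u assume "u \<in> initial"
  then obtain i where i: "i \<in> I" and u: "u = \<Theta> i \<or> u = E i i (one i) \<and> d i \<noteq> 0"
    unfolding initial_def by blast
  have other: "\<exists>j\<in>I. w = \<Theta> j \<or> w = E j j (one j) \<and> d j \<noteq> 0" if "w \<in> initial" for w
    using that unfolding initial_def by blast
  consider (theta0) "d i = 0" "u = \<Theta> i" | (theta) "d i \<noteq> 0" "u = \<Theta> i"
    | (one) "d i \<noteq> 0" "u = E i i (one i)"
    using u by blast
  then show "\<exists>v\<in>initial. tr (u \<circ> v) \<noteq> 0 \<and> (\<forall>w\<in>initial. w \<noteq> v \<longrightarrow> tr (u \<circ> w) = 0)"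
  proof cases
    case theta0
    have "tr (u \<circ> w) = 0" if "w \<in> initial" "w \<noteq> \<Theta> i" for w
      using other[OF that(1)] that(2) theta0 i \<Theta>\<Theta> \<Theta>I by metis
    moreover have "\<Theta> i \<in> initial" using i unfolding initial_def by blast
    ultimately show ?thesis using tr_\<Theta>_\<Theta>[OF i theta0(1)] theta0(2) by blast
  next
    case theta
    have "tr (u \<circ> w) = 0" if "w \<in> initial" "w \<noteq> E i i (one i)" for w
      using other[OF that(1)] that(2) theta i \<Theta>\<Theta> \<Theta>I by metis
    moreover have "tr (u \<circ> E i i (one i)) \<noteq> 0" using \<Theta>_comp_one tr_\<Theta> theta i by simp
    moreover have "E i i (one i) \<in> initial" using i theta(1) unfolding initial_def by blast
    ultimately show ?thesis by blast
  next
    case one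
    have "tr (u \<circ> w) = 0" if "w \<in> initial" "w \<noteq> \<Theta> i" for w
      using other[OF that(1)] that(2) one i I\<Theta> II by metis
    moreover have "tr (u \<circ> \<Theta> i) \<noteq> 0"
      using tr_sym[OF W_B[OF i i one_W[OF i]] \<Theta>_B[OF i]] \<Theta>_comp_one[OF i] tr_\<Theta>[OF i] one by simp
    moreover have "\<Theta> i \<in> initial" using i unfolding initial_def by blast
    ultimately show ?thesis by blast
  qed
qed

text \<open>The partner map of a paired basis matches dual blocks, which gives equal cardinalities,
  and supplies the \<open>g\<close> belonging to \<open>f\<close>. Top degrees agree wherever a
  block meets the basis, since basis elements are nonzero.\<close>

lemma exists_admissible_basis: "\<exists>\<Upsilon>. admissible_basis s I P \<theta> \<Upsilon>"
proof -
  have init: "initial \<subseteq> (\<Union>t\<in>I \<times> I \<times> UNIV. case t of (i, j, e) \<Rightarrow> W i j e)"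
    using \<Theta>_W one_W unfolding initial_def by fastforce
  have "finite initial" unfolding initial_def using fin by auto
  obtain C where C: "finite C" "B \<subseteq> vB.span C" using B_finite_span[OF finite_span_mod_hom] by blast
  obtain \<Upsilon> where \<Upsilon>: "initial \<subseteq> \<Upsilon>" "paired (\<lambda>F G. tr (F \<circ> G)) \<Upsilon>"
    "\<Upsilon> \<subseteq> (\<Union>t\<in>I \<times> I \<times> UNIV. case t of (i, j, e) \<Rightarrow> W i j e)" "finite \<Upsilon>"
    "vB.independent \<Upsilon>" "vB.span \<Upsilon> = B"
    by (rule form.exists_paired_basis[OF paired_initial init \<open>finite initial\<close> C])
  have homog: "\<exists>i\<in>I. \<exists>j\<in>I. \<exists>e. u \<in> W i j e" if "u \<in> \<Upsilon>" for u using \<Upsilon>(3) that by fastforce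
  have \<Upsilon>B: "u \<in> B" if "u \<in> \<Upsilon>" for u using \<Upsilon>(6) vB.span_base that by blast
  obtain p where p: "\<And>u. u \<in> \<Upsilon> \<Longrightarrow> p u \<in> \<Upsilon>" "\<And>u. u \<in> \<Upsilon> \<Longrightarrow> p (p u) = u"
    "\<And>u. u \<in> \<Upsilon> \<Longrightarrow> tr (u \<circ> p u) \<noteq> 0"
    "\<And>u w. u \<in> \<Upsilon> \<Longrightarrow> w \<in> \<Upsilon> \<Longrightarrow> w \<noteq> p u \<Longrightarrow> tr (u \<circ> w) = 0"
    by (rule paired_partner[OF \<Upsilon>(2)]) (use tr_sym \<Upsilon>B in blast)+
  have pW: "p u \<in> W j i (d i - e)" if u: "i \<in> I" "j \<in> I" "u \<in> \<Upsilon>" "u \<in> W i j e" for i j e u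
  proof -
    obtain k l e' where k: "k \<in> I" "l \<in> I" "p u \<in> W k l e'" using homog p(1) u(3) by blast
    have "tr (p u \<circ> u) \<noteq> 0" using p(3)[OF u(3)] tr_comp_homogeneous[OF u(1,2,4) k] by simp
    from tr_comp_nonzero[OF u(1,2) k(1,2) u(4) k(3) this] k(3) show ?thesis by simp
  qed
  have block: "d j = d i \<and> card (\<Upsilon> \<inter> W j i (d i - e)) = card (\<Upsilon> \<inter> W i j e) \<and>
      (\<forall>f\<in>\<Upsilon> \<inter> W i j e. \<exists>!g. g \<in> \<Upsilon> \<inter> W j i (d i - e) \<and>
        (\<exists>c. c \<noteq> 0 \<and> g \<circ> f = vscale c (\<Theta> i) \<and> f \<circ> g = vscale c (\<Theta> j)) \<and>
        (\<forall>h\<in>\<Upsilon> \<inter> W j i (d i - e). h \<noteq> g \<longrightarrow> h \<circ> f = 0 \<and> f \<circ> h = 0))"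
    if i: "i \<in> I" and j: "j \<in> I" and ne: "\<Upsilon> \<inter> W i j e \<noteq> {}" for i j e
  proof -
    have nz: "u \<noteq> 0" if "u \<in> \<Upsilon>" for u using \<Upsilon>(5) vB.dependent_zero that by blast
    obtain u where "u \<in> \<Upsilon>" "u \<in> W i j e" using ne by blast
    then have dij: "d i = d j" using top_degree_eq[OF i j] nz by blast
    then have e: "d j - (d i - e) = e" by simp
    \<comment> \<open>The partner map is its own inverse, and the dual of the dual block is the
      block itself because \<open>d i = d j\<close>.\<close>
    have "bij_betw p (\<Upsilon> \<inter> W i j e) (\<Upsilon> \<inter> W j i (d i - e))"
    proof (rule bij_betw_byWitness[where f' = p])
      show "p ` (\<Upsilon> \<inter> W i j e) \<subseteq> \<Upsilon> \<inter> W j i (d i - e)" using p(1) pW[OF i j] by blast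
      show "p ` (\<Upsilon> \<inter> W j i (d i - e)) \<subseteq> \<Upsilon> \<inter> W i j e" using p(1) pW[OF j i, of _ "d i - e"] e by auto
    qed (use p(2) in auto)
    then have "card (\<Upsilon> \<inter> W j i (d i - e)) = card (\<Upsilon> \<inter> W i j e)" by (simp add: bij_betw_same_card)
    moreover have "\<exists>!g. g \<in> \<Upsilon> \<inter> W j i (d i - e) \<and>
        (\<exists>c. c \<noteq> 0 \<and> g \<circ> f = vscale c (\<Theta> i) \<and> f \<circ> g = vscale c (\<Theta> j)) \<and>
        (\<forall>h\<in>\<Upsilon> \<inter> W j i (d i - e). h \<noteq> g \<longrightarrow> h \<circ> f = 0 \<and> f \<circ> h = 0)"
      if f: "f \<in> \<Upsilon>" "f \<in> W i j e" for f
    proof -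
      \<comment> \<open>Both composites lie in top blocks and are determined by their common trace.
        Values of the form thereby become identities between maps, with one scalar for both
        products.\<close>
      have comp: "h \<circ> f = vscale (tr (f \<circ> h)) (\<Theta> i)" "f \<circ> h = vscale (tr (f \<circ> h)) (\<Theta> j)"
        if h: "h \<in> W j i (d i - e)" for h
      proof -
        have "h \<circ> f \<in> W i i (d i)" "f \<circ> h \<in> W j j (d j)"
          using W_comp[OF i j i f(2) h] W_comp[OF j i j h f(2)] dij by auto
        then show "h \<circ> f = vscale (tr (f \<circ> h)) (\<Theta> i)" "f \<circ> h = vscale (tr (f \<circ> h)) (\<Theta> j)"
          using W_top[OF i] W_top[OF j] tr_comp_homogeneous[OF i j f(2) j i h] by metis+
      qed
      have orth: "h \<circ> f = 0 \<and> f \<circ> h = 0" if h: "h \<in> \<Upsilon> \<inter> W j i (d i - e)" "h \<noteq> p f" for h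
        using comp[of h] p(4)[OF f(1), of h] h vB.scale_zero_left by auto
      show ?thesis
      proof (rule ex1I[of _ "p f"])
        have pf: "p f \<in> \<Upsilon> \<inter> W j i (d i - e)" using p(1)[OF f(1)] pW[OF i j f] by blast
        then show "p f \<in> \<Upsilon> \<inter> W j i (d i - e) \<and>
          (\<exists>c. c \<noteq> 0 \<and> p f \<circ> f = vscale c (\<Theta> i) \<and> f \<circ> p f = vscale c (\<Theta> j)) \<and>
          (\<forall>h\<in>\<Upsilon> \<inter> W j i (d i - e). h \<noteq> p f \<longrightarrow> h \<circ> f = 0 \<and> f \<circ> h = 0)"
          using orth comp[of "p f"] p(3)[OF f(1)] by blast
      next
        fix g assume g: "g \<in> \<Upsilon> \<inter> W j i (d i - e) \<and>
          (\<exists>c. c \<noteq> 0 \<and> g \<circ> f = vscale c (\<Theta> i) \<and> f \<circ> g = vscale c (\<Theta> j)) \<and>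
          (\<forall>h\<in>\<Upsilon> \<inter> W j i (d i - e). h \<noteq> g \<longrightarrow> h \<circ> f = 0 \<and> f \<circ> h = 0)"
        then obtain c where "c \<noteq> 0" "f \<circ> g = vscale c (\<Theta> j)" by blast
        then have "tr (f \<circ> g) \<noteq> 0" using tr_scale[OF \<Theta>_B[OF j]] tr_\<Theta>[OF j] by simp
        then show "g = p f" using p(4)[OF f(1), of g] g by blast
      qed
    qed
    ultimately show ?thesis using dij by simp
  qed
  have appropriate: "appropriate_basis s I P \<theta> \<Upsilon>"
    unfolding appropriate_basis_def
  proof (intro conjI)
    show "\<Theta> ` I \<subseteq> \<Upsilon>" using \<Upsilon>(1) unfolding initial_def by blast
    show "\<Upsilon> \<subseteq> (\<Union>\<kappa>\<in>I. \<Union>\<mu>\<in>I. hom_block I P \<kappa> \<mu>)"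
    proof
      fix u assume "u \<in> \<Upsilon>"
      then obtain i j e where u: "i \<in> I" "j \<in> I" "u \<in> W i j e" using homog by blast
      then have "u \<in> hom_block I P i j"
        by (auto simp: W_iff hom_block_def dest: mod_hom_degD(1))
      then show "u \<in> (\<Union>\<kappa>\<in>I. \<Union>\<mu>\<in>I. hom_block I P \<kappa> \<mu>)" using u by blast
    qed
  qed (use \<Upsilon>(5,6) in auto)
  have subset: "\<Upsilon> \<subseteq> (\<Union>\<kappa>\<in>I. \<Union>\<mu>\<in>I. \<Union>j. W \<kappa> \<mu> j)"
  proof
    fix u assume "u \<in> \<Upsilon>"
    then show "u \<in> (\<Union>\<kappa>\<in>I. \<Union>\<mu>\<in>I. \<Union>j. W \<kappa> \<mu> j)" using homog[of u] by simp
  qed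
  have "admissible_basis s I P \<theta> \<Upsilon>"
    unfolding admissible_basis_def Let_def
    by (rule conjI[OF appropriate conjI[OF subset]]) (intro ballI allI impI, rule block)
  then show ?thesis ..
qed

end

section \<open>Normalizing the form and the socle endomorphisms\<close>

context socle_projective
begin

text \<open>The image is generated by \<open>f gen\<close>, which lies in the component of top
  degree, that is, in the socle.\<close>

lemma hom_top_degree_socle:
  assumes f: "f \<in> mod_hom_deg P P (top_degree P)"
  shows "f ` car P \<subseteq> socle sP P"
proof (rule image_subsetI)
  fix x assume "x \<in> car P"
  then obtain a where "x = act P a gen" using generated by blast
  moreover have "f gen \<in> socle sP P" using mod_hom_degD(2)[OF f gen(1)] top_socle by simp
  ultimately show "f x \<in> socle sP P"
    using mod_homD(4)[OF mod_hom_degD(1)[OF f] gen(3)]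
      submoduleD(4)[OF submodule_socle[OF fdP fd_algebra_axioms]] by simp
qed

lemma socle_endo_scale:
  assumes \<theta>: "\<theta> \<in> mod_hom P P" "\<theta> \<noteq> 0" "\<theta> ` car P = socle sP P" and "c \<noteq> 0"
  shows "fscale sP c \<theta> \<in> mod_hom P P" "fscale sP c \<theta> \<noteq> 0"
    "fscale sP c \<theta> ` car P = socle sP P"
proof -
  interpret vP: vector_space sP using fd_moduleD(1)[OF fdP] .
  show "fscale sP c \<theta> \<in> mod_hom P P" by (rule mod_hom_fscale[OF fdP fd_algebra_axioms \<theta>(1)])
  show "fscale sP c \<theta> \<noteq> 0" using \<theta>(2) \<open>c \<noteq> 0\<close> by (auto simp: fscale_def fun_eq_iff)
  have "vP.subspace (socle sP P)" unfolding socle_def by (rule vP.subspace_span)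
  then have sc: "sP b x \<in> socle sP P" if "x \<in> socle sP P" for b x using that vP.subspace_scale by blast
  have "fscale sP c \<theta> ` car P = sP c ` socle sP P"
    unfolding \<theta>(3)[symmetric] by (simp add: fscale_def image_image)
  also have "\<dots> = socle sP P"
  proof (intro equalityI subsetI)
    fix x assume "x \<in> socle sP P"
    then have "x = sP c (sP (inverse c) x)" "sP (inverse c) x \<in> socle sP P" using \<open>c \<noteq> 0\<close> sc by auto
    then show "x \<in> sP c ` socle sP P" by (rule image_eqI)
  qed (use sc in auto)
  finally show "fscale sP c \<theta> ` car P = socle sP P" .
qed

end

context socle_family
begin

text \<open>If \<tau> vanished at \<open>\<Theta> i\<close>, nondegeneracy would give a homogeneous
  \<open>Y\<close> with \<open>\<tau> (\<Theta> i \<circ> Y)\<close> nonzero. Symmetry makes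
  \<open>Y\<close> an endomorphism of \<open>P i\<close>, and the degree bounds leave degree 0; but
  then \<open>\<Theta> i \<circ> Y\<close> lies in the top block and is a multiple of
  \<open>\<Theta> i\<close>, on which \<tau> vanishes.\<close>

lemma symmetrizing_form_\<Theta>_nonzero:
  assumes add: "\<And>F G. F \<in> B \<Longrightarrow> G \<in> B \<Longrightarrow> \<tau> (F + G) = \<tau> F + \<tau> G"
    and scal: "\<And>c F. F \<in> B \<Longrightarrow> \<tau> (vscale c F) = c * \<tau> F"
    and sym: "\<And>F G. F \<in> B \<Longrightarrow> G \<in> B \<Longrightarrow> \<tau> (F \<circ> G) = \<tau> (G \<circ> F)"
    and nondeg: "\<And>F. F \<in> B \<Longrightarrow> (\<And>G. G \<in> B \<Longrightarrow> \<tau> (F \<circ> G) = 0) \<Longrightarrow> F = 0"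
    and i: "i \<in> I"
  shows "\<tau> (\<Theta> i) \<noteq> (0 :: 'k)"
proof
  assume \<tau>\<Theta>: "\<tau> (\<Theta> i) = 0"
  have 0: "\<tau> 0 = 0" using scal[of 0 0] vB.subspace_0[OF subspace_B] by simp
  have "\<Theta> i \<noteq> 0" using tr_\<Theta>[OF i] tr_zero by (metis zero_neq_one)
  then obtain G where G: "G \<in> B" "\<tau> (\<Theta> i \<circ> G) \<noteq> 0" using nondeg[OF \<Theta>_B[OF i]] by blast
  obtain k l e Y where Y: "k \<in> I" "l \<in> I" "Y \<in> W k l e" "\<tau> (\<Theta> i \<circ> Y) \<noteq> 0"
    using exists_homogeneous_nonzero[OF add scal \<Theta>_B[OF i] G] by blast
  have l: "l = i" using W_comp_zero[OF Y(1,2) i Y(3) \<Theta>_W[OF i]] Y(4) 0 by metis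
  have "\<tau> (Y \<circ> \<Theta> i) \<noteq> 0" using Y(4) sym[OF \<Theta>_B[OF i] W_B[OF Y(1-3)]] by simp
  then have k: "k = i" using W_comp_zero[OF i i Y(1) \<Theta>_W[OF i] Y(3)] 0 by metis
  have YW: "Y \<in> W i i e" using Y(3) k l by simp
  have \<Theta>Y: "\<Theta> i \<circ> Y \<in> W i i (e + d i)" by (rule W_comp[OF i i i YW \<Theta>_W[OF i]])
  have "\<Theta> i \<circ> 0 = (0 :: ('l \<Rightarrow> 'm) \<Rightarrow> _)" by (rule comp_zero(1)[OF \<Theta>_B[OF i]])
  then have "Y \<noteq> 0" "\<Theta> i \<circ> Y \<noteq> 0" using Y(4) 0 by metis+
  then have "e = 0" using W_degrees[OF i i YW] W_degrees[OF i i \<Theta>Y] by simp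
  then have "\<Theta> i \<circ> Y = vscale (tr (\<Theta> i \<circ> Y)) (\<Theta> i)" using W_top[OF i] \<Theta>Y by simp
  then have "\<tau> (\<Theta> i \<circ> Y) = tr (\<Theta> i \<circ> Y) * \<tau> (\<Theta> i)" using scal[OF \<Theta>_B[OF i]] by metis
  then show False using Y(4) \<tau>\<Theta> by simp
qed

end

theorem corollary3p12:
  fixes sA :: "'k::alg_closed_field \<Rightarrow> 'a::ring_1 \<Rightarrow> 'a"
    and GA :: "nat \<Rightarrow> 'a set"
    and sL :: "'k \<Rightarrow> 'n::ab_group_add \<Rightarrow> 'n"
    and sP :: "'k \<Rightarrow> 'm::ab_group_add \<Rightarrow> 'm"
    and \<Lambda> \<Lambda>\<^sub>0 :: "'l set"
    and L :: "'l \<Rightarrow> ('a, 'n) gmodule"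
    and P :: "'l \<Rightarrow> ('a, 'm) gmodule"
    and \<pi> :: "'l \<Rightarrow> 'm \<Rightarrow> 'n"
  assumes "pos_graded_fd_algebra sA GA"
    and "complete_simples sA sL \<Lambda> L"
    and "\<And>\<kappa>. \<kappa> \<in> \<Lambda> \<Longrightarrow> graded_module sA GA sL (L \<kappa>) \<and> concentrated (L \<kappa>) 0"
    and "\<And>\<kappa>. \<kappa> \<in> \<Lambda> \<Longrightarrow> graded_module sA GA sP (P \<kappa>)"
    and "\<And>\<kappa>. \<kappa> \<in> \<Lambda> \<Longrightarrow> projective_cover sA (P \<kappa>) (\<pi> \<kappa>) (L \<kappa>)"
    and "\<And>\<kappa>. \<kappa> \<in> \<Lambda> \<Longrightarrow> \<pi> \<kappa> \<in> mod_hom_deg (P \<kappa>) (L \<kappa>) 0"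
    and "\<Lambda>\<^sub>0 = {\<kappa> \<in> \<Lambda>. injective_module sA (P \<kappa>)}"
    and "\<Lambda>\<^sub>0 \<noteq> {}"
    and "\<And>\<kappa>. \<kappa> \<in> \<Lambda>\<^sub>0 \<Longrightarrow> grade (P \<kappa>) (top_degree (P \<kappa>)) = socle sP (P \<kappa>)"
    and "\<And>\<kappa>. \<kappa> \<in> \<Lambda>\<^sub>0 \<Longrightarrow>
      graded_iso (graded_restrict (P \<kappa>) (socle sP (P \<kappa>))) (shift (L \<kappa>) (top_degree (P \<kappa>)))"
  shows "symmetric_algebra (fscale (fscale sP)) (endo_algebra \<Lambda>\<^sub>0 P) \<longleftrightarrow>
    (\<exists>\<theta> \<Upsilon>. socle_endos sP \<Lambda>\<^sub>0 P \<theta> \<and> admissible_basis sP \<Lambda>\<^sub>0 P \<theta> \<Upsilon>)"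
proof -
  have loc: "local_projective sA GA sP sL (P \<kappa>) (L \<kappa>) (\<pi> \<kappa>)" if "\<kappa> \<in> \<Lambda>" for \<kappa>
  proof -
    have "simple_module (L \<kappa>)" using assms(2) that unfolding complete_simples_def by simp
    then show ?thesis
      using assms(3)[OF that]
      by (intro local_projective.intro local_projective_axioms.intro assms(1,4-6) that) simp_all
  qed
  have \<Lambda>0: "\<kappa> \<in> \<Lambda>" if "\<kappa> \<in> \<Lambda>\<^sub>0" for \<kappa> using that assms(7) by blast
  have soc: "socle_projective sA GA sP sL (P \<kappa>) (L \<kappa>) (\<pi> \<kappa>)" if "\<kappa> \<in> \<Lambda>\<^sub>0" for \<kappa>
    by (intro socle_projective.intro socle_projective_axioms.intro loc \<Lambda>0 assms(9,10) that)
  \<comment> \<open>Endomorphisms of the direct sum are handled as finite matrices, so the index set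
    has to be shown finite.\<close>
  have "finite \<Lambda>"
  proof (rule finite_simple_index[OF loc])
    show "\<kappa> = \<mu>" if "\<kappa> \<in> \<Lambda>" "\<mu> \<in> \<Lambda>" "mod_iso (L \<kappa>) (L \<mu>)" for \<kappa> \<mu>
      using assms(2) that unfolding complete_simples_def by blast
  qed
  then have fin: "finite \<Lambda>\<^sub>0" using assms(7) by simp
  \<comment> \<open>The vector space axioms for \<open>sP\<close> are part of the module axioms, so
    a member of \<open>\<Lambda>\<^sub>0\<close> is called upon to supply them.\<close>
  obtain \<kappa>0 where "\<kappa>0 \<in> \<Lambda>\<^sub>0" using assms(8) by blast
  then have vs: "vector_space sP" by (rule fd_moduleD(1)[OF graded_moduleD(1)[OF assms(4)[OF \<Lambda>0]]])
  define x0 where "x0 \<kappa> = local_projective.gen (P \<kappa>) (\<pi> \<kappa>)" for \<kappa>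
  have fam: "socle_family sA GA sP \<Lambda>\<^sub>0 P \<theta> x0" if \<theta>: "socle_endos sP \<Lambda>\<^sub>0 P \<theta>" for \<theta>
  proof (intro socle_family.intro hom_family.intro hom_family_axioms.intro socle_family_axioms.intro
      assms(1) fin vs)
    fix i assume i: "i \<in> \<Lambda>\<^sub>0"
    then interpret socle_projective sA GA sP sL "P i" "L i" "\<pi> i" by (rule soc)
    have \<theta>i: "\<theta> i \<in> mod_hom (P i) (P i)" "\<theta> i \<noteq> 0" "\<theta> i ` car (P i) = socle sP (P i)"
      using \<theta> i unfolding socle_endos_def by blast+
    show "graded_module sA GA sP (P i)" by (rule P)
    show "x0 i \<in> grade (P i) 0" unfolding x0_def by (rule gen(1))
    show "0 \<le> k \<and> k \<le> top_degree (P i)" if "grade (P i) k \<noteq> {0}" for k by (rule grade_bounds[OF that])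
    show "\<theta> i \<in> mod_hom_deg (P i) (P i) (top_degree (P i))" by (rule socle_endo_deg[OF \<theta>i])
    show "\<theta> i \<noteq> 0" by (rule \<theta>i(2))
    show "\<exists>c. f = fscale sP c (\<theta> i)" if "f \<in> mod_hom_deg (P i) (P i) (top_degree (P i))" for f
      by (rule socle_hom_unique[OF \<theta>i mod_hom_degD(1)[OF that] hom_top_degree_socle[OF that]])
    fix j assume j: "j \<in> \<Lambda>\<^sub>0"
    then interpret j: socle_projective sA GA sP sL "P j" "L j" "\<pi> j" by (rule soc)
    show "f = 0" if "f \<in> mod_hom (P i) (P j)" "f (x0 i) = 0" for f
      using hom_eq_zero_gen[OF that(1) j.fdP] that(2) unfolding x0_def .
    have \<theta>j: "\<theta> j \<in> mod_hom (P j) (P j)" "\<theta> j ` car (P j) = socle sP (P j)"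
      using \<theta> j unfolding socle_endos_def by blast+
    show "\<exists>g\<in>mod_hom (P j) (P i). f \<circ> g = \<theta> j" if "f \<in> mod_hom (P i) (P j)" "f \<noteq> 0" for f
      using j.lift_socle_endo[OF \<theta>j fdP that] by blast
  qed
  show ?thesis
  proof
    assume "\<exists>\<theta> \<Upsilon>. socle_endos sP \<Lambda>\<^sub>0 P \<theta> \<and> admissible_basis sP \<Lambda>\<^sub>0 P \<theta> \<Upsilon>"
    then obtain \<theta> \<Upsilon> where "socle_endos sP \<Lambda>\<^sub>0 P \<theta>" "admissible_basis sP \<Lambda>\<^sub>0 P \<theta> \<Upsilon>" by blast
    then show "symmetric_algebra (fscale (fscale sP)) (endo_algebra \<Lambda>\<^sub>0 P)"
      using socle_family.admissible_imp_symmetric[OF fam] by blast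
  next
    let ?B = "endo_algebra \<Lambda>\<^sub>0 P" and ?s = "fscale (fscale sP)"
    assume "symmetric_algebra ?s ?B"
    then obtain \<tau> where \<tau>0: "\<forall>F\<in>?B. \<forall>G\<in>?B. \<tau> (F + G) = \<tau> F + \<tau> G"
      "\<forall>c. \<forall>F\<in>?B. \<tau> (?s c F) = c * \<tau> F"
      "\<forall>F\<in>?B. \<forall>G\<in>?B. \<tau> (F \<circ> G) = \<tau> (G \<circ> F)"
      "\<forall>F\<in>?B. (\<forall>G\<in>?B. \<tau> (F \<circ> G) = 0) \<longrightarrow> F = 0"
      unfolding symmetric_algebra_def by (elim exE conjE) (rule that)
    have \<tau>: "\<tau> (F + G) = \<tau> F + \<tau> G" "\<tau> (F \<circ> G) = \<tau> (G \<circ> F)" if "F \<in> ?B" "G \<in> ?B" for F G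
      using \<tau>0(1,3) that by simp_all
    have \<tau>s: "\<tau> (?s c F) = c * \<tau> F" if "F \<in> ?B" for c F using \<tau>0(2) that by simp
    have \<tau>n: "F = 0" if "F \<in> ?B" "\<And>G. G \<in> ?B \<Longrightarrow> \<tau> (F \<circ> G) = 0" for F
      using \<tau>0(4) that by simp
    have "\<forall>i\<in>\<Lambda>\<^sub>0. \<exists>\<theta>. \<theta> \<in> mod_hom (P i) (P i) \<and> \<theta> \<noteq> 0 \<and> \<theta> ` car (P i) = socle sP (P i)"
      using socle_projective.exists_socle_endo[OF soc] by simp
    from bchoice[OF this] obtain \<theta>0 where \<theta>0: "socle_endos sP \<Lambda>\<^sub>0 P \<theta>0"
      unfolding socle_endos_def ..
    interpret f0: socle_family sA GA sP \<Lambda>\<^sub>0 P \<theta>0 x0 by (rule fam[OF \<theta>0])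
    \<comment> \<open>The family \<open>\<theta>0\<close> is an arbitrary choice; dividing by the
      values of \<tau> makes \<tau> equal to 1 on every rescaled socle endomorphism.\<close>
    define c where "c i = inverse (\<tau> (embed_hom \<Lambda>\<^sub>0 P i i (\<theta>0 i)))" for i
    have nz: "\<tau> (embed_hom \<Lambda>\<^sub>0 P i i (\<theta>0 i)) \<noteq> 0" if "i \<in> \<Lambda>\<^sub>0" for i
      by (rule f0.symmetrizing_form_\<Theta>_nonzero[OF \<tau>(1) \<tau>s \<tau>(2) \<tau>n that])
    define \<theta> where "\<theta> i = fscale sP (c i) (\<theta>0 i)" for i
    have \<theta>: "socle_endos sP \<Lambda>\<^sub>0 P \<theta>"
      unfolding socle_endos_def \<theta>_def
    proof (intro ballI conjI)
      fix i assume i: "i \<in> \<Lambda>\<^sub>0"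
      have \<theta>i: "\<theta>0 i \<in> mod_hom (P i) (P i)" "\<theta>0 i \<noteq> 0" "\<theta>0 i ` car (P i) = socle sP (P i)"
        using \<theta>0 i unfolding socle_endos_def by blast+
      have "c i \<noteq> 0" using nz[OF i] by (simp add: c_def)
      note sc = socle_projective.socle_endo_scale[OF soc[OF i] \<theta>i this]
      show "fscale sP (c i) (\<theta>0 i) \<in> mod_hom (P i) (P i)" "fscale sP (c i) (\<theta>0 i) \<noteq> 0"
        "fscale sP (c i) (\<theta>0 i) ` car (P i) = socle sP (P i)"
        using sc by blast+
    qed
    have "\<tau> (embed_hom \<Lambda>\<^sub>0 P i i (\<theta> i)) = 1" if "i \<in> \<Lambda>\<^sub>0" for i
      using nz[OF that] \<tau>s[OF f0.\<Theta>_B[OF that]] by (simp add: \<theta>_def f0.E_scale c_def)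
    then have "symmetrized_socle_family sA GA sP \<Lambda>\<^sub>0 P \<theta> x0 \<tau>"
      by (intro symmetrized_socle_family.intro symmetrized_socle_family_axioms.intro fam \<theta> \<tau>s \<tau>(2))
    then show "\<exists>\<theta> \<Upsilon>. socle_endos sP \<Lambda>\<^sub>0 P \<theta> \<and> admissible_basis sP \<Lambda>\<^sub>0 P \<theta> \<Upsilon>"
      using \<theta> symmetrized_socle_family.exists_admissible_basis by blast
  qed
qed

end
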